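(* (i) For $d\ge3$, $(x_n^{(d)})_n$ is a $P$-recursive sequence, transcendental over $\mathbb C$, but algebraic modulo $p$ for every prime $p$. (ii) For $d\ge2$, $(A_{2n}^{(d)})_n$ is a $P$-recursive sequence, transcendental over $\mathbb C$, but algebraic modulo $p$ for every prime $p$. (iii) For $d\ge2$, $(B_{2n}^{(d)})_n$ is not a $P$-recursive sequence.
   Context: A walk of length $n$ in $\mathbb Z^d$ is a sequence of $n$ steps, each one of $\pm e_1,\dots,\pm e_d$, starting at the origin. $A_{2n}^{(d)}$ is the number of walks of length $2n$ that end at the origin ($A_0^{(d)}=1$), $x_n^{(d)}=A_{2n}^{(d)}/\binom{2n}n$ (an integer), and for $n\ge1$, $B_{2n}^{(d)}$ is the number of walks of length $2n$ that return to the origin for the first time at time $2n$. A sequence $(f_n)_n$ in a field $K$ is $P$-recursive if there are polynomials $P_0,\dots,P_r\in K[z]$, not all zero, with $\sum_{k=0}^rP_k(n)f_{n+k}=0$ for all $n\ge n_0$; here $K=\mathbb C$. A sequence $(f_n)$ is algebraic over $K$ if its generating formal power series $f=\sum f_nz^n$ is algebraic over $K(z)$ (i.e. $\sum_{k=0}^rQ_kf^k=0$ for some $Q_k\in K[z]$ not all zero), and transcendental over $K$ otherwise. An integer sequence is algebraic modulo a prime $p$ if its reduction mod $p$ is algebraic over $\mathbb Z/p$. *)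

theory Defs
  imports
    Complex_Main
    "HOL-Computational_Algebra.Computational_Algebra"
    "Berlekamp_Zassenhaus.Finite_Field"
begin

section \<open>Walks\<close>

text \<open>
  A point of \<open>\<int>\<^sup>d\<close> is a function \<open>nat \<Rightarrow> int\<close> that vanishes outside \<open>{..<d}\<close>;
  the signed unit vector \<open>unit_step i s\<close> is \<open>s * e\<^sub>i\<close>.
\<close>

definition unit_step :: "nat \<Rightarrow> int \<Rightarrow> nat \<Rightarrow> int" where
  "unit_step i s = (\<lambda>j. if j = i then s else 0)"

definition steps :: "nat \<Rightarrow> (nat \<Rightarrow> int) set" where
  "steps d = {unit_step i s |i s. i < d \<and> s \<in> {1, -1}}"

definition walks :: "nat \<Rightarrow> nat \<Rightarrow> (nat \<Rightarrow> int) list set" where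
  "walks d n = {w. set w \<subseteq> steps d \<and> length w = n}"

definition endpoint :: "(nat \<Rightarrow> int) list \<Rightarrow> nat \<Rightarrow> int" where
  "endpoint w = (\<lambda>j. \<Sum>s\<leftarrow>w. s j)"

definition closed_walks :: "nat \<Rightarrow> nat \<Rightarrow> (nat \<Rightarrow> int) list set" where
  "closed_walks d n = {w \<in> walks d n. endpoint w = (\<lambda>j. 0)}"

definition first_return_walks :: "nat \<Rightarrow> nat \<Rightarrow> (nat \<Rightarrow> int) list set" where
  "first_return_walks d n =
     {w \<in> closed_walks d n. 0 < n \<and> (\<forall>k. 0 < k \<and> k < n \<longrightarrow> endpoint (take k w) \<noteq> (\<lambda>j. 0))}"

text \<open>
  The argument \<open>n\<close> of the next three functions is half the length of the walks.
  The division in \<open>x_seq\<close> is exact, see \<open>x_seq_mult_central_binomial\<close> below.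
  The value \<open>B_seq d 0 = 0\<close> is a convention; it does not affect P-recursiveness,
  which only concerns large indices.
\<close>

definition A_seq :: "nat \<Rightarrow> nat \<Rightarrow> nat" where
  "A_seq d n = card (closed_walks d (2 * n))"

definition x_seq :: "nat \<Rightarrow> nat \<Rightarrow> nat" where
  "x_seq d n = A_seq d n div ((2 * n) choose n)"

definition B_seq :: "nat \<Rightarrow> nat \<Rightarrow> nat" where
  "B_seq d n = card (first_return_walks d (2 * n))"


section \<open>P-recursive and algebraic sequences\<close>

definition P_recursive :: "(nat \<Rightarrow> 'a::field) \<Rightarrow> bool" where
  "P_recursive f \<longleftrightarrow>
     (\<exists>r (P :: nat \<Rightarrow> 'a poly) n0. (\<exists>k\<le>r. P k \<noteq> 0) \<and>
        (\<forall>n\<ge>n0. (\<Sum>k\<le>r. poly (P k) (of_nat n) * f (n + k)) = 0))"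

definition algebraic_seq :: "(nat \<Rightarrow> 'a::field) \<Rightarrow> bool" where
  "algebraic_seq f \<longleftrightarrow>
     (\<exists>r (Q :: nat \<Rightarrow> 'a poly). (\<exists>k\<le>r. Q k \<noteq> 0) \<and>
        (\<Sum>k\<le>r. fps_of_poly (Q k) * Abs_fps f ^ k) = 0)"

abbreviation transcendental_seq :: "(nat \<Rightarrow> 'a::field) \<Rightarrow> bool" where
  "transcendental_seq f \<equiv> \<not> algebraic_seq f"

text \<open>
  Algebraicity over \<open>\<int>/p\<close> of the reduction of an integer sequence, with polynomials and
  power series over \<open>\<int>/p\<close> represented by integral ones up to congruence of all
  coefficients.  The modulus is a term rather than a type, so that one can quantify over
  it; \<open>algebraic_seq_mod_iff\<close> shows that this is \<open>algebraic_seq\<close> over the field \<open>\<int>/p\<close>.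
\<close>

definition algebraic_seq_mod :: "nat \<Rightarrow> (nat \<Rightarrow> int) \<Rightarrow> bool" where
  "algebraic_seq_mod p f \<longleftrightarrow>
     (\<exists>r (Q :: nat \<Rightarrow> int poly). (\<exists>k\<le>r. \<exists>i. \<not> [poly.coeff (Q k) i = 0] (mod int p)) \<and>
        (\<forall>n. [fps_nth (\<Sum>k\<le>r. fps_of_poly (Q k) * Abs_fps f ^ k) n = 0] (mod int p)))"

definition fps_reduce :: "int fps \<Rightarrow> 'a::comm_ring_1 fps" where
  "fps_reduce F = Abs_fps (\<lambda>n. of_int (fps_nth F n))"

lemma fps_reduce_mult: "fps_reduce (F * G) = fps_reduce F * fps_reduce G"
  by (simp add: fps_reduce_def fps_eq_iff fps_mult_nth)

lemma fps_reduce_power: "fps_reduce (F ^ k) = fps_reduce F ^ k"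
  by (induction k) (simp_all add: fps_reduce_mult, simp add: fps_reduce_def fps_eq_iff)

lemma fps_reduce_sum: "fps_reduce (sum F A) = (\<Sum>k\<in>A. fps_reduce (F k))"
  by (simp add: fps_reduce_def fps_eq_iff fps_sum_nth)

lemma fps_reduce_fps_of_poly: "fps_reduce (fps_of_poly q) = fps_of_poly (map_poly of_int q)"
  by (simp add: fps_reduce_def fps_eq_iff coeff_map_poly)

lemma of_int_mod_ring_eq_0_iff:
  "(of_int a :: 'p::prime_card mod_ring) = 0 \<longleftrightarrow> [a = 0] (mod int CARD('p))"
  by (simp add: of_int_eq_0_iff_char_dvd cong_0_iff)

lemma fps_reduce_relation:
  "fps_reduce (\<Sum>k\<le>r. fps_of_poly (Q k) * Abs_fps f ^ k) =
     (\<Sum>k\<le>r. fps_of_poly (map_poly of_int (Q k)) * Abs_fps (\<lambda>n. of_int (f n)) ^ k)"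
  by (simp add: fps_reduce_sum fps_reduce_mult fps_reduce_power fps_reduce_fps_of_poly)
     (simp add: fps_reduce_def)

theorem algebraic_seq_mod_iff:
  "algebraic_seq_mod CARD('p::prime_card) f \<longleftrightarrow>
     algebraic_seq (\<lambda>n. of_int (f n) :: 'p mod_ring)"
proof -
  define red :: "int poly \<Rightarrow> 'p mod_ring poly" where "red = map_poly of_int"
  have red_surj: "\<exists>q. red q = q'" for q'
  proof -
    have "red (map_poly to_int_mod_ring q') = q'"
      by (rule poly_eqI) (simp add: red_def coeff_map_poly of_int_of_int_mod_ring)
    thus ?thesis by blast
  qed
  have red_nz: "red q \<noteq> 0 \<longleftrightarrow> (\<exists>i. \<not> [poly.coeff q i = 0] (mod int CARD('p)))" for q
    by (simp add: red_def poly_eq_iff coeff_map_poly of_int_mod_ring_eq_0_iff)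
  have rel: "(\<Sum>k\<le>r. fps_of_poly (red (Q k)) * Abs_fps (\<lambda>n. of_int (f n)) ^ k) = 0 \<longleftrightarrow>
     (\<forall>n. [fps_nth (\<Sum>k\<le>r. fps_of_poly (Q k) * Abs_fps f ^ k) n = 0] (mod int CARD('p)))"
    for r Q
    unfolding red_def fps_reduce_relation[symmetric]
    by (simp add: fps_reduce_def fps_eq_iff of_int_mod_ring_eq_0_iff)
  show ?thesis
  proof
    assume "algebraic_seq_mod CARD('p) f"
    then obtain r Q where "\<exists>k\<le>r. red (Q k) \<noteq> 0"
      "(\<Sum>k\<le>r. fps_of_poly (red (Q k)) * Abs_fps (\<lambda>n. of_int (f n)) ^ k) = 0"
      unfolding algebraic_seq_mod_def rel red_nz by blast
    thus "algebraic_seq (\<lambda>n. of_int (f n) :: 'p mod_ring)"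
      unfolding algebraic_seq_def by (intro exI[of _ r] exI[of _ "\<lambda>k. red (Q k)"]) simp
  next
    assume "algebraic_seq (\<lambda>n. of_int (f n) :: 'p mod_ring)"
    then obtain r Q' where Q': "\<exists>k\<le>r. Q' k \<noteq> (0 :: 'p mod_ring poly)"
      "(\<Sum>k\<le>r. fps_of_poly (Q' k) * Abs_fps (\<lambda>n. of_int (f n)) ^ k) = 0"
      unfolding algebraic_seq_def by blast
    have "\<forall>k. \<exists>q. red q = Q' k" using red_surj by blast
    then obtain Q where "\<And>k. Q' k = red (Q k)" by metis
    with Q' show "algebraic_seq_mod CARD('p) f"
      unfolding algebraic_seq_mod_def by (intro exI[of _ r] exI[of _ Q]) (auto simp: rel red_nz)
  qed
qed


section \<open>Divisibility of \<open>A_seq\<close> by the central binomial coefficient\<close>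

definition axis_walks :: "nat \<Rightarrow> nat \<Rightarrow> (nat \<Rightarrow> int) list set" where
  "axis_walks d n =
     {w. set w \<subseteq> {unit_step d 1, unit_step d (-1)} \<and> length w = n \<and> endpoint w = (\<lambda>j. 0)}"

lemma endpoint_filter:
  "endpoint w j = endpoint (filter P w) j + endpoint (filter (\<lambda>s. \<not> P s) w) j"
  by (induction w) (simp_all add: endpoint_def)

lemma unit_step_eq_iff: "s \<noteq> 0 \<Longrightarrow> unit_step i s = unit_step j t \<longleftrightarrow> i = j \<and> s = t"
  unfolding unit_step_def fun_eq_iff by (metis)

lemma steps_Suc: "steps (Suc d) = steps d \<union> {unit_step d 1, unit_step d (-1)}"
  by (auto simp: steps_def less_Suc_eq)

lemma steps_disjoint: "steps d \<inter> {unit_step d 1, unit_step d (-1)} = {}"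
  by (auto simp: steps_def unit_step_eq_iff)

lemma finite_steps: "finite (steps d)"
  by (induction d) (simp_all add: steps_Suc, simp add: steps_def)

lemma finite_closed_walks: "finite (closed_walks d n)"
  by (rule finite_subset[OF _ finite_lists_length_eq[OF finite_steps[of d], of n]])
     (auto simp: closed_walks_def walks_def)

lemma finite_axis_walks: "finite (axis_walks d n)"
  by (rule finite_subset[OF _ finite_lists_length_eq[of "{unit_step d 1, unit_step d (-1)}" n]])
     (auto simp: axis_walks_def)

lemma endpoint_steps_ge: "set w \<subseteq> steps d \<Longrightarrow> d \<le> j \<Longrightarrow> endpoint w j = 0"
  by (induction w) (auto simp: endpoint_def steps_def unit_step_def)

lemma endpoint_axis_neq:
  "set w \<subseteq> {unit_step d 1, unit_step d (-1)} \<Longrightarrow> j \<noteq> d \<Longrightarrow> endpoint w j = 0"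
  by (induction w) (auto simp: endpoint_def unit_step_def)

lemma endpoint_shuffles: "w \<in> shuffles xs ys \<Longrightarrow> endpoint w j = endpoint xs j + endpoint ys j"
  by (induction xs ys arbitrary: w rule: shuffles.induct) (auto simp: endpoint_def)

lemma closed_walks_Suc:
  "closed_walks (Suc d) n =
     (\<Union>k\<le>n. \<Union>(xs, ys) \<in> closed_walks d k \<times> axis_walks d (n - k). shuffles xs ys)"
proof (intro equalityI subsetI)
  fix w assume w: "w \<in> closed_walks (Suc d) n"
  define P where "P = (\<lambda>s. s \<in> steps d)"
  define xs where "xs = filter P w"
  define ys where "ys = filter (\<lambda>s. \<not> P s) w"
  have sh: "w \<in> shuffles xs ys"
    unfolding xs_def ys_def by (rule partition_in_shuffles)
  have sx: "set xs \<subseteq> steps d" by (auto simp: xs_def P_def)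
  have sy: "set ys \<subseteq> {unit_step d 1, unit_step d (-1)}"
    using w by (auto simp: ys_def P_def closed_walks_def walks_def steps_Suc)
  have e: "endpoint xs j + endpoint ys j = 0" for j
    using endpoint_shuffles[OF sh, of j] w by (simp add: closed_walks_def)
  have ex: "endpoint xs = (\<lambda>j. 0)" "endpoint ys = (\<lambda>j. 0)"
    using e endpoint_steps_ge[OF sx] endpoint_axis_neq[OF sy]
    by (metis add_cancel_right_left add.right_neutral order_refl)+
  have len: "length xs + length ys = n"
    using length_shuffles[OF sh] w by (simp add: closed_walks_def walks_def)
  have "xs \<in> closed_walks d (length xs)" "ys \<in> axis_walks d (n - length xs)"
    using sx sy ex len by (auto simp: closed_walks_def walks_def axis_walks_def)
  with sh len show "w \<in> (\<Union>k\<le>n. \<Union>(xs, ys) \<in> closed_walks d k \<times> axis_walks d (n - k). shuffles xs ys)"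
    by (intro UN_I[of "length xs"] UN_I[of "(xs, ys)"]) auto
next
  fix w assume "w \<in> (\<Union>k\<le>n. \<Union>(xs, ys) \<in> closed_walks d k \<times> axis_walks d (n - k). shuffles xs ys)"
  then obtain k xs ys where *: "k \<le> n" "xs \<in> closed_walks d k" "ys \<in> axis_walks d (n - k)"
    "w \<in> shuffles xs ys" by auto
  from * show "w \<in> closed_walks (Suc d) n"
    using endpoint_shuffles[OF *(4)] length_shuffles[OF *(4)] set_shuffles[OF *(4)]
    by (auto simp: closed_walks_def walks_def axis_walks_def steps_Suc)
qed

lemma card_closed_walks_Suc:
  "card (closed_walks (Suc d) n) =
     (\<Sum>k\<le>n. (n choose k) * card (closed_walks d k) * card (axis_walks d (n - k)))"
proof -
  define I where "I = (SIGMA k:{..n}. closed_walks d k \<times> axis_walks d (n - k))"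
  define S where "S = (\<lambda>(k::nat, xs :: (nat \<Rightarrow> int) list, ys). shuffles xs ys)"
  have eq: "closed_walks (Suc d) n = (\<Union>i\<in>I. S i)"
    unfolding closed_walks_Suc I_def S_def by fastforce
  have disj: "set xs \<inter> set ys = {}" if "(k, xs, ys) \<in> I" for k xs ys
    using that steps_disjoint[of d] by (auto simp: I_def closed_walks_def walks_def axis_walks_def)
  have sep: "k = length xs \<and> xs = filter (\<lambda>s. s \<in> steps d) w \<and> ys = filter (\<lambda>s. s \<notin> steps d) w"
    if "(k, xs, ys) \<in> I" "w \<in> shuffles xs ys" for k xs ys w
  proof -
    have x: "set xs \<subseteq> steps d" and y: "set ys \<inter> steps d = {}" and k: "k = length xs"
      using that steps_disjoint[of d] by (auto simp: I_def closed_walks_def walks_def axis_walks_def)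
    have "filter (\<lambda>s. s \<in> steps d) w \<in> shuffles (filter (\<lambda>s. s \<in> steps d) xs) (filter (\<lambda>s. s \<in> steps d) ys)"
         "filter (\<lambda>s. s \<notin> steps d) w \<in> shuffles (filter (\<lambda>s. s \<notin> steps d) xs) (filter (\<lambda>s. s \<notin> steps d) ys)"
      using that(2) filter_shuffles by blast+
    moreover have "filter (\<lambda>s. s \<in> steps d) xs = xs" "filter (\<lambda>s. s \<notin> steps d) ys = ys"
      "filter (\<lambda>s. s \<in> steps d) ys = []" "filter (\<lambda>s. s \<notin> steps d) xs = []"
      using x y by (auto simp: filter_id_conv filter_empty_conv)
    ultimately show ?thesis using k by simp
  qed
  have fin: "finite I"
    by (simp add: I_def finite_closed_walks finite_axis_walks)
  have "card (closed_walks (Suc d) n) = (\<Sum>i\<in>I. card (S i))"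
    unfolding eq
  proof (rule card_UN_disjoint[OF fin])
    show "\<forall>i\<in>I. finite (S i)" by (auto simp: S_def)
    show "\<forall>i\<in>I. \<forall>j\<in>I. i \<noteq> j \<longrightarrow> S i \<inter> S j = {}"
      unfolding S_def by (clarsimp, metis disjoint_iff sep)
  qed
  also have "\<dots> = (\<Sum>i\<in>I. n choose fst i)"
  proof (rule sum.cong[OF refl])
    fix i assume i: "i \<in> I"
    obtain k xs ys where [simp]: "i = (k, xs, ys)" by (cases i) auto
    have "length xs = k" "length xs + length ys = n"
      using i by (auto simp: I_def closed_walks_def walks_def axis_walks_def)
    thus "card (S i) = n choose fst i"
      using card_disjoint_shuffles[OF disj[of k xs ys]] i by (simp add: S_def)
  qed
  also have "\<dots> = (\<Sum>k\<le>n. \<Sum>_\<in>closed_walks d k \<times> axis_walks d (n - k). n choose k)"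
    unfolding I_def by (subst sum.Sigma) (auto simp: finite_closed_walks finite_axis_walks split_def)
  finally show ?thesis by (simp add: card_cartesian_product mult_ac)
qed

lemma card_axis_walks: "card (axis_walks d n) = (if even n then n choose (n div 2) else 0)"
proof -
  define u where "u = unit_step d 1"
  define v where "v = unit_step d (-1)"
  have uv: "u \<noteq> v" by (simp add: u_def v_def unit_step_eq_iff)
  have part: "w \<in> shuffles (replicate (count_list w u) u) (replicate (count_list w v) v)
      \<and> length w = count_list w u + count_list w v
      \<and> endpoint w d = int (count_list w u) - int (count_list w v)"
    if "set w \<subseteq> {u, v}" for w
  proof -
    have "filter (\<lambda>s. s = u) w = replicate (count_list w u) u"
      by (induction w) auto
    moreover from that have "filter (\<lambda>s. \<not> s = u) w = replicate (count_list w v) v"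
      using uv by (induction w) auto
    moreover from that have "length w = count_list w u + count_list w v"
      using uv by (induction w) auto
    moreover from that have "endpoint w d = int (count_list w u) - int (count_list w v)"
      using uv by (induction w) (auto simp: endpoint_def u_def v_def unit_step_def)
    ultimately show ?thesis using partition_in_shuffles[of w "\<lambda>s. s = u"] by simp
  qed
  show ?thesis
  proof (cases "even n")
    case False
    have "axis_walks d n = {}"
    proof (rule ccontr)
      assume "axis_walks d n \<noteq> {}"
      then obtain w where "set w \<subseteq> {u, v}" "length w = n" "endpoint w d = 0"
        by (auto simp: axis_walks_def u_def v_def)
      with part[of w] have "n = 2 * count_list w u" by simp
      with False show False by simp
    qed
    with False show ?thesis by simp
  next
    case True
    then obtain a where n: "n = 2 * a" by blast
    have "axis_walks d n = shuffles (replicate a u) (replicate a v)"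
    proof (intro equalityI subsetI)
      fix w assume "w \<in> axis_walks d n"
      hence w: "set w \<subseteq> {u, v}" "length w = n" "endpoint w d = 0"
        by (auto simp: axis_walks_def u_def v_def)
      with part[of w] n have "count_list w u = a" "count_list w v = a" by auto
      with part[OF w(1)] show "w \<in> shuffles (replicate a u) (replicate a v)" by simp
    next
      fix w assume w: "w \<in> shuffles (replicate a u) (replicate a v)"
      have e: "endpoint (replicate a u) j + endpoint (replicate a v) j = 0" for j
        by (simp add: endpoint_def sum_list_replicate u_def v_def unit_step_def)
      show "w \<in> axis_walks d n"
        using set_shuffles[OF w] length_shuffles[OF w] endpoint_shuffles[OF w] e n
        by (auto simp: axis_walks_def u_def v_def split: if_splits)
    qed
    moreover have "set (replicate a u) \<inter> set (replicate a v) = {}" using uv by auto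
    ultimately show ?thesis using card_disjoint_shuffles[of "replicate a u" "replicate a v"] n
      by (simp add: mult_2)
  qed
qed

lemma central_binomial_identity:
  assumes "k \<le> n"
  shows "((2 * n) choose (2 * k)) * ((2 * k) choose k) * ((2 * (n - k)) choose (n - k)) =
    ((2 * n) choose n) * (n choose k) ^ 2"
proof -
  obtain j where n: "n = k + j" using assms le_Suc_ex by blast
  have "2 * (k + j) - 2 * k = 2 * j" "2 * (k + j) - (k + j) = k + j" "2 * k - k = k" "2 * j - j = j"
    by simp_all
  hence "real (((2 * n) choose (2 * k)) * ((2 * k) choose k) * ((2 * (n - k)) choose (n - k))) =
    real (((2 * n) choose n) * (n choose k) ^ 2)"
    unfolding n by (simp add: binomial_fact power2_eq_square add.commute[of j k] mult_ac)
  thus ?thesis by (simp only: of_nat_eq_iff)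
qed

lemma card_closed_walks_dvd:
  "(odd n \<longrightarrow> card (closed_walks d n) = 0) \<and> ((2 * n) choose n) dvd card (closed_walks d (2 * n))"
proof (induction d arbitrary: n)
  case 0
  have "closed_walks 0 m = (if m = 0 then {[]} else {})" for m
    by (auto simp: closed_walks_def walks_def steps_def endpoint_def)
  thus ?case by auto
next
  case (Suc d)
  have "card (closed_walks (Suc d) n) = 0" if "odd n"
    unfolding card_closed_walks_Suc
  proof (intro sum.neutral ballI)
    fix k assume "k \<in> {..n}"
    with that have "odd k \<or> odd (n - k)" by auto
    with Suc[of k] show "(n choose k) * card (closed_walks d k) * card (axis_walks d (n - k)) = 0"
      by (auto simp: card_axis_walks)
  qed
  moreover have "((2 * n) choose n) dvd card (closed_walks (Suc d) (2 * n))"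
    unfolding card_closed_walks_Suc
  proof (rule dvd_sum)
    fix m assume m: "m \<in> {..2 * n}"
    show "((2 * n) choose n) dvd
      ((2 * n) choose m) * card (closed_walks d m) * card (axis_walks d (2 * n - m))"
    proof (cases "even m")
      case False
      with Suc[of m] show ?thesis by simp
    next
      case True
      then obtain k where k: "m = 2 * k" by blast
      with m have kn: "k \<le> n" by simp
      obtain c where c: "card (closed_walks d (2 * k)) = ((2 * k) choose k) * c"
        using Suc[of k] by (auto elim: dvdE)
      have ax: "card (axis_walks d (2 * n - 2 * k)) = (2 * (n - k)) choose (n - k)"
        by (simp add: card_axis_walks flip: diff_mult_distrib2)
      have "((2 * n) choose m) * card (closed_walks d m) * card (axis_walks d (2 * n - m)) =
        (((2 * n) choose (2 * k)) * ((2 * k) choose k) * ((2 * (n - k)) choose (n - k))) * c"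
        unfolding k c ax by (simp only: mult_ac)
      thus ?thesis
        unfolding central_binomial_identity[OF kn] by (simp only: mult.assoc dvd_triv_left)
    qed
  qed
  ultimately show ?case by blast
qed

theorem x_seq_mult_central_binomial: "x_seq d n * ((2 * n) choose n) = A_seq d n"
  using card_closed_walks_dvd[of n d] by (simp add: x_seq_def A_seq_def)

end

theory Submission
  imports Defs "HOL-Analysis.FPS_Convergence"
begin

text \<open>
  Let \<open>F\<close> be the generating series of \<open>x_seq d\<close> or \<open>A_seq d\<close>.  Sorting the steps by their
  axis gives \<open>x_seq (Suc d) n = (\<Sum>k\<le>n. (n choose k)\<^sup>2 * x_seq d k)\<close>, so both sequences inherit
  from the binomial coefficients the Lucas congruences \<open>f (p n + j) \<equiv> f n * f j\<close> modulo
  every prime \<open>p\<close>, for \<open>j < p\<close>.  For the series this says \<open>F = g F\<^sup>p\<close> over \<open>\<int>/p\<close> with a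
  polynomial \<open>g\<close> of degree below \<open>p\<close>, an algebraic equation.

  The same equation controls the logarithmic derivative: as \<open>F\<^sup>p\<close> has derivative \<open>0\<close>,
  \<open>F'/F = g'/g\<close> modulo \<open>p\<close>, which has only simple poles, at the zeros of \<open>g\<close>.  An
  assumption on \<open>F\<close> in characteristic zero confines them to the zeros of a polynomial that
  does not depend on \<open>p\<close>:

  \<^item> If \<open>\<Sum>k\<le>r. Q\<^sub>k F\<^sup>k = 0\<close>, then \<open>1/F\<close> is integral over \<open>\<int>/p[z]\<close> with
    \<open>(1/F)\<^sup>p\<^sup>-\<^sup>1 = g\<close>, and every prime factor of \<open>g\<close> divides \<open>Q\<^sub>r\<close>
    (\<open>algebraic_prime_divisors\<close>).
  \<^item> If \<open>F\<close> and \<open>1/F\<close> satisfy linear differential equations of orders \<open>s\<close> and \<open>t\<close>, then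
    every prime factor of \<open>g\<close> divides one of the leading coefficients \<open>a\<^sub>s\<close> and \<open>b\<^sub>t\<close>.
    Otherwise a zero of \<open>g\<close> of order \<open>e\<close> would be an ordinary point of both equations with
    exponents \<open>e\<close> and \<open>-e\<close> modulo \<open>p\<close>, but the exponents at an ordinary point are
    \<open>0, \<dots>, s - 1\<close> and \<open>0, \<dots>, t - 1\<close> (\<open>dfinite_prime_divisors\<close>).

  In both cases there is a nonzero integer polynomial \<open>q\<close> such that, for every large prime
  \<open>p\<close>, the series \<open>q F'/F\<close> is modulo \<open>p\<close> a polynomial of degree less than that of \<open>q\<close>.
  Its higher coefficients are divisible by infinitely many primes, so they vanish and
  \<open>q F' = S F\<close> holds over the integers.

  A first-order equation contradicts the growth of the coefficients.  These lie between
  \<open>c \<rho>\<^sup>-\<^sup>n / (n + 1)\<^sup>K\<close> and \<open>C \<rho>\<^sup>-\<^sup>n / (n + 1)\<close>, where \<open>1/\<rho>\<close> is \<open>d\<^sup>2\<close> for \<open>x_seq d\<close> with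
  \<open>d \<ge> 3\<close> and \<open>4 d\<^sup>2\<close> for \<open>A_seq d\<close> with \<open>d \<ge> 2\<close>.  If \<open>S/q\<close> has a pole at
  \<open>\<rho>\<close>, then \<open>F\<close> grows too fast near \<open>\<rho>\<close> for the upper bound; if it has none, all
  derivatives of \<open>F\<close> stay bounded near \<open>\<rho>\<close>, which contradicts the lower bound
  (\<open>no_first_order_ode\<close>).

  The first case gives transcendence.  For first returns, \<open>A (1 - B) = 1\<close> for the generating
  series of \<open>A_seq d\<close> and \<open>B_seq d\<close>, so a P-recursive \<open>B_seq d\<close> would put \<open>A\<close> into the second
  case.  Finally, \<open>A_seq d\<close> and \<open>x_seq d\<close> are P-recursive because
  \<open>\<Sum>n. x_seq d n z\<^sup>n / (n!)\<^sup>2\<close> is the \<open>d\<close>-th power of a Bessel series.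
\<close>

hide_const (open) up_ring.coeff up_ring.monom Module.smult

section \<open>Series with \<open>F = g F\<^sup>p\<close> in characteristic \<open>p\<close>\<close>

text \<open>
  The logarithmic derivative of \<open>g\<close> has only simple poles, so a polynomial that vanishes at
  all zeros of \<open>g\<close> clears its denominator.
\<close>

lemma prime_divisors_imp_dvd_mult_pderiv:
  fixes g q :: "'a::field_gcd poly"
  assumes "g \<noteq> 0" and "\<And>\<pi>. prime \<pi> \<Longrightarrow> \<pi> dvd g \<Longrightarrow> \<pi> dvd q"
  shows "g dvd q * pderiv g"
  using assms
proof (induction g rule: prime_divisors_induct)
  case (unit g)
  from unit(1) show ?case by (rule unit_imp_dvd)
next
  case (factor \<pi> h)
  have "\<pi> dvd q" using factor by auto
  hence "\<pi> * h dvd q * (h * pderiv \<pi>)"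
    by (metis dvd_mult2 dvd_refl mult.assoc mult_dvd_mono)
  moreover have "h dvd q * pderiv h" using factor by auto
  hence "\<pi> * h dvd q * (\<pi> * pderiv h)"
    by (metis dvd_refl mult.left_commute mult_dvd_mono)
  ultimately show ?case
    by (simp add: pderiv_mult distrib_left)
qed auto

lemma fps_deriv_power_CHAR:
  fixes F :: "'a::comm_ring_1 fps"
  shows "fps_deriv (F ^ CHAR('a)) = 0"
  by (simp add: fps_deriv_power)

text \<open>
  In characteristic \<open>p\<close> the factor \<open>F\<^sup>p\<close> is a constant of the derivation, so the
  logarithmic derivative of \<open>F\<close> is \<open>g'/g\<close>.  It vanishes at infinity, hence multiplication
  by \<open>q\<close> leaves a polynomial of degree less than that of \<open>q\<close>.
\<close>

lemma frobenius_quotient_log_deriv: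
  fixes F W :: "'a::field_gcd fps"
  assumes F: "F = fps_of_poly g * F ^ CHAR('a)" and W: "F * W = 1" and "q \<noteq> 0"
    and "\<And>\<pi>. prime \<pi> \<Longrightarrow> \<pi> dvd g \<Longrightarrow> \<pi> dvd q" and n: "degree q \<le> n"
  shows "fps_nth (fps_of_poly q * fps_deriv F * W) n = 0"
proof -
  have g: "g \<noteq> 0" using F W by auto
  then obtain s where s: "q * pderiv g = g * s"
    using prime_divisors_imp_dvd_mult_pderiv[of g q] assms by (auto elim: dvdE)
  have "fps_deriv F = fps_of_poly (pderiv g) * F ^ CHAR('a)"
    by (subst F) (simp add: fps_deriv_power_CHAR fps_of_poly_pderiv)
  hence "fps_of_poly q * fps_deriv F * W = fps_of_poly (q * pderiv g) * F ^ CHAR('a) * W"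
    by (simp add: fps_of_poly_mult mult_ac)
  also have "\<dots> = fps_of_poly s * (fps_of_poly g * F ^ CHAR('a)) * W"
    by (simp add: s fps_of_poly_mult mult_ac)
  also have "\<dots> = fps_of_poly s"
    using W by (simp add: F[symmetric] mult.assoc)
  finally have "fps_nth (fps_of_poly q * fps_deriv F * W) n = coeff s n" by simp
  moreover have "coeff s n = 0"
  proof (cases "s = 0")
    case False
    with s g have "pderiv g \<noteq> 0" by auto
    moreover from this have "degree g > 0"
      by (metis degree_eq_zeroE gr0I pderiv_0 pderiv_pCons add_0 mult_zero_left pCons_0_0)
    ultimately have "degree q + degree (pderiv g) = degree g + degree s"
      using s g False \<open>q \<noteq> 0\<close> by (metis degree_mult_eq)
    moreover have "degree (pderiv g) < degree g"
      using degree_pderiv_le[of g] \<open>degree g > 0\<close> by linarith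
    ultimately show ?thesis using n by (intro coeff_eq_0) linarith
  qed auto
  ultimately show ?thesis by simp
qed

lemma map_poly_fps_of_poly_mult:
  "map_poly fps_of_poly (p * q) = map_poly fps_of_poly p * map_poly fps_of_poly q"
  for p q :: "'a::field poly poly"
  by (rule poly_eqI) (simp add: coeff_map_poly coeff_mult fps_of_poly_sum fps_of_poly_mult)

definition poly_at_fps :: "'a::field fps \<Rightarrow> 'a poly poly \<Rightarrow> 'a fps" where
  "poly_at_fps w E = poly (map_poly fps_of_poly E) w"

lemma poly_at_fps_mult: "poly_at_fps w (p * q) = poly_at_fps w p * poly_at_fps w q"
  by (simp add: poly_at_fps_def map_poly_fps_of_poly_mult)

lemma poly_at_fps_altdef: "poly_at_fps w E = (\<Sum>i\<le>degree E. fps_of_poly (coeff E i) * w ^ i)"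
  by (simp add: poly_at_fps_def poly_altdef coeff_map_poly degree_map_poly)

lemma poly_at_fps_bound: "degree E \<le> n \<Longrightarrow> poly_at_fps w E = (\<Sum>i\<le>n. fps_of_poly (coeff E i) * w ^ i)"
  unfolding poly_at_fps_altdef by (intro sum.mono_neutral_left) (auto simp: coeff_eq_0)

lemma poly_at_fps_add: "poly_at_fps w (p + q) = poly_at_fps w p + poly_at_fps w q"
  by (simp add: poly_at_fps_bound[of _ "max (degree p) (degree q)"] degree_add_le_max fps_of_poly_add
     distrib_right sum.distrib)

lemma poly_at_fps_smult: "poly_at_fps w (smult c p) = fps_of_poly c * poly_at_fps w p"
  by (simp add: poly_at_fps_bound[of _ "degree p"] degree_smult_le fps_of_poly_mult sum_distrib_left mult_ac)

text \<open>
  Gauss's lemma: a primitive annihilating polynomial of minimal degree divides, over the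
  polynomial ring and not just over its fraction field, every other annihilating polynomial.
\<close>

lemma exists_primitive_annihilator:
  fixes w :: "'a::field_gcd fps"
  assumes "G \<noteq> 0" "poly_at_fps w G = 0"
  obtains E where "E \<noteq> 0" "poly_at_fps w E = 0" "\<And>H. poly_at_fps w H = 0 \<Longrightarrow> E dvd H"
proof -
  define P where "P = (\<lambda>E. E \<noteq> 0 \<and> poly_at_fps w E = 0)"
  obtain E0 where E0: "P E0" and min: "\<And>E. P E \<Longrightarrow> degree E0 \<le> degree E"
    using ex_has_least_nat[of P G degree] assms unfolding P_def by metis
  define E where "E = primitive_part E0"
  have E: "E \<noteq> 0" using E0 by (simp add: P_def E_def)
  have cont: "content E = 1" using E0 by (simp add: P_def E_def)
  have "poly_at_fps w E0 = fps_of_poly (content E0) * poly_at_fps w E"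
    unfolding E_def poly_at_fps_smult[symmetric] by simp
  hence ev: "poly_at_fps w E = 0" using E0 by (auto simp: P_def)
  have "E dvd H" if H: "poly_at_fps w H = 0" for H
  proof -
    obtain a q where aq: "a \<noteq> 0" "smult a H = E * q + pseudo_mod H E"
      using pseudo_mod(1)[OF E] by blast
    have "poly_at_fps w (pseudo_mod H E) = 0"
      using arg_cong[OF aq(2), of "poly_at_fps w"] H ev
      by (simp add: poly_at_fps_add poly_at_fps_mult poly_at_fps_smult)
    moreover have "degree E = degree E0" by (simp add: E_def)
    ultimately have "pseudo_mod H E = 0"
      using min[of "pseudo_mod H E"] pseudo_mod(2)[OF E, of H] unfolding P_def by fastforce
    with aq have eq: "smult a H = E * q" by simp
    have "content q = normalize a * content H"
      using arg_cong[OF eq, of content] by (simp add: content_mult cont)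
    hence "a dvd content q" by simp
    then obtain c where "content q = a * c" ..
    hence "q = smult a (smult c (primitive_part q))"
      using content_times_primitive_part[of q] by simp
    then obtain q' where "q = smult a q'" ..
    with eq have "smult a (H - E * q') = 0" by (simp add: smult_diff_right)
    with aq(1) have "H = E * q'" by simp
    thus ?thesis by simp
  qed
  with that E ev show ?thesis by blast
qed

text \<open>
  Modulo \<open>\<pi>\<close> the product is a power of the variable, and both factors have unit leading
  coefficients.  Hence the reduction of \<open>E\<close> is, up to a unit, a power of the variable too, and
  a nontrivial one.
\<close>

lemma prime_dvd_const_coeff_of_factor:
  fixes E :: "'a::idom poly"
  assumes EG: "E * q = monom 1 m - [:c:]" and m: "m > 0" and \<pi>: "prime_elem \<pi>" "\<pi> dvd c"
    and deg: "degree E > 0"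
  shows "\<pi> dvd coeff E 0"
proof (rule ccontr)
  assume E0: "\<not> \<pi> dvd coeff E 0"
  have dG: "degree (monom 1 m - [:c:] :: 'a poly) = m"
    using m degree_add_eq_left[of "-[:c:]" "monom 1 m"]
    by (simp only: diff_conv_add_uminus degree_minus degree_pCons_0 degree_monom_eq one_neq_zero not_False_eq_True)
  have lc: "coeff (monom 1 m - [:c:]) m = 1"
    using m by (cases m) simp_all
  hence ne: "monom 1 m - [:c:] \<noteq> 0" by (metis coeff_0 zero_neq_one)
  have nz: "E \<noteq> 0" "q \<noteq> 0" using EG ne by auto
  have dm: "degree E + degree q = m" using dG nz by (simp add: EG[symmetric] degree_mult_eq)
  have "coeff (E * q) m = lead_coeff E * lead_coeff q"
    unfolding dm[symmetric] by (rule coeff_mult_degree_sum)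
  hence lead: "\<not> \<pi> dvd lead_coeff q"
    using lc \<pi>(1) EG by (metis dvd_mult prime_elem_not_unit)
  define j where "j = (LEAST j. \<not> \<pi> dvd coeff q j)"
  have j: "\<not> \<pi> dvd coeff q j" "\<And>i. i < j \<Longrightarrow> \<pi> dvd coeff q i"
    unfolding j_def using LeastI[of "\<lambda>j. \<not> \<pi> dvd coeff q j", OF lead] not_less_Least by blast+
  have jd: "j \<le> degree q" unfolding j_def using lead by (rule Least_le)
  have "coeff (E * q) j = (\<Sum>i\<le>j. coeff E i * coeff q (j - i))" by (rule coeff_mult)
  also have "\<dots> = coeff E 0 * coeff q j + (\<Sum>i\<in>{..j} - {0}. coeff E i * coeff q (j - i))"
    by (subst sum.remove[of _ 0]) auto
  finally have "coeff (E * q) j = coeff E 0 * coeff q j + (\<Sum>i\<in>{..j} - {0}. coeff E i * coeff q (j - i))" .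
  moreover have "\<pi> dvd (\<Sum>i\<in>{..j} - {0}. coeff E i * coeff q (j - i))"
    by (intro dvd_sum dvd_mult j) auto
  moreover have "\<pi> dvd coeff (E * q) j"
    using jd dm deg \<pi>(2) by (cases j) (auto simp: EG)
  ultimately have "\<pi> dvd coeff E 0 * coeff q j" by (metis dvd_add_left_iff)
  thus False using E0 j(1) \<pi>(1) by (simp add: prime_elem_dvd_mult_iff)
qed

text \<open>
  \<open>W = 1/F\<close> is a root of \<open>Y\<^sup>m - g\<close> and of the reversed polynomial with constant term
  \<open>Q\<^sub>r\<close>.  The primitive minimal polynomial of \<open>W\<close> divides both: from the first its constant
  term is a multiple of \<open>\<pi>\<close>, and by the second it divides \<open>Q\<^sub>r\<close>.
\<close>

lemma algebraic_prime_divisors: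
  fixes F W :: "'a::field_gcd fps"
  assumes W: "F * W = 1" and g: "W ^ m = fps_of_poly g" and m: "m > 0"
    and Q: "Q r \<noteq> 0" "(\<Sum>k\<le>r. fps_of_poly (Q k) * F ^ k) = 0"
    and \<pi>: "prime \<pi>" "\<pi> dvd g"
  shows "\<pi> dvd Q r"
proof -
  define H where "H = (\<Sum>k\<le>r. monom (Q k) (r - k))"
  define G where "G = monom 1 m - [:g:]"
  have cH: "coeff H 0 = Q r"
  proof -
    have "coeff H 0 = (\<Sum>k\<le>r. if k = r then Q r else 0)"
      unfolding H_def coeff_sum by (rule sum.cong) auto
    thus ?thesis by simp
  qed
  have ev_monom: "poly_at_fps W (monom c k) = fps_of_poly c * W ^ k" for c k
    by (simp add: poly_at_fps_def map_poly_monom poly_monom)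
  have ev_sum: "poly_at_fps W (\<Sum>k\<in>A. f k) = (\<Sum>k\<in>A. poly_at_fps W (f k))" for f and A :: "nat set"
    by (induction A rule: infinite_finite_induct) (simp_all add: poly_at_fps_add, simp_all add: poly_at_fps_def)
  have "poly_at_fps W H = (\<Sum>k\<le>r. fps_of_poly (Q k) * W ^ (r - k))"
    unfolding H_def ev_sum ev_monom ..
  also have "\<dots> = (\<Sum>k\<le>r. fps_of_poly (Q k) * F ^ k * W ^ r)"
  proof (rule sum.cong[OF refl])
    fix k assume "k \<in> {..r}"
    hence "W ^ r = W ^ (r - k) * W ^ k" by (simp flip: power_add)
    hence "F ^ k * W ^ r = (F * W) ^ k * W ^ (r - k)" by (simp add: power_mult_distrib mult_ac)
    thus "fps_of_poly (Q k) * W ^ (r - k) = fps_of_poly (Q k) * F ^ k * W ^ r"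
      by (simp add: W mult.assoc)
  qed
  also have "\<dots> = 0" using Q(2) by (simp flip: sum_distrib_right)
  finally have evH: "poly_at_fps W H = 0" .
  have "G = monom 1 m + [:- g:]" by (simp add: G_def)
  hence evG: "poly_at_fps W G = 0"
    using ev_monom[of "-g" 0] by (simp add: poly_at_fps_add ev_monom g monom_0 fps_of_poly_uminus)
  have "coeff G m = 1" using m by (cases m) (simp_all add: G_def)
  hence "G \<noteq> 0" by auto
  from this evG obtain E where E: "E \<noteq> 0" "poly_at_fps W E = 0" "\<And>H. poly_at_fps W H = 0 \<Longrightarrow> E dvd H"
    using exists_primitive_annihilator[of G W] by blast
  have "degree E > 0"
  proof (rule ccontr)
    assume "\<not> degree E > 0"
    then obtain c where "E = [:c:]" by (auto elim: degree_eq_zeroE)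
    with E(1,2) ev_monom[of c 0] show False by (simp add: monom_0)
  qed
  moreover obtain q where "E * q = monom 1 m - [:g:]" using E(3)[OF evG] unfolding G_def by (metis dvdE)
  ultimately have "\<pi> dvd coeff E 0"
    using prime_dvd_const_coeff_of_factor[of E _ m g \<pi>] \<pi> m by blast
  moreover obtain q' where "H = E * q'" using E(3)[OF evH] by (elim dvdE)
  hence "coeff E 0 dvd coeff H 0" by (simp add: coeff_mult)
  ultimately show ?thesis unfolding cH by (rule dvd_trans)
qed

text \<open>
  The derivation \<open>z d/dz\<close>.  It is used instead of \<open>d/dz\<close> because it multiplies the \<open>n\<close>-th
  coefficient of a series by \<open>n\<close>, which turns recurrences directly into differential equations.
\<close>

definition euler_poly :: "'a::idom poly \<Rightarrow> 'a poly" where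
  "euler_poly u = [:0, 1:] * pderiv u"

definition euler_fps :: "'a::comm_ring_1 fps \<Rightarrow> 'a fps" where
  "euler_fps F = fps_X * fps_deriv F"

lemma nth_euler_fps: "fps_nth (euler_fps F) n = of_nat n * fps_nth F n"
  by (cases n) (simp_all add: euler_fps_def)

lemma nth_euler_fps_iterate: "fps_nth ((euler_fps ^^ i) F) n = of_nat n ^ i * fps_nth F n"
  by (induction i) (simp_all add: nth_euler_fps mult.assoc)

lemma euler_poly_mult: "euler_poly (u * v) = euler_poly u * v + u * euler_poly v"
  by (simp only: euler_poly_def pderiv_mult) (simp add: algebra_simps)

lemma euler_poly_power_Suc: "euler_poly (u ^ Suc n) = of_nat (Suc n) * u ^ n * euler_poly u"
  unfolding euler_poly_def pderiv_power_Suc by (simp add: of_nat_poly mult_ac)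

lemma euler_fps_times_constant:
  assumes "fps_deriv H = 0"
  shows "(euler_fps ^^ i) (fps_of_poly g * H) = fps_of_poly ((euler_poly ^^ i) g) * H"
proof (induction i)
  case (Suc i)
  have "(euler_fps ^^ Suc i) (fps_of_poly g * H) = euler_fps (fps_of_poly ((euler_poly ^^ i) g) * H)"
    using Suc by simp
  also have "\<dots> = fps_of_poly ((euler_poly ^^ Suc i) g) * H"
    by (simp add: euler_fps_def euler_poly_def assms fps_of_poly_mult fps_of_poly_pderiv
        fps_of_poly_fps_X mult_ac del: mult_pCons_left)
  finally show ?case .
qed simp

text \<open>
  The leading term of the \<open>\<pi>\<close>-adic expansion: every differentiation lowers the order by one
  and multiplies the leading coefficient by the order and by the derivative of \<open>\<pi>\<close>.
\<close>

lemma euler_poly_iterate_prime_power: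
  assumes "i \<le> e"
  obtains q where "(euler_poly ^^ i) (\<pi> ^ e * h) =
    \<pi> ^ (e - i) * (of_nat (\<Prod>j<i. e - j) * euler_poly \<pi> ^ i * h + \<pi> * q)"
proof -
  have "\<exists>q. (euler_poly ^^ i) (\<pi> ^ e * h) =
    \<pi> ^ (e - i) * (of_nat (\<Prod>j<i. e - j) * euler_poly \<pi> ^ i * h + \<pi> * q)"
    using assms
  proof (induction i)
    case 0
    show ?case by (intro exI[of _ 0]) simp
  next
    case (Suc i)
    then obtain q where q: "(euler_poly ^^ i) (\<pi> ^ e * h) =
      \<pi> ^ (e - i) * (of_nat (\<Prod>j<i. e - j) * euler_poly \<pi> ^ i * h + \<pi> * q)" by auto
    define v where "v = of_nat (\<Prod>j<i. e - j) * euler_poly \<pi> ^ i * h + \<pi> * q"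
    have e: "e - i = Suc (e - Suc i)" using Suc.prems by simp
    have "(euler_poly ^^ Suc i) (\<pi> ^ e * h) = euler_poly (\<pi> ^ Suc (e - Suc i) * v)"
      by (simp add: q e v_def)
    also have "\<dots> = of_nat (e - i) * \<pi> ^ (e - Suc i) * euler_poly \<pi> * v
        + \<pi> ^ Suc (e - Suc i) * euler_poly v"
      by (simp only: euler_poly_mult euler_poly_power_Suc e)
    also have "\<dots> = \<pi> ^ (e - Suc i) * (of_nat (e - i) * euler_poly \<pi> * v + \<pi> * euler_poly v)"
      by (simp add: algebra_simps)
    finally have step: "(euler_poly ^^ Suc i) (\<pi> ^ e * h) =
      \<pi> ^ (e - Suc i) * (of_nat (e - i) * euler_poly \<pi> * v + \<pi> * euler_poly v)" .
    have "of_nat (\<Prod>j<Suc i. e - j) = of_nat (e - i) * (of_nat (\<Prod>j<i. e - j) :: 'a poly)"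
      by (simp only: prod.lessThan_Suc of_nat_mult mult.commute)
    hence "of_nat (e - i) * euler_poly \<pi> * v + \<pi> * euler_poly v =
        of_nat (\<Prod>j<Suc i. e - j) * euler_poly \<pi> ^ Suc i * h
        + \<pi> * (of_nat (e - i) * euler_poly \<pi> * q + euler_poly v)"
      by (simp only: v_def power_Suc distrib_left mult.assoc mult.left_commute add.assoc mult.commute)
    thus ?case unfolding step by auto
  qed
  with that show ?thesis by blast
qed

text \<open>
  The indicial equation at a prime \<open>\<pi>\<close> that does not divide the leading coefficient: the order
  \<open>e\<close> of a solution satisfies \<open>e (e - 1) \<dots> (e - s + 1) = 0\<close> in the field.
\<close>

lemma ordinary_point_exponent:
  fixes \<pi> h :: "'a::field_gcd poly"
  assumes \<pi>: "prime \<pi>" "\<not> \<pi> dvd a s" "\<not> \<pi> dvd euler_poly \<pi>" "\<not> \<pi> dvd h"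
    and ode: "(\<Sum>i\<le>s. a i * (euler_poly ^^ i) (\<pi> ^ e * h)) = 0" and se: "s \<le> e"
  shows "(of_nat (\<Prod>j<s. e - j) :: 'a) = 0"
proof (rule ccontr)
  assume nz: "(of_nat (\<Prod>j<s. e - j) :: 'a) \<noteq> 0"
  define c where "c = (of_nat (\<Prod>j<s. e - j) :: 'a poly)"
  obtain q where q: "(euler_poly ^^ s) (\<pi> ^ e * h) = \<pi> ^ (e - s) * (c * euler_poly \<pi> ^ s * h + \<pi> * q)"
    unfolding c_def using euler_poly_iterate_prime_power[OF se] by metis
  have "\<pi> ^ Suc (e - s) dvd (\<Sum>i<s. a i * (euler_poly ^^ i) (\<pi> ^ e * h))"
  proof (intro dvd_sum dvd_mult)
    fix i assume i: "i \<in> {..<s}"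
    with se have "i \<le> e" by simp
    then obtain q where "(euler_poly ^^ i) (\<pi> ^ e * h) =
        \<pi> ^ (e - i) * (of_nat (\<Prod>j<i. e - j) * euler_poly \<pi> ^ i * h + \<pi> * q)"
      using euler_poly_iterate_prime_power by metis
    moreover have "\<pi> ^ Suc (e - s) dvd \<pi> ^ (e - i)" using i se by (intro le_imp_power_dvd) auto
    ultimately show "\<pi> ^ Suc (e - s) dvd (euler_poly ^^ i) (\<pi> ^ e * h)" by simp
  qed
  then obtain u where u: "(\<Sum>i<s. a i * (euler_poly ^^ i) (\<pi> ^ e * h)) = \<pi> ^ Suc (e - s) * u" by blast
  have "\<pi> ^ (e - s) * (\<pi> * u + a s * (c * euler_poly \<pi> ^ s * h + \<pi> * q)) = 0"
  proof -
    have "(\<Sum>i<s. a i * (euler_poly ^^ i) (\<pi> ^ e * h)) + a s * (euler_poly ^^ s) (\<pi> ^ e * h) = 0"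
      using ode by (simp only: lessThan_Suc_atMost[symmetric] sum.lessThan_Suc)
    thus ?thesis unfolding u q by (simp add: distrib_left mult_ac)
  qed
  moreover have "\<pi> ^ (e - s) \<noteq> 0" using \<pi>(1) by auto
  ultimately have "\<pi> * u + a s * (c * euler_poly \<pi> ^ s * h + \<pi> * q) = 0"
    by (metis mult_eq_0_iff)
  hence "a s * (c * euler_poly \<pi> ^ s * h) = \<pi> * (- u - a s * q)"
    by (simp add: algebra_simps eq_neg_iff_add_eq_0)
  hence "\<pi> dvd a s * (c * euler_poly \<pi> ^ s * h)" by simp
  hence "\<pi> dvd c" using \<pi> by (auto simp: prime_dvd_mult_iff dest: prime_dvd_power)
  moreover have "is_unit c" using nz by (simp add: c_def of_nat_poly is_unit_const_poly_iff)
  ultimately show False using \<pi>(1) by (meson dvd_trans not_prime_unit)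
qed

lemma prime_not_dvd_euler_poly:
  fixes \<pi> :: "'a::field_gcd poly"
  assumes "prime \<pi>" "degree \<pi> < CHAR('a)" "coeff \<pi> 0 \<noteq> 0"
  shows "\<not> \<pi> dvd euler_poly \<pi>"
proof
  assume "\<pi> dvd euler_poly \<pi>"
  moreover have deg: "degree \<pi> > 0"
    using assms(1) by (metis is_unit_iff_degree not_gr_zero not_prime_0 not_prime_unit)
  have "\<not> \<pi> dvd [:0, 1:]"
  proof
    assume "\<pi> dvd [:0, 1:]"
    then obtain u where u: "[:0, 1:] = \<pi> * u" ..
    from arg_cong[OF u, of "\<lambda>x. coeff x 0"] assms(3) have u0: "coeff u 0 = 0"
      by (simp add: coeff_mult)
    have "u \<noteq> 0" using u by auto
    hence "degree \<pi> + degree u = 1"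
      using assms(1) arg_cong[OF u, of degree] by (auto simp: degree_mult_eq)
    with deg have "degree u = 0" by simp
    then obtain c where "u = [:c:]" by (elim degree_eq_zeroE)
    with u0 \<open>u \<noteq> 0\<close> show False by simp
  qed
  ultimately have "\<pi> dvd pderiv \<pi>"
    unfolding euler_poly_def using assms(1) prime_dvd_mult_iff by blast
  moreover have "pderiv \<pi> \<noteq> 0"
  proof -
    have "\<not> CHAR('a) dvd degree \<pi>" using deg assms(2) by (auto dest: dvd_imp_le)
    hence "coeff (pderiv \<pi>) (degree \<pi> - 1) \<noteq> 0"
      using deg assms(1) by (auto simp: coeff_pderiv of_nat_eq_0_iff_char_dvd simp del: of_nat_Suc)
    thus ?thesis by auto
  qed
  ultimately have "degree \<pi> \<le> degree (pderiv \<pi>)" by (rule dvd_imp_degree_le)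
  with degree_pderiv_le[of \<pi>] deg show False by linarith
qed

text \<open>
  A factor that is constant for the derivation cancels from a differential equation, which
  replaces the series by its polynomial part.
\<close>

lemma poly_ode_of_fps_ode:
  fixes H :: "'a::field fps"
  assumes "(\<Sum>i\<le>s. fps_of_poly (a i) * (euler_fps ^^ i) (fps_of_poly g * H)) = 0"
    and "fps_deriv H = 0" "H \<noteq> 0"
  shows "(\<Sum>i\<le>s. a i * (euler_poly ^^ i) g) = 0"
proof -
  have "fps_of_poly (\<Sum>i\<le>s. a i * (euler_poly ^^ i) g) * H = 0"
    using assms(1) by (simp only: euler_fps_times_constant[OF assms(2)] fps_of_poly_sum fps_of_poly_mult
        sum_distrib_right mult.assoc)
  with assms(3) have "fps_of_poly (\<Sum>i\<le>s. a i * (euler_poly ^^ i) g) = fps_of_poly 0" by simp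
  thus ?thesis by (simp only: fps_of_poly_eq_iff)
qed

text \<open>
  Cancel \<open>F\<close> in \<open>F = G F\<^sup>p\<close> to get \<open>G F\<^sup>p\<^sup>-\<^sup>1 = 1\<close>.
\<close>

lemma inverse_power_of_frobenius_quotient:
  fixes F W :: "'a::comm_ring_1"
  assumes F: "F = G * F ^ p" and W: "F * W = 1" and p: "p > 0"
  shows "W ^ (p - 1) = G"
proof -
  have "G * F ^ p * W = F * W" by (simp only: F[symmetric])
  also have "F ^ p = F ^ (p - 1) * F" using p by (cases p) simp_all
  also have "G * (F ^ (p - 1) * F) * W = F ^ (p - 1) * G * (F * W)"
    by (simp only: mult_ac)
  finally have "F ^ (p - 1) * G = 1" using W by simp
  hence "W ^ (p - 1) * (F ^ (p - 1) * G) = W ^ (p - 1)" by simp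
  moreover have "W ^ (p - 1) * (F ^ (p - 1) * G) = (F * W) ^ (p - 1) * G"
    by (simp only: power_mult_distrib mult_ac)
  ultimately show ?thesis using W by simp
qed

text \<open>
  A zero of \<open>g\<close> of order \<open>e\<close> with \<open>0 < e < p\<close> that is an ordinary point of both equations
  has to satisfy \<open>e < s\<close> by the equation of \<open>F\<close>.  Up to \<open>p\<close>-th powers, \<open>1/F\<close> is
  \<open>g\<^sup>p\<^sup>-\<^sup>1\<close> and has the exponent \<open>e (p - 1)\<close>, which is \<open>-e\<close> modulo \<open>p\<close>; its equation then
  requires \<open>p\<close> to divide \<open>e + j\<close> for some \<open>j < t\<close>, which is impossible as \<open>e + j < s + t \<le> p\<close>.
\<close>

lemma dfinite_prime_divisors:
  fixes F W :: "'a::field_gcd fps"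
  assumes F: "F = fps_of_poly g * F ^ CHAR('a)" and W: "F * W = 1" and p: "prime CHAR('a)"
    and g: "coeff g 0 \<noteq> 0" "degree g < CHAR('a)"
    and odeF: "(\<Sum>i\<le>s. fps_of_poly (a i) * (euler_fps ^^ i) F) = 0"
    and odeW: "(\<Sum>i\<le>t. fps_of_poly (b i) * (euler_fps ^^ i) W) = 0"
    and st: "s + t \<le> CHAR('a)" and \<pi>: "prime \<pi>" "\<pi> dvd g"
  shows "\<pi> dvd a s * b t"
proof (rule ccontr)
  define p where "p = CHAR('a)"
  have p2: "p \<ge> 2" using p by (simp add: p_def prime_ge_2_nat)
  assume "\<not> \<pi> dvd a s * b t"
  hence nd: "\<not> \<pi> dvd a s" "\<not> \<pi> dvd b t" by auto
  have g0: "g \<noteq> 0" using g by auto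
  define e where "e = multiplicity \<pi> g"
  obtain h where gh: "g = \<pi> ^ e * h" and h: "\<not> \<pi> dvd h"
    using multiplicity_decompose'[of g \<pi>] g0 \<pi>(1) unfolding e_def by (metis not_prime_unit)
  have e1: "e \<ge> 1" using \<pi> gh h by (cases e) auto
  have \<pi>0: "\<pi> \<noteq> 0" and h0: "h \<noteq> 0" using gh g0 e1 by auto
  have deg\<pi>: "degree \<pi> > 0"
    using \<pi>(1) by (metis is_unit_iff_degree not_gr_zero not_prime_0 not_prime_unit)
  have "degree g = e * degree \<pi> + degree h"
    using \<pi>0 h0 by (simp add: gh degree_mult_eq degree_power_eq)
  hence dg: "e \<le> degree g" using deg\<pi> by (metis One_nat_def Suc_leI le_add1 le_trans mult.right_neutral mult_le_mono2)
  hence ep: "e < p" using g p_def by simp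
  have "coeff \<pi> 0 \<noteq> 0"
    using g(1) \<pi>(2) by (auto simp: coeff_mult elim!: dvdE)
  moreover have "degree \<pi> < CHAR('a)" using dvd_imp_degree_le[OF \<pi>(2) g0] g(2) by simp
  ultimately have ne: "\<not> \<pi> dvd euler_poly \<pi>" using prime_not_dvd_euler_poly[OF \<pi>(1)] by blast
  have nzF: "F \<noteq> 0" using W by auto
  have "(\<Sum>i\<le>s. a i * (euler_poly ^^ i) g) = 0"
    by (rule poly_ode_of_fps_ode[where H = "F ^ p"])
       (use nzF in \<open>simp_all only: p_def F[symmetric] odeF fps_deriv_power_CHAR power_not_zero
          not_False_eq_True\<close>)
  hence *: "(of_nat (\<Prod>j<s. e - j) :: 'a) = 0" if "s \<le> e"
    using ordinary_point_exponent[where a = a and s = s, OF \<pi>(1) nd(1) ne h] that by (simp add: gh)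
  have es: "e < s"
  proof (rule ccontr)
    assume "\<not> e < s"
    hence "s \<le> e" by simp
    from *[OF this] have "p dvd (\<Prod>j<s. e - j)" unfolding of_nat_eq_0_iff_char_dvd p_def .
    then obtain j where "j < s" "p dvd e - j"
      using p by (auto simp: prime_dvd_prod_iff p_def)
    moreover have "0 < e - j" "e - j < p" using \<open>j < s\<close> \<open>s \<le> e\<close> ep by auto
    ultimately show False by (auto dest: dvd_imp_le)
  qed
  have Wg: "W ^ (p - 1) = fps_of_poly g"
    using inverse_power_of_frobenius_quotient[OF F W] p2 by (simp add: p_def)
  \<comment> \<open>As \<open>W\<^sup>p\<^sup>-\<^sup>1 = g\<close> and \<open>F = 1/W\<close>, the product is \<open>W\<close> to the power
    \<open>(p - 1)\<^sup>2 - (p - 2) p = 1\<close>.\<close>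
  have "fps_of_poly (g ^ (p - 1)) * (F ^ (p - 2)) ^ p = W ^ ((p - 1) * (p - 1)) * F ^ ((p - 2) * p)"
    by (simp add: fps_of_poly_power flip: Wg power_mult)
  also have "(p - 1) * (p - 1) = Suc ((p - 2) * p)"
    using p2 by (auto simp: le_iff_add algebra_simps)
  also have "W ^ Suc ((p - 2) * p) * F ^ ((p - 2) * p) = (F * W) ^ ((p - 2) * p) * W"
    by (simp add: power_mult_distrib mult_ac)
  finally have WF: "W = fps_of_poly (g ^ (p - 1)) * (F ^ (p - 2)) ^ p" by (simp add: W)
  have ode: "(\<Sum>i\<le>t. b i * (euler_poly ^^ i) (g ^ (p - 1))) = 0"
  proof (rule poly_ode_of_fps_ode)
    show "(\<Sum>i\<le>t. fps_of_poly (b i) *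
        (euler_fps ^^ i) (fps_of_poly (g ^ (p - 1)) * (F ^ (p - 2)) ^ p)) = 0"
      unfolding WF[symmetric] by (rule odeW)
    show "fps_deriv ((F ^ (p - 2)) ^ p) = 0" unfolding p_def by (rule fps_deriv_power_CHAR)
    show "(F ^ (p - 2)) ^ p \<noteq> 0" using nzF by simp
  qed
  have gp: "g ^ (p - 1) = \<pi> ^ (e * (p - 1)) * h ^ (p - 1)"
    by (simp add: gh power_mult_distrib power_mult)
  have nh: "\<not> \<pi> dvd h ^ (p - 1)" using h \<pi>(1) by (auto dest: prime_dvd_power)
  have "t \<le> p - 1" using st es e1 p_def by simp
  hence te: "t \<le> e * (p - 1)" using e1 by (metis le_trans mult_le_mono1 nat_mult_1)
  have "(of_nat (\<Prod>j<t. e * (p - 1) - j) :: 'a) = 0"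
    by (rule ordinary_point_exponent[where a = b and s = t, OF \<pi>(1) nd(2) ne nh])
       (use ode te in \<open>simp_all only: gp\<close>)
  hence "p dvd (\<Prod>j<t. e * (p - 1) - j)" unfolding of_nat_eq_0_iff_char_dvd p_def .
  then obtain j where j: "j < t" "p dvd e * (p - 1) - j"
    using p by (auto simp: prime_dvd_prod_iff p_def)
  have "e * (p - 1) - j + (e + j) = e * p"
    using te j(1) p2 by (cases p) (auto simp: algebra_simps)
  hence "p dvd e + j" using j(2) by (metis dvd_add_right_iff dvd_triv_right)
  moreover have "0 < e + j" "e + j < p" using e1 es j(1) st p_def by auto
  ultimately show False by (auto dest: dvd_imp_le)
qed

lemma fps_power_CHAR_add:
  fixes F G :: "'a::comm_ring_1 fps"
  assumes "prime CHAR('a)"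
  shows "(F + G) ^ CHAR('a) = F ^ CHAR('a) + G ^ CHAR('a)"
  using freshmans_dream[of _ F G] assms by (simp add: semiring_char_fps)

text \<open>
  \<open>F(z)\<^sup>p = F(z\<^sup>p)\<close> over the prime field: the Frobenius map is additive and fixes the
  coefficients.
\<close>

lemma fps_nth_power_CARD:
  fixes F :: "'p::prime_card mod_ring fps"
  shows "fps_nth (F ^ CARD('p)) n = (if CARD('p) dvd n then fps_nth F (n div CARD('p)) else 0)"
proof -
  define p where "p = CARD('p)"
  have char: "CHAR('p mod_ring) = p" by (simp add: p_def)
  have p: "prime p" using prime_card[where 'a = 'p] by (simp add: p_def)
  hence p0: "p > 0" by (rule prime_gt_0_nat)
  have const: "c ^ p = c" for c :: "'p mod_ring"
    using finite_field_power_card_eq_same[of c] by (simp add: p_def)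
  define T where "T = (\<Sum>i\<le>n. fps_const (fps_nth F i) * fps_X ^ i)"
  have nthT: "fps_nth T k = (if k \<le> n then fps_nth F k else 0)" for k
    by (simp add: T_def fps_sum_nth if_distrib[of "\<lambda>x. _ * x"] cong: if_cong)
  have dec: "F = T + fps_X ^ Suc n * fps_shift (Suc n) F"
    by (rule fps_ext) (simp add: nthT fps_X_power_mult_nth del: power_Suc)
  have "F ^ p = T ^ p + (fps_X ^ Suc n * fps_shift (Suc n) F) ^ p"
    using fps_power_CHAR_add[of T "fps_X ^ Suc n * fps_shift (Suc n) F"] p unfolding char dec[symmetric] .
  also have "(fps_X ^ Suc n * fps_shift (Suc n) F) ^ p = fps_X ^ (Suc n * p) * fps_shift (Suc n) F ^ p"
    by (simp only: power_mult_distrib power_mult)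
  also have "fps_nth (T ^ p + \<dots>) n = fps_nth (T ^ p) n"
  proof -
    have "n < Suc n * p" using p0 by (cases p) auto
    thus ?thesis by (simp add: fps_X_power_mult_nth)
  qed
  also have "T ^ p = (\<Sum>i\<le>n. (fps_const (fps_nth F i) * fps_X ^ i) ^ p)"
    unfolding T_def by (rule freshmans_dream_sum) (use p in \<open>simp_all only: semiring_char_fps char\<close>)
  also have "\<dots> = (\<Sum>i\<le>n. fps_const (fps_nth F i) * fps_X ^ (i * p))"
    by (simp add: power_mult_distrib const power_mult)
  also have "fps_nth \<dots> n = (\<Sum>i\<le>n. if n = i * p then fps_nth F i else 0)"
    by (simp add: fps_sum_nth if_distrib[of "\<lambda>x. _ * x"] cong: if_cong)
  also have "\<dots> = (if p dvd n then fps_nth F (n div p) else 0)"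
  proof (cases "p dvd n")
    case True
    hence "(\<Sum>i\<le>n. if n = i * p then fps_nth F i else 0) =
      (\<Sum>i\<le>n. if i = n div p then fps_nth F i else 0)"
      using p0 by (intro sum.cong) auto
    thus ?thesis using True by simp
  qed (auto intro!: sum.neutral)
  finally show ?thesis by (simp add: p_def)
qed

section \<open>Lucas sequences modulo a prime\<close>

definition lucas_mod :: "nat \<Rightarrow> (nat \<Rightarrow> int) \<Rightarrow> bool" where
  "lucas_mod p f \<longleftrightarrow> (\<forall>n j. j < p \<longrightarrow> [f (p * n + j) = f n * f j] (mod int p))"

text \<open>
  The Lucas congruences say \<open>F(z) = g(z) F(z\<^sup>p)\<close>, where \<open>g\<close> is the truncation of \<open>F\<close> to
  degrees below \<open>p\<close>.
\<close>

lemma lucas_mod_imp_frobenius_quotient: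
  fixes f :: "nat \<Rightarrow> int"
  assumes "lucas_mod CARD('p::prime_card) f"
  defines "F \<equiv> fps_reduce (Abs_fps f) :: 'p mod_ring fps"
  defines "g \<equiv> (\<Sum>j<CARD('p). monom (of_int (f j)) j)"
  shows "F = fps_of_poly g * F ^ CHAR('p mod_ring)"
proof (rule fps_ext)
  fix n
  define p where "p = CARD('p)"
  have p0: "p > 0" by (simp add: p_def)
  define m where "m = n div p"
  define j where "j = n mod p"
  have n: "n = p * m + j" and j: "j < p" using p0 by (auto simp: m_def j_def)
  have nF: "fps_nth F k = of_int (f k)" for k by (simp add: F_def fps_reduce_def)
  have cg: "coeff g i = (if i < p then of_int (f i) else 0)" for i
    by (simp add: g_def coeff_sum coeff_monom p_def)
  have "fps_nth (fps_of_poly g * F ^ CHAR('p mod_ring)) n =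
    (\<Sum>i\<le>n. coeff g i * (if p dvd n - i then of_int (f ((n - i) div p)) else 0))"
    by (simp add: fps_mult_nth fps_nth_power_CARD nF p_def atLeast0AtMost cong: if_cong)
  also have "\<dots> = (\<Sum>i\<le>n. if i = j then of_int (f j) * of_int (f m) else 0)"
  proof (rule sum.cong[OF refl])
    fix i assume i: "i \<in> {..n}"
    show "coeff g i * (if p dvd n - i then of_int (f ((n - i) div p)) else 0) =
      (if i = j then of_int (f j) * of_int (f m) else (0 :: 'p mod_ring))"
    proof (cases "i = j")
      case True
      thus ?thesis using j p0 by (simp add: cg n)
    next
      case False
      have "\<not> (i < p \<and> p dvd n - i)"
        using i j False by (metis atMost_iff j_def mod_eq_dvd_iff_nat mod_less)
      thus ?thesis using False by (auto simp: cg)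
    qed
  qed
  also have "\<dots> = of_int (f m * f j)" using n by simp
  also have "\<dots> = (of_int (f n) :: 'p mod_ring)"
  proof -
    have "[f n - f m * f j = 0] (mod int CARD('p))"
      using assms(1) j n unfolding lucas_mod_def p_def by (simp add: cong_diff_iff_cong_0)
    hence "(of_int (f n - f m * f j) :: 'p mod_ring) = 0" unfolding of_int_mod_ring_eq_0_iff .
    thus ?thesis by simp
  qed
  finally show "fps_nth F n = fps_nth (fps_of_poly g * F ^ CHAR('p mod_ring)) n" by (simp add: nF)
qed

abbreviation red_poly :: "int poly \<Rightarrow> 'a::comm_ring_1 poly" where
  "red_poly \<equiv> map_poly of_int"

lemma red_poly_mult: "red_poly (p * q) = red_poly p * red_poly q"
  by (metis fps_of_poly_eq_iff fps_of_poly_mult fps_reduce_fps_of_poly fps_reduce_mult)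

lemma fps_reduce_euler: "fps_reduce ((euler_fps ^^ i) F) = (euler_fps ^^ i) (fps_reduce F)"
  by (rule fps_ext) (simp add: fps_reduce_def nth_euler_fps_iterate)

lemma fps_reduce_deriv: "fps_reduce (fps_deriv F) = fps_deriv (fps_reduce F)"
  by (rule fps_ext) (simp add: fps_reduce_def)

lemma fps_reduce_0 [simp]: "fps_reduce 0 = 0" and fps_reduce_1 [simp]: "fps_reduce 1 = 1"
  by (simp_all add: fps_reduce_def fps_eq_iff)

lemma red_poly_eq_0_iff:
  "(red_poly q :: 'p::prime_card mod_ring poly) = 0 \<longleftrightarrow> (\<forall>i. int CARD('p) dvd coeff q i)"
  by (simp add: poly_eq_iff coeff_map_poly of_int_mod_ring_eq_0_iff cong_0_iff)

lemma dvd_fps_nth_iff_reduce: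
  "int CARD('p) dvd fps_nth F n \<longleftrightarrow> fps_nth (fps_reduce F :: 'p::prime_card mod_ring fps) n = 0"
  by (simp add: fps_reduce_def of_int_mod_ring_eq_0_iff cong_0_iff)

text \<open>
  Modulo \<open>p\<close>, the series \<open>q F'/F\<close> is a polynomial of degree less than that of \<open>q\<close>.  The
  inverse of \<open>F\<close> appears as \<open>W\<close> since the coefficients are integers.
\<close>

definition log_deriv_bounded_mod :: "nat \<Rightarrow> (nat \<Rightarrow> int) \<Rightarrow> int poly \<Rightarrow> bool" where
  "log_deriv_bounded_mod p f q \<longleftrightarrow> (\<forall>W. Abs_fps f * W = 1 \<longrightarrow>
     (\<forall>n\<ge>degree q. int p dvd fps_nth (fps_of_poly q * fps_deriv (Abs_fps f) * W) n))"

text \<open>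
  This and the next definition phrase the two results on prime factors of \<open>g\<close> without a type
  for the field \<open>\<int>/p\<close>, so that \<open>p\<close> can be a bound variable.
\<close>

definition algebraic_lucas_claim :: "nat \<Rightarrow> bool" where
  "algebraic_lucas_claim p \<longleftrightarrow> (\<forall>f Q r. lucas_mod p f \<longrightarrow> f 0 = 1 \<longrightarrow>
     (\<Sum>k\<le>r. fps_of_poly (Q k) * Abs_fps f ^ k) = 0 \<longrightarrow>
     (\<exists>i. \<not> int p dvd coeff (Q r) i) \<longrightarrow> log_deriv_bounded_mod p f (Q r))"

definition dfinite_lucas_claim :: "nat \<Rightarrow> bool" where
  "dfinite_lucas_claim p \<longleftrightarrow> (\<forall>f W a s b t. lucas_mod p f \<longrightarrow> f 0 = 1 \<longrightarrow> Abs_fps f * W = 1 \<longrightarrow>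
     (\<Sum>i\<le>s. fps_of_poly (a i) * (euler_fps ^^ i) (Abs_fps f)) = 0 \<longrightarrow>
     (\<Sum>i\<le>t. fps_of_poly (b i) * (euler_fps ^^ i) W) = 0 \<longrightarrow> s + t \<le> p \<longrightarrow>
     (\<exists>i. \<not> int p dvd coeff (a s * b t) i) \<longrightarrow> log_deriv_bounded_mod p f (a s * b t))"

lemma reduced_lucas_series:
  fixes f :: "nat \<Rightarrow> int"
  assumes "lucas_mod CARD('p::prime_card) f" "f 0 = 1"
  obtains g :: "'p::prime_card mod_ring poly" where
    "fps_reduce (Abs_fps f) = fps_of_poly g * fps_reduce (Abs_fps f) ^ CHAR('p mod_ring)"
    "coeff g 0 = 1" "degree g < CHAR('p mod_ring)"
proof
  define g :: "'p mod_ring poly" where "g = (\<Sum>j<CARD('p). monom (of_int (f j)) j)"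
  have p: "CARD('p) > 1" by (rule nontriv)
  show "fps_reduce (Abs_fps f) = fps_of_poly g * fps_reduce (Abs_fps f) ^ CHAR('p mod_ring)"
    unfolding g_def by (rule lucas_mod_imp_frobenius_quotient) fact
  have cg: "coeff g i = (if i < CARD('p) then of_int (f i) else 0)" for i
    by (simp add: g_def coeff_sum coeff_monom)
  show "coeff g 0 = 1" using p by (simp add: cg assms(2))
  have "degree g \<le> CARD('p) - 1" by (rule degree_le) (use cg in auto)
  with p show "degree g < CHAR('p mod_ring)" by simp
qed

lemma log_deriv_bounded_modI:
  fixes f :: "nat \<Rightarrow> int" and g :: "'p::prime_card mod_ring poly"
  assumes F: "fps_reduce (Abs_fps f) = fps_of_poly g * fps_reduce (Abs_fps f) ^ CHAR('p mod_ring)"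
    and q: "\<exists>i. \<not> int CARD('p) dvd coeff q i"
    and pr: "\<And>\<pi>. prime \<pi> \<Longrightarrow> \<pi> dvd g \<Longrightarrow> \<pi> dvd red_poly q"
  shows "log_deriv_bounded_mod CARD('p) f q"
  unfolding log_deriv_bounded_mod_def
proof (intro allI impI)
  fix W n assume W: "Abs_fps f * W = 1" and n: "degree q \<le> n"
  have q': "(red_poly q :: 'p mod_ring poly) \<noteq> 0" using q unfolding red_poly_eq_0_iff by blast
  have "fps_nth (fps_of_poly (red_poly q :: 'p mod_ring poly) * fps_deriv (fps_reduce (Abs_fps f))
      * fps_reduce W) n = 0"
  proof (rule frobenius_quotient_log_deriv[OF F _ q' pr])
    show "fps_reduce (Abs_fps f) * fps_reduce W = (1 :: 'p mod_ring fps)"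
      by (simp add: W flip: fps_reduce_mult)
    show "degree (red_poly q :: 'p mod_ring poly) \<le> n"
      using n degree_map_poly_le le_trans by blast
  qed
  thus "int CARD('p) dvd fps_nth (fps_of_poly q * fps_deriv (Abs_fps f) * W) n"
    unfolding dvd_fps_nth_iff_reduce
    by (simp add: fps_reduce_mult fps_reduce_deriv fps_reduce_fps_of_poly)
qed

lemma algebraic_lucas_claim_CARD: "algebraic_lucas_claim CARD('p::prime_card)"
  unfolding algebraic_lucas_claim_def
proof (intro allI impI)
  fix f r and Q :: "nat \<Rightarrow> int poly"
  assume f: "lucas_mod CARD('p) f" "f 0 = 1"
    and rel: "(\<Sum>k\<le>r. fps_of_poly (Q k) * Abs_fps f ^ k) = 0"
    and nz: "\<exists>i. \<not> int CARD('p) dvd coeff (Q r) i"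
  obtain g :: "'p mod_ring poly" where
    g: "fps_reduce (Abs_fps f) = fps_of_poly g * fps_reduce (Abs_fps f) ^ CHAR('p mod_ring)"
    by (rule reduced_lucas_series[OF f])
  define F where "F = (fps_reduce (Abs_fps f) :: 'p mod_ring fps)"
  have F: "F = fps_of_poly g * F ^ CARD('p)" using g by (simp add: F_def)
  have p: "CARD('p) > 1" by (rule nontriv)
  have "fps_nth F 0 = 1" by (simp add: F_def fps_reduce_def f)
  hence W: "F * inverse F = 1" by (subst mult.commute) (simp add: inverse_mult_eq_1)
  have rel': "(\<Sum>k\<le>r. fps_of_poly (red_poly (Q k) :: 'p mod_ring poly) * F ^ k) = 0"
    using arg_cong[OF rel, of "fps_reduce :: _ \<Rightarrow> 'p mod_ring fps"]
    by (simp add: F_def fps_reduce_sum fps_reduce_mult fps_reduce_power fps_reduce_fps_of_poly)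
  have "\<pi> dvd red_poly (Q r)" if "prime \<pi>" "\<pi> dvd g" for \<pi> :: "'p mod_ring poly"
  proof -
    have nz': "(red_poly (Q r) :: 'p mod_ring poly) \<noteq> 0" using nz unfolding red_poly_eq_0_iff by blast
    show ?thesis
      by (rule algebraic_prime_divisors[where Q = "\<lambda>k. red_poly (Q k)" and r = r,
            OF W inverse_power_of_frobenius_quotient[OF F W]])
         (use that p rel' nz' in simp_all)
  qed
  with g nz show "log_deriv_bounded_mod CARD('p) f (Q r)" by (intro log_deriv_bounded_modI)
qed

lemma dfinite_lucas_claim_CARD: "dfinite_lucas_claim CARD('p::prime_card)"
  unfolding dfinite_lucas_claim_def
proof (intro allI impI)
  fix f W s t and a b :: "nat \<Rightarrow> int poly"
  assume f: "lucas_mod CARD('p) f" "f 0 = 1" and W: "Abs_fps f * W = 1"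
    and odeF: "(\<Sum>i\<le>s. fps_of_poly (a i) * (euler_fps ^^ i) (Abs_fps f)) = 0"
    and odeW: "(\<Sum>i\<le>t. fps_of_poly (b i) * (euler_fps ^^ i) W) = 0"
    and st: "s + t \<le> CARD('p)" and nz: "\<exists>i. \<not> int CARD('p) dvd coeff (a s * b t) i"
  obtain g :: "'p mod_ring poly" where
    g: "fps_reduce (Abs_fps f) = fps_of_poly g * fps_reduce (Abs_fps f) ^ CHAR('p mod_ring)"
    "coeff g 0 = 1" "degree g < CHAR('p mod_ring)"
    by (rule reduced_lucas_series[OF f])
  have "\<pi> dvd red_poly (a s * b t)" if "prime \<pi>" "\<pi> dvd g" for \<pi> :: "'p mod_ring poly"
    unfolding red_poly_mult
  proof (rule dfinite_prime_divisors[OF g(1) _ _ _ g(3)])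
    show "fps_reduce (Abs_fps f) * fps_reduce W = (1 :: 'p mod_ring fps)"
      by (simp add: W flip: fps_reduce_mult)
    show "prime CHAR('p mod_ring)" using prime_card[where 'a = 'p] by simp
    show "(\<Sum>i\<le>s. fps_of_poly (red_poly (a i)) * (euler_fps ^^ i) (fps_reduce (Abs_fps f))) =
        (0 :: 'p mod_ring fps)"
      using arg_cong[OF odeF, of "fps_reduce :: _ \<Rightarrow> 'p mod_ring fps"]
      by (simp add: fps_reduce_sum fps_reduce_mult fps_reduce_euler fps_reduce_fps_of_poly)
    show "(\<Sum>i\<le>t. fps_of_poly (red_poly (b i)) * (euler_fps ^^ i) (fps_reduce W)) =
        (0 :: 'p mod_ring fps)"
      using arg_cong[OF odeW, of "fps_reduce :: _ \<Rightarrow> 'p mod_ring fps"]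
      by (simp add: fps_reduce_sum fps_reduce_mult fps_reduce_euler fps_reduce_fps_of_poly)
  qed (use g that st in simp_all)
  with g(1) nz show "log_deriv_bounded_mod CARD('p) f (a s * b t)" by (intro log_deriv_bounded_modI)
qed

text \<open>
  \<open>F\<close> is a root of \<open>Y - g Y\<^sup>p\<close>.
\<close>

lemma lucas_algebraic_mod_CARD:
  assumes "lucas_mod CARD('p::prime_card) f"
  shows "algebraic_seq_mod CARD('p) f"
proof -
  define p where "p = CARD('p)"
  have p: "p > 1" unfolding p_def by (rule nontriv)
  define F where "F = (fps_reduce (Abs_fps f) :: 'p mod_ring fps)"
  define g :: "'p mod_ring poly" where "g = (\<Sum>j<CARD('p). monom (of_int (f j)) j)"
  have F: "F = fps_of_poly g * F ^ p"
    using lucas_mod_imp_frobenius_quotient[OF assms] by (simp add: F_def g_def p_def)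
  have F': "Abs_fps (\<lambda>n. of_int (f n)) = F" by (simp add: F_def fps_reduce_def)
  define Q where "Q = (\<lambda>k. if k = 1 then 1 else if k = p then - g else 0)"
  have "(\<Sum>k\<le>p. fps_of_poly (Q k) * F ^ k) = (\<Sum>k\<in>{1, p}. fps_of_poly (Q k) * F ^ k)"
    using p by (intro sum.mono_neutral_right) (auto simp: Q_def)
  also have "\<dots> = F - fps_of_poly g * F ^ p"
    using p by (simp add: Q_def fps_of_poly_uminus)
  also have "\<dots> = 0" by (simp only: F[symmetric] diff_self)
  finally have "algebraic_seq (\<lambda>n. of_int (f n) :: 'p mod_ring)"
    unfolding algebraic_seq_def F' using p
    by (intro exI[of _ p] exI[of _ Q] conjI exI[of _ 1]) (simp_all add: Q_def)
  thus ?thesis unfolding algebraic_seq_mod_iff .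
qed

definition lucas_claims :: "nat \<Rightarrow> bool" where
  "lucas_claims p \<longleftrightarrow> algebraic_lucas_claim p \<and> dfinite_lucas_claim p \<and>
     (\<forall>f. lucas_mod p f \<longrightarrow> algebraic_seq_mod p f)"

text \<open>
  What is proved for the field with \<open>CARD('p)\<close> elements, for an arbitrary index type \<open>'p\<close> of
  prime cardinality, holds for all primes: if it failed for some prime, it would fail for this
  one, which is a constant and can therefore be the cardinality of a type.  The value \<open>2\<close> is a
  default.
\<close>

definition exceptional_prime :: nat where
  "exceptional_prime = (if \<exists>p. prime p \<and> \<not> lucas_claims p
     then SOME p. prime p \<and> \<not> lucas_claims p else 2)"

lemma prime_exceptional_prime: "prime exceptional_prime"
  using someI_ex[of "\<lambda>p. prime p \<and> \<not> lucas_claims p"] by (auto simp: exceptional_prime_def)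

typedef exceptional_index = "{..<exceptional_prime}"
  using prime_gt_0_nat[OF prime_exceptional_prime] by blast

lemma CARD_exceptional_index: "CARD(exceptional_index) = exceptional_prime"
  using type_definition.card[OF type_definition_exceptional_index] by simp

instance exceptional_index :: prime_card
  by standard (simp add: CARD_exceptional_index prime_exceptional_prime)

lemma lucas_claims:
  assumes "prime p"
  shows "lucas_claims p"
proof (rule ccontr)
  assume "\<not> lucas_claims p"
  with assms have ex: "\<exists>p. prime p \<and> \<not> lucas_claims p" by blast
  hence "\<not> lucas_claims exceptional_prime"
    unfolding exceptional_prime_def using someI_ex[OF ex] by simp
  moreover have "lucas_claims CARD(exceptional_index)"
    unfolding lucas_claims_def
    using algebraic_lucas_claim_CARD dfinite_lucas_claim_CARD lucas_algebraic_mod_CARD by blast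
  ultimately show False by (simp add: CARD_exceptional_index)
qed

section \<open>Integer relations and integer differential equations\<close>

text \<open>
  A \<open>\<rat>\<close>-linear functional that takes the value \<open>1\<close> at \<open>c i0\<close> maps the relation with
  coefficients \<open>c\<close> to one with rational coefficients; clearing denominators makes them integers.
  The same \<open>\<psi>\<close> serves all integer vectors \<open>g\<close>, hence the infinitely many relations that
  make up an identity of power series or a recurrence.
\<close>

lemma integer_relations_descend:
  fixes c :: "'i \<Rightarrow> 'a::field_char_0"
  assumes I: "finite I" and c: "c i0 \<noteq> 0"
  obtains \<psi> :: "'i \<Rightarrow> int" where "i0 \<in> I \<Longrightarrow> \<psi> i0 \<noteq> 0"
    "\<And>g. (\<Sum>i\<in>I. of_int (g i) * c i) = 0 \<Longrightarrow> (\<Sum>i\<in>I. g i * \<psi> i) = 0"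
proof -
  interpret Q: vector_space_pair "\<lambda>(q::rat) (z::'a). of_rat q * z" "\<lambda>(q::rat) (z::rat). q * z"
    by unfold_locales (simp_all add: of_rat_add of_rat_mult algebra_simps)
  have "\<not> Q.vs1.dependent {c i0}" using c by (simp add: Q.vs1.dependent_single)
  from Q.linear_independent_extend[OF this, of "\<lambda>_. 1"]
  obtain \<phi> where lin: "Vector_Spaces.linear (\<lambda>q z. of_rat q * z) (*) \<phi>" and \<phi>1: "\<phi> (c i0) = 1"
    by auto
  interpret \<phi>: Vector_Spaces.linear "\<lambda>(q::rat) (z::'a). of_rat q * z" "(*)" \<phi> by (rule lin)
  have "\<exists>D::int. D \<noteq> 0 \<and> (\<forall>i\<in>I. of_int D * \<phi> (c i) \<in> \<int>)"
    using I
  proof (induction I)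
    case empty
    show ?case by (intro exI[of _ 1]) simp
  next
    case (insert i I)
    then obtain D where D: "D \<noteq> 0" "\<forall>i\<in>I. of_int D * \<phi> (c i) \<in> \<int>" by blast
    obtain a b where ab: "\<phi> (c i) = of_int a / of_int b" "b > 0"
      by (metis quotient_of_div quotient_of_denom_pos surj_pair)
    have "of_int (b * D) * \<phi> (c j) \<in> \<int>" if "j \<in> insert i I" for j
    proof (cases "j = i")
      case True
      have "of_int (b * D) * \<phi> (c i) = of_int (D * a)" using ab by simp
      thus ?thesis using True by (metis Ints_of_int)
    next
      case False
      hence "of_int D * \<phi> (c j) \<in> \<int>" using D(2) that by blast
      hence "of_int b * (of_int D * \<phi> (c j)) \<in> \<int>" by (rule Ints_mult[OF Ints_of_int])
      thus ?thesis by (simp only: of_int_mult mult.assoc)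
    qed
    thus ?case using D(1) ab(2) by (intro exI[of _ "b * D"]) auto
  qed
  then obtain D :: int where D: "D \<noteq> 0" "\<forall>i\<in>I. of_int D * \<phi> (c i) \<in> \<int>" by blast
  then have "\<exists>\<psi>::'i \<Rightarrow> int. \<forall>i\<in>I. of_int D * \<phi> (c i) = of_int (\<psi> i)"
    by (intro bchoice) (auto elim: Ints_cases)
  then obtain \<psi> :: "'i \<Rightarrow> int" where \<psi>: "\<And>i. i \<in> I \<Longrightarrow> of_int D * \<phi> (c i) = of_int (\<psi> i)" by blast
  show ?thesis
  proof
    assume "i0 \<in> I"
    from \<psi>[OF this] D(1) \<phi>1 show "\<psi> i0 \<noteq> 0" by auto
  next
    fix g :: "'i \<Rightarrow> int"
    assume "(\<Sum>i\<in>I. of_int (g i) * c i) = 0"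
    hence "(\<Sum>i\<in>I. of_rat (of_int (g i)) * c i) = 0" by simp
    hence "\<phi> (\<Sum>i\<in>I. of_rat (of_int (g i)) * c i) = 0" by (simp add: \<phi>.zero)
    hence "(\<Sum>i\<in>I. of_int (g i) * \<phi> (c i)) = 0" by (simp only: \<phi>.sum \<phi>.scale)
    hence "of_int D * (\<Sum>i\<in>I. of_int (g i) * \<phi> (c i)) = 0" by simp
    also have "of_int D * (\<Sum>i\<in>I. of_int (g i) * \<phi> (c i)) = (\<Sum>i\<in>I. of_int (g i) * (of_int D * \<phi> (c i)))"
      unfolding sum_distrib_left by (simp only: mult.left_commute)
    also have "\<dots> = of_int (\<Sum>i\<in>I. g i * \<psi> i)"
      unfolding of_int_sum of_int_mult by (rule sum.cong[OF refl]) (simp only: \<psi>)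
    finally show "(\<Sum>i\<in>I. g i * \<psi> i) = 0" by (simp only: of_int_eq_0_iff)
  qed
qed

lemma exists_last_nonzero:
  assumes "\<exists>k\<le>r::nat. a k \<noteq> 0"
  obtains s where "s \<le> r" "a s \<noteq> 0" "\<And>k. s < k \<Longrightarrow> k \<le> r \<Longrightarrow> a k = 0"
proof
  define S where "S = {k. k \<le> r \<and> a k \<noteq> 0}"
  have S: "finite S" "S \<noteq> {}" using assms by (auto simp: S_def)
  show "Max S \<le> r" "a (Max S) \<noteq> 0" using Max_in[OF S] by (auto simp: S_def)
  show "a k = 0" if "Max S < k" "k \<le> r" for k
  proof (rule ccontr)
    assume "a k \<noteq> 0"
    with that(2) have "k \<in> S" by (simp add: S_def)
    with Max_ge[OF S(1)] that(1) show False by (meson leD)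
  qed
qed

lemma sum_le_last_nonzero:
  fixes h :: "nat \<Rightarrow> 'a::comm_monoid_add"
  assumes "s \<le> r" "\<And>k. s < k \<Longrightarrow> k \<le> r \<Longrightarrow> h k = 0"
  shows "(\<Sum>k\<le>r. h k) = (\<Sum>k\<le>s. h k)"
  by (rule sum.mono_neutral_right) (use assms in auto)

lemma coeff_degree_bound:
  obtains N where "\<And>k i. k \<le> (r::nat) \<Longrightarrow> N < i \<Longrightarrow> coeff (P k) i = 0"
proof
  fix k i assume "k \<le> r" "Max ((\<lambda>k. degree (P k)) ` {..r}) < i"
  moreover from this(1) have "degree (P k) \<le> Max ((\<lambda>k. degree (P k)) ` {..r})" by (intro Max_ge) auto
  ultimately show "coeff (P k) i = 0" by (intro coeff_eq_0) simp
qed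

lemma poly_eq_sum_coeff:
  fixes p :: "'a::comm_ring_1 poly"
  assumes "\<And>i. N < i \<Longrightarrow> coeff p i = 0"
  shows "poly p x = (\<Sum>i\<le>N. coeff p i * x ^ i)"
  unfolding poly_altdef
  by (rule sum.mono_neutral_left) (use assms degree_le[of N p] in \<open>auto simp: coeff_eq_0\<close>)

text \<open>
  The coefficients of a power series identity are integer relations between the coefficients of
  the polynomials \<open>Q\<^sub>k\<close>, so the descent applies to all of them simultaneously.
\<close>

lemma algebraic_seq_integer_relation:
  fixes f :: "nat \<Rightarrow> int"
  assumes "algebraic_seq (\<lambda>n. of_int (f n) :: 'a::field_char_0)"
  obtains r and Q :: "nat \<Rightarrow> int poly" where
    "Q r \<noteq> 0" "(\<Sum>k\<le>r. fps_of_poly (Q k) * Abs_fps f ^ k) = 0"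
proof -
  obtain r and Q :: "nat \<Rightarrow> 'a poly" where ex: "\<exists>k\<le>r. Q k \<noteq> 0"
    and rel: "(\<Sum>k\<le>r. fps_of_poly (Q k) * Abs_fps (\<lambda>n. of_int (f n)) ^ k) = 0"
    using assms unfolding algebraic_seq_def by blast
  have F: "(Abs_fps (\<lambda>n. of_int (f n)) :: 'a fps) = fps_reduce (Abs_fps f)"
    by (simp add: fps_reduce_def)
  obtain N where N: "\<And>k i. k \<le> r \<Longrightarrow> N < i \<Longrightarrow> coeff (Q k) i = 0" using coeff_degree_bound by blast
  from ex obtain k0 i0 where k0: "k0 \<le> r" "coeff (Q k0) i0 \<noteq> 0" by (auto simp: poly_eq_iff)
  hence i0: "i0 \<le> N" using N not_less by blast
  obtain \<psi> :: "nat \<times> nat \<Rightarrow> int" where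
    \<psi>0: "\<psi> (k0, i0) \<noteq> 0" and
    \<psi>: "\<And>g. (\<Sum>x\<in>{..r} \<times> {..N}. of_int (g x) * coeff (Q (fst x)) (snd x)) = 0
      \<Longrightarrow> (\<Sum>x\<in>{..r} \<times> {..N}. g x * \<psi> x) = 0"
    using integer_relations_descend[of "{..r} \<times> {..N}" "\<lambda>x. coeff (Q (fst x)) (snd x)" "(k0, i0)"]
      k0 i0 by auto
  define P where "P = (\<lambda>k. \<Sum>i\<le>N. monom (\<psi> (k, i)) i)"
  have cP: "coeff (P k) i = (if i \<le> N then \<psi> (k, i) else 0)" for k i
    by (simp add: P_def coeff_sum coeff_monom)
  have nth: "fps_nth (fps_of_poly q * G) n =
      (\<Sum>i\<le>N. coeff q i * (if i \<le> n then fps_nth G (n - i) else 0))"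
    if "\<And>i. N < i \<Longrightarrow> coeff q i = 0" for q :: "'b::comm_ring_1 poly" and G n
  proof -
    have "fps_nth (fps_of_poly q * G) n = (\<Sum>i\<le>n. coeff q i * (if i \<le> n then fps_nth G (n - i) else 0))"
      by (simp add: fps_mult_nth atLeast0AtMost)
    also have "\<dots> = (\<Sum>i\<le>max n N. coeff q i * (if i \<le> n then fps_nth G (n - i) else 0))"
      by (rule sum.mono_neutral_left) auto
    also have "\<dots> = (\<Sum>i\<le>N. coeff q i * (if i \<le> n then fps_nth G (n - i) else 0))"
      by (rule sum.mono_neutral_right) (use that in auto)
    finally show ?thesis .
  qed
  have relP: "(\<Sum>k\<le>r. fps_of_poly (P k) * Abs_fps f ^ k) = 0"
  proof (rule fps_ext)
    fix n
    define g where "g = (\<lambda>(k, i). if i \<le> n then fps_nth (Abs_fps f ^ k) (n - i) else 0)"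
    have "0 = fps_nth (\<Sum>k\<le>r. fps_of_poly (Q k) * fps_reduce (Abs_fps f ^ k)) n"
      using rel unfolding F fps_reduce_power by simp
    also have "\<dots> = (\<Sum>k\<le>r. \<Sum>i\<le>N. coeff (Q k) i * of_int (g (k, i)))"
      unfolding fps_sum_nth
    proof (rule sum.cong[OF refl])
      fix k assume "k \<in> {..r}"
      thus "fps_nth (fps_of_poly (Q k) * fps_reduce (Abs_fps f ^ k)) n =
          (\<Sum>i\<le>N. coeff (Q k) i * of_int (g (k, i)))"
        by (subst nth) (use N in \<open>auto simp: fps_reduce_def g_def intro!: sum.cong\<close>)
    qed
    also have "\<dots> = (\<Sum>x\<in>{..r} \<times> {..N}. of_int (g x) * coeff (Q (fst x)) (snd x))"
      by (simp add: sum.cartesian_product mult.commute case_prod_unfold)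
    finally have "(\<Sum>x\<in>{..r} \<times> {..N}. g x * \<psi> x) = 0" by (intro \<psi>) simp
    also have "(\<Sum>x\<in>{..r} \<times> {..N}. g x * \<psi> x) = (\<Sum>k\<le>r. \<Sum>i\<le>N. \<psi> (k, i) * g (k, i))"
      by (simp add: sum.cartesian_product mult.commute case_prod_unfold)
    also have "\<dots> = fps_nth (\<Sum>k\<le>r. fps_of_poly (P k) * Abs_fps f ^ k) n"
      unfolding fps_sum_nth
      by (rule sum.cong[OF refl], subst nth) (auto simp: cP g_def intro!: sum.cong)
    finally show "fps_nth (\<Sum>k\<le>r. fps_of_poly (P k) * Abs_fps f ^ k) n = fps_nth 0 n" by simp
  qed
  have "P k0 \<noteq> 0" using \<psi>0 i0 cP[of k0 i0] by auto
  then obtain s where s: "s \<le> r" "P s \<noteq> 0" "\<And>k. s < k \<Longrightarrow> k \<le> r \<Longrightarrow> P k = 0"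
    using exists_last_nonzero[of r P] k0 by blast
  have "(\<Sum>k\<le>s. fps_of_poly (P k) * Abs_fps f ^ k) = 0"
    using relP sum_le_last_nonzero[of s r "\<lambda>k. fps_of_poly (P k) * Abs_fps f ^ k"] s by simp
  with s(2) that show ?thesis by blast
qed

lemma P_recursive_integer_recurrence:
  fixes f :: "nat \<Rightarrow> int"
  assumes "P_recursive (\<lambda>n. of_int (f n) :: 'a::field_char_0)"
  obtains r n0 and P :: "nat \<Rightarrow> int poly" where
    "\<exists>k\<le>r. P k \<noteq> 0" "\<forall>n\<ge>n0. (\<Sum>k\<le>r. poly (P k) (int n) * f (n + k)) = 0"
proof -
  obtain r n0 and Q :: "nat \<Rightarrow> 'a poly" where ex: "\<exists>k\<le>r. Q k \<noteq> 0"
    and rel: "\<And>n. n \<ge> n0 \<Longrightarrow> (\<Sum>k\<le>r. poly (Q k) (of_nat n) * of_int (f (n + k))) = 0"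
    using assms unfolding P_recursive_def by blast
  obtain N where N: "\<And>k i. k \<le> r \<Longrightarrow> N < i \<Longrightarrow> coeff (Q k) i = 0" using coeff_degree_bound by blast
  from ex obtain k0 i0 where k0: "k0 \<le> r" "coeff (Q k0) i0 \<noteq> 0" by (auto simp: poly_eq_iff)
  hence i0: "i0 \<le> N" using N not_less by blast
  obtain \<psi> :: "nat \<times> nat \<Rightarrow> int" where
    \<psi>0: "\<psi> (k0, i0) \<noteq> 0" and
    \<psi>: "\<And>g. (\<Sum>x\<in>{..r} \<times> {..N}. of_int (g x) * coeff (Q (fst x)) (snd x)) = 0
      \<Longrightarrow> (\<Sum>x\<in>{..r} \<times> {..N}. g x * \<psi> x) = 0"
    using integer_relations_descend[of "{..r} \<times> {..N}" "\<lambda>x. coeff (Q (fst x)) (snd x)" "(k0, i0)"]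
      k0 i0 by auto
  define P where "P = (\<lambda>k. \<Sum>i\<le>N. monom (\<psi> (k, i)) i)"
  have cP: "coeff (P k) i = (if i \<le> N then \<psi> (k, i) else 0)" for k i
    by (simp add: P_def coeff_sum coeff_monom)
  have "(\<Sum>k\<le>r. poly (P k) (int n) * f (n + k)) = 0" if n: "n \<ge> n0" for n
  proof -
    define g where "g = (\<lambda>(k, i). int n ^ i * f (n + k))"
    have "0 = (\<Sum>k\<le>r. \<Sum>i\<le>N. of_int (g (k, i)) * coeff (Q k) i)"
      unfolding rel[OF n, symmetric]
    proof (rule sum.cong[OF refl])
      fix k assume "k \<in> {..r}"
      hence "poly (Q k) (of_nat n) = (\<Sum>i\<le>N. coeff (Q k) i * of_nat n ^ i)"
        using N by (intro poly_eq_sum_coeff) auto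
      thus "poly (Q k) (of_nat n) * of_int (f (n + k)) = (\<Sum>i\<le>N. of_int (g (k, i)) * coeff (Q k) i)"
        by (simp add: g_def sum_distrib_left sum_distrib_right mult_ac)
    qed
    also have "\<dots> = (\<Sum>x\<in>{..r} \<times> {..N}. of_int (g x) * coeff (Q (fst x)) (snd x))"
      by (simp add: sum.cartesian_product case_prod_unfold)
    finally have "(\<Sum>x\<in>{..r} \<times> {..N}. g x * \<psi> x) = 0" by (intro \<psi>) simp
    also have "(\<Sum>x\<in>{..r} \<times> {..N}. g x * \<psi> x) = (\<Sum>k\<le>r. \<Sum>i\<le>N. g (k, i) * \<psi> (k, i))"
      by (simp add: sum.cartesian_product case_prod_unfold)
    also have "\<dots> = (\<Sum>k\<le>r. poly (P k) (int n) * f (n + k))"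
      by (rule sum.cong[OF refl])
         (simp add: poly_eq_sum_coeff[of N] cP g_def sum_distrib_left sum_distrib_right mult_ac)
    finally show ?thesis .
  qed
  moreover have "P k0 \<noteq> 0" using \<psi>0 i0 cP[of k0 i0] by auto
  ultimately show ?thesis using that k0(1) by blast
qed

text \<open>
  The coefficients \<open>a\<^sub>i\<close> collect the recurrence by powers of the index \<open>n + k\<close> of \<open>f (n + k)\<close>,
  which is what the \<open>i\<close>-th power of \<open>z d/dz\<close> produces at the term \<open>f (n + k)\<close>.
\<close>

lemma recurrence_imp_euler_ode:
  fixes f :: "nat \<Rightarrow> int" and P :: "nat \<Rightarrow> int poly"
  assumes ex: "\<exists>k\<le>r. P k \<noteq> 0"
    and rec: "\<And>n. n \<ge> n0 \<Longrightarrow> (\<Sum>k\<le>r. poly (P k) (int n) * f (n + k)) = 0"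
  obtains s and a :: "nat \<Rightarrow> int poly" where
    "a s \<noteq> 0" "(\<Sum>i\<le>s. fps_of_poly (a i) * (euler_fps ^^ i) (Abs_fps f)) = 0"
proof -
  \<comment> \<open>The factor \<open>c\<close> vanishes at the indices \<open>-r, \<dots>, n0 - 1\<close> where the recurrence may fail or where
    it refers to negative arguments of \<open>f\<close>.\<close>
  define c :: "int poly" where "c = (\<Prod>i<n0 + r. [:int r - int i, 1:])"
  have c0: "c \<noteq> 0" by (simp add: c_def)
  have cz: "poly c (int m - int r) = 0" if "m < n0 + r" for m
    using that by (auto simp: c_def poly_prod)
  define R where "R = (\<lambda>k. pcompose (P k * c) [:- int k, 1:])"
  have pR: "poly (R k) x = poly (P k) (x - int k) * poly c (x - int k)" for k x
    by (simp add: R_def poly_pcompose)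
  have R0: "R k \<noteq> 0" if "P k \<noteq> 0" for k
  proof
    assume "R k = 0"
    hence "P k * c = 0" using pcompose_eq_0[of "P k * c" "[:- int k, 1:]"] by (simp add: R_def)
    with c0 that show False by simp
  qed
  obtain N where N: "\<And>k i. k \<le> r \<Longrightarrow> N < i \<Longrightarrow> coeff (R k) i = 0" using coeff_degree_bound by blast
  define a where "a = (\<lambda>i. \<Sum>k\<le>r. monom (coeff (R k) i) (r - k))"
  have ode: "(\<Sum>i\<le>N. fps_of_poly (a i) * (euler_fps ^^ i) (Abs_fps f)) = 0"
  proof (rule fps_ext)
    fix m
    have nth: "fps_nth (fps_of_poly (a i) * (euler_fps ^^ i) (Abs_fps f)) m =
        (\<Sum>k\<le>r. if r - k \<le> m then coeff (R k) i * int (m - (r - k)) ^ i * f (m - (r - k)) else 0)" for i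
      unfolding a_def fps_of_poly_sum sum_distrib_right fps_sum_nth
      by (rule sum.cong[OF refl])
         (auto simp: fps_of_poly_monom mult.assoc fps_X_power_mult_nth nth_euler_fps_iterate)
    have "fps_nth (\<Sum>i\<le>N. fps_of_poly (a i) * (euler_fps ^^ i) (Abs_fps f)) m =
      (\<Sum>k\<le>r. if r - k \<le> m then poly (R k) (int (m - (r - k))) * f (m - (r - k)) else 0)"
      unfolding fps_sum_nth nth
      by (subst sum.swap, rule sum.cong[OF refl])
         (use N in \<open>auto simp: poly_eq_sum_coeff[of N] sum_distrib_left sum_distrib_right mult_ac\<close>)
    also have "\<dots> = (\<Sum>k\<le>r. if r - k \<le> m then
        poly c (int m - int r) * (poly (P k) (int m - int r) * f (m - (r - k))) else 0)"
      by (rule sum.cong[OF refl]) (auto simp: pR of_nat_diff)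
    also have "\<dots> = 0"
    proof (cases "m < n0 + r")
      case True
      thus ?thesis by (intro sum.neutral) (auto simp: cz)
    next
      case False
      then obtain n where n: "m = n + r" "n \<ge> n0" by (metis le_add_diff_inverse2 not_less add_leD2 add_le_imp_le_diff)
      have "(\<Sum>k\<le>r. if r - k \<le> m then
        poly c (int m - int r) * (poly (P k) (int m - int r) * f (m - (r - k))) else 0) =
        poly c (int n) * (\<Sum>k\<le>r. poly (P k) (int n) * f (n + k))"
        unfolding sum_distrib_left by (rule sum.cong[OF refl]) (auto simp: n)
      thus ?thesis using rec[OF n(2)] by simp
    qed
    finally show "fps_nth (\<Sum>i\<le>N. fps_of_poly (a i) * (euler_fps ^^ i) (Abs_fps f)) m = fps_nth 0 m" by simp
  qed
  from ex obtain k0 where k0: "k0 \<le> r" "R k0 \<noteq> 0" using R0 by blast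
  then obtain i0 where i0: "coeff (R k0) i0 \<noteq> 0" by (auto simp: poly_eq_iff)
  hence i0N: "i0 \<le> N" using N k0 not_less by blast
  have "coeff (a i0) (r - k0) = (\<Sum>k\<le>r. if k = k0 then coeff (R k) i0 else 0)"
    unfolding a_def coeff_sum by (rule sum.cong[OF refl]) (use k0 in \<open>auto simp: coeff_monom\<close>)
  also have "\<dots> = coeff (R k0) i0" using k0 by simp
  finally have "a i0 \<noteq> 0" using i0 by auto
  then obtain s where s: "s \<le> N" "a s \<noteq> 0" "\<And>k. s < k \<Longrightarrow> k \<le> N \<Longrightarrow> a k = 0"
    using exists_last_nonzero[of N a] i0N by blast
  have "(\<Sum>i\<le>s. fps_of_poly (a i) * (euler_fps ^^ i) (Abs_fps f)) = 0"
    using ode sum_le_last_nonzero[of s N "\<lambda>i. fps_of_poly (a i) * (euler_fps ^^ i) (Abs_fps f)"] s by simp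
  with s(2) that show ?thesis by blast
qed

text \<open>
  For the passage from all large primes back to characteristic zero.
\<close>

lemma eq_0_if_dvd_by_large_primes:
  fixes c :: int
  assumes "\<And>p. prime p \<Longrightarrow> p \<ge> p1 \<Longrightarrow> int p dvd c"
  shows "c = 0"
proof (rule ccontr)
  assume "c \<noteq> 0"
  obtain p where "prime p" "p > max p1 (nat \<bar>c\<bar>)" using bigger_prime by blast
  with assms[of p] have "int p dvd c" "int p > \<bar>c\<bar>" by auto
  with \<open>c \<noteq> 0\<close> show False by (metis dvd_imp_le_int abs_of_nat not_less)
qed

section \<open>First-order equations satisfied by Lucas series\<close>

text \<open>
  The coefficients of \<open>q F'/F\<close> from the degree of \<open>q\<close> on are divisible by all large primes.
\<close>

lemma log_deriv_rational_of_bounded_mod: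
  fixes f :: "nat \<Rightarrow> int"
  assumes f0: "f 0 = 1"
    and bounded: "\<And>p. prime p \<Longrightarrow> p \<ge> p1 \<Longrightarrow> log_deriv_bounded_mod p f q"
  obtains S where "fps_of_poly q * fps_deriv (Abs_fps f) = fps_of_poly S * Abs_fps f"
proof -
  define F where "F = Abs_fps f"
  define W where "W = fps_right_inverse F 1"
  have W: "F * W = 1" unfolding W_def by (rule fps_right_inverse) (simp add: F_def f0)
  define U where "U = fps_of_poly q * fps_deriv F * W"
  have U: "fps_nth U n = 0" if "n \<ge> degree q" for n
  proof (rule eq_0_if_dvd_by_large_primes)
    fix p :: nat assume "prime p" "p \<ge> p1"
    from bounded[OF this] show "int p dvd fps_nth U n"
      using W that unfolding log_deriv_bounded_mod_def U_def F_def by blast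
  qed
  define S where "S = truncate_fps (degree q) U"
  have "fps_of_poly S = U"
    unfolding S_def fps_of_poly_truncate by (rule fps_ext) (use U in auto)
  hence "fps_of_poly S * F = fps_of_poly q * fps_deriv F * (F * W)"
    by (simp only: U_def mult_ac)
  hence "fps_of_poly q * fps_deriv F = fps_of_poly S * F" unfolding W by simp
  thus ?thesis unfolding F_def by (rule that)
qed

lemma large_primes_not_dvd_coeffs:
  fixes q :: "int poly"
  assumes "q \<noteq> 0"
  shows "\<exists>N. \<forall>p\<ge>N. \<exists>i. \<not> int p dvd coeff q i"
proof (rule exI[of _ "nat \<bar>lead_coeff q\<bar> + 1"], intro allI impI)
  fix p assume p: "p \<ge> nat \<bar>lead_coeff q\<bar> + 1"
  have "\<not> int p dvd lead_coeff q"
  proof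
    assume "int p dvd lead_coeff q"
    hence "\<bar>int p\<bar> \<le> \<bar>lead_coeff q\<bar>" using assms by (intro dvd_imp_le_int) auto
    with p show False by linarith
  qed
  thus "\<exists>i. \<not> int p dvd coeff q i" by (rule exI)
qed

lemma algebraic_lucas_first_order_ode:
  fixes f :: "nat \<Rightarrow> int"
  assumes lucas: "\<And>p. prime p \<Longrightarrow> lucas_mod p f" and f0: "f 0 = 1"
    and alg: "algebraic_seq (\<lambda>n. of_int (f n) :: 'a::field_char_0)"
  obtains q S where "q \<noteq> 0" "fps_of_poly q * fps_deriv (Abs_fps f) = fps_of_poly S * Abs_fps f"
proof -
  obtain r and Q :: "nat \<Rightarrow> int poly" where Q: "Q r \<noteq> 0"
    "(\<Sum>k\<le>r. fps_of_poly (Q k) * Abs_fps f ^ k) = 0"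
    by (rule algebraic_seq_integer_relation[OF alg])
  obtain N where N: "\<forall>p\<ge>N. \<exists>i. \<not> int p dvd coeff (Q r) i"
    using large_primes_not_dvd_coeffs[OF Q(1)] by (rule exE)
  have "log_deriv_bounded_mod p f (Q r)" if p: "prime p" "p \<ge> N" for p
  proof -
    have "algebraic_lucas_claim p" using lucas_claims[OF p(1)] by (simp only: lucas_claims_def)
    from this[unfolded algebraic_lucas_claim_def, rule_format, OF lucas[OF p(1)] f0 Q(2) N[rule_format, OF p(2)]]
    show ?thesis .
  qed
  then obtain S where "fps_of_poly (Q r) * fps_deriv (Abs_fps f) = fps_of_poly S * Abs_fps f"
    by (rule log_deriv_rational_of_bounded_mod[where f = f, OF f0])
  thus ?thesis by (rule that[OF Q(1)])
qed

lemma P_recursive_lucas_first_order_ode: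
  fixes f g :: "nat \<Rightarrow> int"
  assumes lucas: "\<And>p. prime p \<Longrightarrow> lucas_mod p f" and f0: "f 0 = 1"
    and inv: "Abs_fps f * Abs_fps g = 1"
    and Pf: "P_recursive (\<lambda>n. of_int (f n) :: 'a::field_char_0)"
    and Pg: "P_recursive (\<lambda>n. of_int (g n) :: 'a)"
  obtains q S where "q \<noteq> 0" "fps_of_poly q * fps_deriv (Abs_fps f) = fps_of_poly S * Abs_fps f"
proof -
  have ode: "\<exists>s a. a s \<noteq> 0 \<and> (\<Sum>i\<le>s. fps_of_poly (a i) * (euler_fps ^^ i) (Abs_fps h)) = 0"
    if h: "P_recursive (\<lambda>n. of_int (h n) :: 'a)" for h :: "nat \<Rightarrow> int"
  proof -
    obtain r n0 and P :: "nat \<Rightarrow> int poly" where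
      P: "\<exists>k\<le>r. P k \<noteq> 0" "\<forall>n\<ge>n0. (\<Sum>k\<le>r. poly (P k) (int n) * h (n + k)) = 0"
      by (rule P_recursive_integer_recurrence[OF h])
    obtain s a where "a s \<noteq> 0"
      "(\<Sum>i\<le>s. fps_of_poly (a i) * (euler_fps ^^ i) (Abs_fps h)) = 0"
      by (rule recurrence_imp_euler_ode[OF P(1) P(2)[rule_format]])
    thus ?thesis by (intro exI conjI)
  qed
  obtain s a where a: "a s \<noteq> 0" "(\<Sum>i\<le>s. fps_of_poly (a i) * (euler_fps ^^ i) (Abs_fps f)) = 0"
    using ode[OF Pf] by blast
  obtain t b where b: "b t \<noteq> 0" "(\<Sum>i\<le>t. fps_of_poly (b i) * (euler_fps ^^ i) (Abs_fps g)) = 0"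
    using ode[OF Pg] by blast
  have ab: "a s * b t \<noteq> 0" using a b by simp
  obtain N where N: "\<forall>p\<ge>N. \<exists>i. \<not> int p dvd coeff (a s * b t) i"
    using large_primes_not_dvd_coeffs[OF ab] by (rule exE)
  have "log_deriv_bounded_mod p f (a s * b t)" if p: "prime p" "p \<ge> max N (s + t)" for p
  proof -
    have claim: "dfinite_lucas_claim p" using lucas_claims[OF p(1)] by (simp only: lucas_claims_def)
    have "s + t \<le> p" "N \<le> p" using p(2) by simp_all
    from claim[unfolded dfinite_lucas_claim_def, rule_format, OF lucas[OF p(1)] f0 inv a(2) b(2)
        this(1) N[rule_format, OF this(2)]]
    show ?thesis .
  qed
  then obtain S where "fps_of_poly (a s * b t) * fps_deriv (Abs_fps f) = fps_of_poly S * Abs_fps f"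
    by (rule log_deriv_rational_of_bounded_mod[where f = f, OF f0])
  thus ?thesis by (rule that[OF ab])
qed

section \<open>Growth excludes first-order equations\<close>

text \<open>
  Comparison with a geometric series.
\<close>

lemma conv_radius_of_bounded_scaled_coeffs:
  fixes F :: "real fps"
  assumes "\<rho> > 0" "\<And>n. \<bar>fps_nth F n\<bar> * \<rho> ^ n \<le> C"
  shows "ereal \<rho> \<le> fps_conv_radius F"
  unfolding fps_conv_radius_def
proof (rule conv_radius_geI_ex)
  fix r assume r: "0 < r" "ereal r < ereal \<rho>"
  define q where "q = r / \<rho>"
  have q: "0 < q" "q < 1" using r assms(1) by (simp_all add: q_def)
  have "summable (\<lambda>n. fps_nth F n * r ^ n)"
  proof (rule summable_comparison_test')
    show "summable (\<lambda>n. C * q ^ n)" using q by (intro summable_mult summable_geometric) simp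
    fix n :: nat
    have "norm (fps_nth F n * r ^ n) = \<bar>fps_nth F n\<bar> * \<rho> ^ n * q ^ n"
      using r assms(1) by (simp add: q_def abs_mult power_divide)
    also have "\<dots> \<le> C * q ^ n" using assms(2) q by (intro mult_right_mono) auto
    finally show "norm (fps_nth F n * r ^ n) \<le> C * q ^ n" .
  qed
  thus "\<exists>z. norm z = r \<and> summable (\<lambda>n. fps_nth F n * z ^ n)"
    using r by (intro exI[of _ r]) auto
qed

text \<open>
  Nonnegative coefficients that are at most \<open>C \<rho>\<^sup>-\<^sup>n / (n + 1)\<close>, so that \<open>F\<close> grows at
  most logarithmically towards \<open>\<rho>\<close>.
\<close>

locale reciprocal_growth_fps =
  fixes F :: "real fps" and \<rho> C :: real
  assumes nonneg: "fps_nth F n \<ge> 0" and rho: "\<rho> > 0"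
    and upper: "fps_nth F n * \<rho> ^ n * real (n + 1) \<le> C" and F0: "fps_nth F 0 = 1"
begin

lemma radius: "ereal \<rho> \<le> fps_conv_radius F"
proof (rule conv_radius_of_bounded_scaled_coeffs[OF rho])
  fix n
  have "fps_nth F n * \<rho> ^ n * 1 \<le> fps_nth F n * \<rho> ^ n * real (n + 1)"
    using nonneg rho by (intro mult_left_mono) auto
  thus "\<bar>fps_nth F n\<bar> * \<rho> ^ n \<le> C" using upper[of n] nonneg[of n] by simp
qed

lemma radius_iter: "ereal \<rho> \<le> fps_conv_radius ((fps_deriv ^^ j) F)"
proof (induction j)
  case (Suc j)
  thus ?case using fps_conv_radius_deriv[of "(fps_deriv ^^ j) F"] by (auto intro: order_trans)
qed (use radius in simp)

lemma nonneg_iter: "fps_nth ((fps_deriv ^^ j) F) n \<ge> 0"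
  by (induction j arbitrary: n) (simp_all add: nonneg)

lemma in_ball:
  assumes "0 \<le> z" "z < \<rho>" "ereal \<rho> \<le> fps_conv_radius G"
  shows "ereal (norm z) < fps_conv_radius G"
proof -
  have "ereal (norm z) < ereal \<rho>" using assms by simp
  also note assms(3)
  finally show ?thesis .
qed

lemma coeff_le_eval:
  assumes "\<And>n. fps_nth G n \<ge> 0" "0 \<le> z" "z < \<rho>" "ereal \<rho> \<le> fps_conv_radius G"
  shows "fps_nth G n * z ^ n \<le> eval_fps G z"
proof -
  have "summable (\<lambda>n. fps_nth G n * z ^ n)"
    using in_ball[OF assms(2-4)] by (rule summable_fps)
  hence "(\<Sum>k\<in>{n}. fps_nth G k * z ^ k) \<le> (\<Sum>k. fps_nth G k * z ^ k)"
    using assms by (intro sum_le_suminf) auto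
  thus ?thesis by (simp add: eval_fps_def)
qed

abbreviation "\<phi> \<equiv> eval_fps F"
abbreviation "\<phi>' \<equiv> eval_fps (fps_deriv F)"

lemma deriv: "0 \<le> z \<Longrightarrow> z < \<rho> \<Longrightarrow> (\<phi> has_field_derivative \<phi>' z) (at z within A)"
  using in_ball[OF _ _ radius, of z] by (intro has_field_derivative_eval_fps) (auto simp: in_eball_iff dist_norm)

lemma ge_1: "0 \<le> z \<Longrightarrow> z < \<rho> \<Longrightarrow> \<phi> z \<ge> 1"
  using coeff_le_eval[of F z 0] nonneg radius F0 by simp

lemma deriv_nonneg: "0 \<le> z \<Longrightarrow> z < \<rho> \<Longrightarrow> \<phi>' z \<ge> 0"
  using coeff_le_eval[of "fps_deriv F" z 0] radius_iter[of 1] nonneg_iter[of 1] nonneg[of 1]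
  by simp

text \<open>
  The upper bound on the coefficients makes the derivative at most a geometric series.
\<close>

lemma deriv_upper:
  assumes z: "0 \<le> z" "z < \<rho>"
  shows "\<phi>' z * (\<rho> - z) \<le> C"
proof -
  define q where "q = z / \<rho>"
  have q: "0 \<le> q" "q < 1" "z = q * \<rho>" using z rho by (simp_all add: q_def)
  have "summable (\<lambda>n. fps_nth (fps_deriv F) n * z ^ n)"
    using radius_iter[of 1] by (intro summable_fps in_ball[OF z]) simp
  moreover have "summable (\<lambda>n. C / \<rho> * q ^ n)" using q by (intro summable_mult summable_geometric) simp
  moreover have "fps_nth (fps_deriv F) n * z ^ n \<le> C / \<rho> * q ^ n" for n
  proof -
    have "fps_nth F (n + 1) * \<rho> ^ (n + 1) * real (n + 1) \<le> fps_nth F (n + 1) * \<rho> ^ (n + 1) * real (n + 1 + 1)"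
      using nonneg[of "n + 1"] rho by (intro mult_left_mono) auto
    also have "\<dots> \<le> C" by (rule upper)
    finally have "real (n + 1) * fps_nth F (n + 1) * \<rho> ^ n \<le> C / \<rho>"
      using rho by (simp add: pos_le_divide_eq mult_ac)
    hence "real (n + 1) * fps_nth F (n + 1) * \<rho> ^ n * q ^ n \<le> C / \<rho> * q ^ n"
      using q by (intro mult_right_mono) auto
    thus ?thesis using q(3) by (simp add: power_mult_distrib mult_ac)
  qed
  ultimately have "\<phi>' z \<le> (\<Sum>n. C / \<rho> * q ^ n)"
    unfolding eval_fps_def by (intro suminf_le) auto
  also have "\<dots> = C / \<rho> * (1 / (1 - q))"
    using q by (subst suminf_mult) (simp_all add: suminf_geometric)
  also have "\<dots> = C / (\<rho> - z)" using rho q by (simp add: q(3) field_simps)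
  finally show ?thesis using z by (simp add: pos_le_divide_eq)
qed

lemma ode_eval:
  assumes "fps_of_poly q * fps_deriv F = fps_of_poly s * F" "0 \<le> z" "z < \<rho>"
  shows "poly q z * \<phi>' z = poly s z * \<phi> z"
proof -
  have "eval_fps (fps_of_poly q * fps_deriv F) z = poly q z * \<phi>' z"
    using in_ball[OF assms(2,3)] radius_iter[of 1] by (subst eval_fps_mult) auto
  moreover have "eval_fps (fps_of_poly s * F) z = poly s z * \<phi> z"
    using in_ball[OF assms(2,3)] radius by (subst eval_fps_mult) auto
  ultimately show ?thesis using assms(1) by simp
qed

lemma near_rho:
  assumes "poly s \<rho> \<noteq> 0"
  obtains r where "0 \<le> r" "r < \<rho>" "\<And>z. r \<le> z \<Longrightarrow> z \<le> \<rho> \<Longrightarrow> \<bar>poly s z\<bar> \<ge> \<bar>poly s \<rho>\<bar> / 2"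
proof -
  have "isCont (\<lambda>z. \<bar>poly s z\<bar>) \<rho>" by simp
  hence "((\<lambda>z. \<bar>poly s z\<bar>) \<longlongrightarrow> \<bar>poly s \<rho>\<bar>) (at \<rho>)" by (simp add: isCont_def)
  moreover have "\<bar>poly s \<rho>\<bar> / 2 < \<bar>poly s \<rho>\<bar>" using assms by simp
  ultimately have "eventually (\<lambda>z. \<bar>poly s \<rho>\<bar> / 2 < \<bar>poly s z\<bar>) (at \<rho>)" by (rule order_tendstoD)
  then obtain d where d: "d > 0" "\<And>z. z \<noteq> \<rho> \<Longrightarrow> dist z \<rho> < d \<Longrightarrow> \<bar>poly s \<rho>\<bar> / 2 < \<bar>poly s z\<bar>"
    unfolding eventually_at by auto
  show ?thesis
  proof
    show "0 \<le> max 0 (\<rho> - d / 2)" "max 0 (\<rho> - d / 2) < \<rho>" using rho d by auto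
    show "\<bar>poly s z\<bar> \<ge> \<bar>poly s \<rho>\<bar> / 2" if "max 0 (\<rho> - d / 2) \<le> z" "z \<le> \<rho>" for z
      using d(2)[of z] that d(1) by (cases "z = \<rho>") (auto simp: dist_real_def)
  qed
qed

lemma poly_bound:
  obtains M where "M > 0" "\<And>z. 0 \<le> z \<Longrightarrow> z \<le> \<rho> \<Longrightarrow> \<bar>poly s z\<bar> \<le> M"
proof -
  have "compact ((\<lambda>z. poly s z) ` {0..\<rho>})"
    by (intro compact_continuous_image continuous_intros) auto
  hence "bounded ((\<lambda>z. poly s z) ` {0..\<rho>})" by (rule compact_imp_bounded)
  then obtain M where "M > 0" "\<And>x. x \<in> (\<lambda>z. poly s z) ` {0..\<rho>} \<Longrightarrow> norm x \<le> M"
    by (auto simp: bounded_pos)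
  with that[of M] show ?thesis by auto
qed

text \<open>
  At a pole of \<open>s/q\<close> the equation forces \<open>\<phi>' \<ge> c \<phi> / (\<rho> - z)\<close> near \<open>\<rho>\<close>.  On the one hand
  \<open>\<phi>' (\<rho> - z) \<le> C\<close>, so \<open>\<phi>\<close> is bounded by \<open>C / c\<close>; on the other hand \<open>\<phi> \<ge> 1\<close> turns the
  inequality into \<open>\<phi>' \<ge> c / (\<rho> - z)\<close>, so \<open>\<phi>\<close> grows at least logarithmically.
\<close>

lemma no_pole:
  assumes ode: "fps_of_poly q * fps_deriv F = fps_of_poly s * F"
    and q: "poly q \<rho> = 0" and s: "poly s \<rho> \<noteq> 0"
  shows False
proof -
  obtain q1 where q1: "q = [:- \<rho>, 1:] * q1" using q by (auto simp: poly_eq_0_iff_dvd elim: dvdE)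
  obtain M where M: "M > 0" "\<And>z. 0 \<le> z \<Longrightarrow> z \<le> \<rho> \<Longrightarrow> \<bar>poly q1 z\<bar> \<le> M" using poly_bound by blast
  obtain r where r: "0 \<le> r" "r < \<rho>" "\<And>z. r \<le> z \<Longrightarrow> z \<le> \<rho> \<Longrightarrow> \<bar>poly s z\<bar> \<ge> \<bar>poly s \<rho>\<bar> / 2"
    using near_rho[OF s] by blast
  define c where "c = \<bar>poly s \<rho>\<bar> / 2 / M"
  have c: "c > 0" using s M(1) by (simp add: c_def)
  have lower: "c * \<phi> z \<le> \<phi>' z * (\<rho> - z)" if z: "r \<le> z" "z < \<rho>" for z
  proof -
    have z0: "0 \<le> z" using z r by simp
    have "\<bar>poly s \<rho>\<bar> / 2 * \<phi> z \<le> \<bar>poly s z\<bar> * \<phi> z"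
      using ge_1[OF z0 z(2)] r(3)[of z] z by (intro mult_right_mono) auto
    also have "\<dots> = \<bar>poly q z\<bar> * \<phi>' z"
      using arg_cong[OF ode_eval[OF ode z0 z(2)], of abs] ge_1[OF z0 z(2)] deriv_nonneg[OF z0 z(2)]
      by (simp add: abs_mult)
    also have "\<dots> = \<bar>poly q1 z\<bar> * ((\<rho> - z) * \<phi>' z)"
    proof -
      have "poly q z = (z - \<rho>) * poly q1 z" by (simp add: q1 algebra_simps)
      thus ?thesis using z by (simp add: abs_mult)
    qed
    also have "\<dots> \<le> M * ((\<rho> - z) * \<phi>' z)"
      using M(2)[of z] z z0 deriv_nonneg[OF z0 z(2)] by (intro mult_right_mono) auto
    finally show ?thesis using M(1) by (simp add: c_def field_simps)
  qed
  have bounded: "\<phi> z \<le> C / c" if "r \<le> z" "z < \<rho>" for z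
    using lower[OF that] deriv_upper[of z] that r(1) c by (simp add: pos_le_divide_eq mult.commute)
  \<comment> \<open>The lower bound on \<open>\<phi>'\<close> makes \<open>h\<close> nondecreasing, although its second summand tends to
    \<open>-\<infinity>\<close> at \<open>\<rho>\<close>.\<close>
  define h where "h = (\<lambda>z. \<phi> z + c * ln (\<rho> - z))"
  have mono: "h r \<le> h z" if z: "r \<le> z" "z < \<rho>" for z
  proof (rule DERIV_nonneg_imp_nondecreasing[OF z(1)])
    fix x assume x: "r \<le> x" "x \<le> z"
    hence x': "0 \<le> x" "x < \<rho>" using r z by auto
    have "(h has_field_derivative (\<phi>' x + c * (- 1 / (\<rho> - x)))) (at x)"
      unfolding h_def using x' by (auto intro!: derivative_eq_intros deriv)
    moreover have "c \<le> c * \<phi> x" using ge_1[OF x'] c by simp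
    with lower[of x] x x' have "c \<le> \<phi>' x * (\<rho> - x)" by auto
    hence "0 \<le> \<phi>' x + c * (- 1 / (\<rho> - x))" using x' by (simp add: field_simps)
    ultimately show "\<exists>y. (h has_real_derivative y) (at x) \<and> 0 \<le> y" by blast
  qed
  define K where "K = (h r - C / c) / c"
  \<comment> \<open>Close enough to \<open>\<rho>\<close> for the logarithm to push \<open>h\<close> below \<open>h r\<close>, as \<open>\<phi> \<le> C / c\<close>.\<close>
  define z where "z = max r (\<rho> - exp (K - 1))"
  have z: "r \<le> z" "z < \<rho>" using r by (auto simp: z_def)
  have "\<rho> - z \<le> exp (K - 1)" by (simp add: z_def)
  hence "ln (\<rho> - z) \<le> K - 1" using z by (metis diff_gt_0_iff_gt exp_gt_zero ln_exp ln_le_cancel_iff)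
  hence "c * ln (\<rho> - z) \<le> c * (K - 1)" using c by (intro mult_left_mono) auto
  moreover have "c * K = h r - C / c" using c by (simp add: K_def)
  ultimately have "h z \<le> h r - c" using bounded[OF z] by (simp add: h_def algebra_simps)
  with mono[OF z] c show False by simp
qed

text \<open>
  Differentiate \<open>q\<^sup>j F\<^bsup>(j)\<^esup> = S F\<close>, multiply by \<open>q\<close> and eliminate both derivatives.
\<close>

lemma iterated_ode:
  assumes ode: "fps_of_poly q * fps_deriv F = fps_of_poly s * F"
  shows "\<exists>S. fps_of_poly (q ^ j) * (fps_deriv ^^ j) F = fps_of_poly S * F"
proof (induction j)
  case 0
  show ?case by (intro exI[of _ 1]) simp
next
  case (Suc j)
  then obtain S where S: "fps_of_poly (q ^ j) * (fps_deriv ^^ j) F = fps_of_poly S * F" by blast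
  define D where "D = (fps_deriv ^^ j) F"
  have "fps_deriv (fps_of_poly (q ^ j) * D) = fps_deriv (fps_of_poly S * F)" using S by (simp add: D_def)
  hence "fps_of_poly (q ^ j) * fps_deriv D =
      fps_of_poly (pderiv S) * F + fps_of_poly S * fps_deriv F - fps_of_poly (pderiv (q ^ j)) * D"
    by (simp add: fps_of_poly_pderiv algebra_simps)
  hence "fps_of_poly q * (fps_of_poly (q ^ j) * fps_deriv D) = fps_of_poly q *
      (fps_of_poly (pderiv S) * F + fps_of_poly S * fps_deriv F - fps_of_poly (pderiv (q ^ j)) * D)"
    by simp
  hence "fps_of_poly (q ^ Suc j) * fps_deriv D =
      fps_of_poly q * fps_of_poly (pderiv S) * F + fps_of_poly S * (fps_of_poly q * fps_deriv F)
      - fps_of_poly (q * pderiv (q ^ j)) * D"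
    unfolding power_Suc fps_of_poly_mult by (simp add: algebra_simps)
  also have "q * pderiv (q ^ j) = of_nat j * pderiv q * q ^ j"
    by (cases j) (simp_all add: pderiv_power_Suc of_nat_poly del: power_Suc, simp add: algebra_simps)
  also have "fps_of_poly (of_nat j * pderiv q * q ^ j) * D = fps_of_poly (of_nat j * pderiv q) * (fps_of_poly S * F)"
    using S by (simp add: fps_of_poly_mult D_def mult.assoc)
  also have "fps_of_poly q * fps_of_poly (pderiv S) * F + fps_of_poly S * (fps_of_poly q * fps_deriv F)
      - fps_of_poly (of_nat j * pderiv q) * (fps_of_poly S * F)
      = fps_of_poly (q * pderiv S + S * s - of_nat j * pderiv q * S) * F"
    unfolding ode by (simp add: fps_of_poly_mult fps_of_poly_add fps_of_poly_diff algebra_simps)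
  finally show ?case by (auto simp: D_def)
qed

text \<open>
  As \<open>q\<close> does not vanish at \<open>\<rho>\<close>, near \<open>\<rho>\<close> \<open>\<phi>' \<le> (M / m) \<phi>\<close> with constants, so \<open>\<phi>\<close> is at most
  exponential and hence bounded; each derivative is a bounded multiple of \<open>\<phi>\<close>.
\<close>

lemma derivatives_bounded:
  assumes ode: "fps_of_poly q * fps_deriv F = fps_of_poly s * F" and q: "poly q \<rho> \<noteq> 0"
  shows "\<exists>B r. 0 \<le> r \<and> r < \<rho> \<and> (\<forall>z. r \<le> z \<and> z < \<rho> \<longrightarrow> eval_fps ((fps_deriv ^^ j) F) z \<le> B)"
proof -
  define m where "m = \<bar>poly q \<rho>\<bar> / 2"
  have m: "m > 0" using q by (simp add: m_def)
  obtain r where r: "0 \<le> r" "r < \<rho>" "\<And>z. r \<le> z \<Longrightarrow> z \<le> \<rho> \<Longrightarrow> \<bar>poly q z\<bar> \<ge> m"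
    using near_rho[OF q] unfolding m_def by blast
  obtain M where M: "M > 0" "\<And>z. 0 \<le> z \<Longrightarrow> z \<le> \<rho> \<Longrightarrow> \<bar>poly s z\<bar> \<le> M" using poly_bound by blast
  have deriv_le: "\<phi>' z \<le> M / m * \<phi> z" if z: "r \<le> z" "z < \<rho>" for z
  proof -
    have z0: "0 \<le> z" using z r by simp
    have "m * \<phi>' z \<le> \<bar>poly q z\<bar> * \<phi>' z"
      using r(3)[of z] z deriv_nonneg[OF z0 z(2)] by (intro mult_right_mono) auto
    also have "\<dots> = \<bar>poly s z\<bar> * \<phi> z"
      using arg_cong[OF ode_eval[OF ode z0 z(2)], of abs] ge_1[OF z0 z(2)] deriv_nonneg[OF z0 z(2)]
      by (simp add: abs_mult)
    also have "\<dots> \<le> M * \<phi> z"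
      using M(2)[of z] z z0 ge_1[OF z0 z(2)] by (intro mult_right_mono) auto
    finally show ?thesis using m by (simp add: field_simps)
  qed
  define h where "h = (\<lambda>z. - (\<phi> z * exp (- (M / m) * z)))"
  have mono: "h r \<le> h z" if z: "r \<le> z" "z < \<rho>" for z
  proof (rule DERIV_nonneg_imp_nondecreasing[OF z(1)])
    fix x assume x: "r \<le> x" "x \<le> z"
    hence x': "0 \<le> x" "x < \<rho>" using r z by auto
    have "(h has_field_derivative ((M / m * \<phi> x - \<phi>' x) * exp (- (M / m) * x))) (at x)"
      unfolding h_def using x' m by (auto intro!: derivative_eq_intros deriv simp: field_simps)
    moreover have "0 \<le> (M / m * \<phi> x - \<phi>' x) * exp (- (M / m) * x)"
      using deriv_le[of x] x x' by simp
    ultimately show "\<exists>y. (h has_real_derivative y) (at x) \<and> 0 \<le> y" by blast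
  qed
  define B where "B = \<phi> r * exp (- (M / m) * r) * exp (M / m * \<rho>)"
  have bound: "\<phi> z \<le> B" if z: "r \<le> z" "z < \<rho>" for z
  proof -
    have "\<phi> z = \<phi> z * exp (- (M / m) * z) * exp (M / m * z)" by (simp flip: exp_add)
    also have "\<dots> \<le> \<phi> r * exp (- (M / m) * r) * exp (M / m * z)"
      using mono[OF z] by (intro mult_right_mono) (simp_all add: h_def)
    also have "\<dots> \<le> B"
      unfolding B_def using ge_1[OF r(1,2)] z m M by (intro mult_left_mono) (auto intro!: mult_left_mono divide_right_mono)
    finally show ?thesis .
  qed
  obtain S where S: "fps_of_poly (q ^ j) * (fps_deriv ^^ j) F = fps_of_poly S * F"
    using iterated_ode[OF ode] by blast
  obtain L where L: "L > 0" "\<And>z. 0 \<le> z \<Longrightarrow> z \<le> \<rho> \<Longrightarrow> \<bar>poly S z\<bar> \<le> L" using poly_bound by blast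
  have "eval_fps ((fps_deriv ^^ j) F) z \<le> L * B / m ^ j" if z: "r \<le> z" "z < \<rho>" for z
  proof -
    have z0: "0 \<le> z" using z r by simp
    define D where "D = eval_fps ((fps_deriv ^^ j) F) z"
    have D0: "D \<ge> 0" unfolding D_def
      using coeff_le_eval[of "(fps_deriv ^^ j) F" z 0] nonneg_iter[of j] radius_iter[of j] z0 z(2)
      by (metis (no_types, lifting) mult_cancel_left1 order_trans power_0 mult.right_neutral)
    have "eval_fps (fps_of_poly (q ^ j) * (fps_deriv ^^ j) F) z = poly q z ^ j * D"
      using in_ball[OF z0 z(2)] radius_iter[of j] by (subst eval_fps_mult) (auto simp: D_def)
    moreover have "eval_fps (fps_of_poly S * F) z = poly S z * \<phi> z"
      using in_ball[OF z0 z(2)] radius by (subst eval_fps_mult) auto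
    ultimately have eq: "poly q z ^ j * D = poly S z * \<phi> z" using S by simp
    have "m ^ j * D \<le> \<bar>poly q z\<bar> ^ j * D"
      using D0 r(3)[of z] z m by (intro mult_right_mono power_mono) auto
    also have "\<dots> = \<bar>poly S z\<bar> * \<phi> z"
      using arg_cong[OF eq, of abs] D0 ge_1[OF z0 z(2)] by (simp add: abs_mult power_abs)
    also have "\<dots> \<le> L * B"
      using L z z0 bound[OF z] ge_1[OF z0 z(2)] by (intro mult_mono) auto
    finally show ?thesis using m by (simp add: D_def field_simps)
  qed
  thus ?thesis using r by blast
qed

lemma nth_deriv_iter: "fps_nth ((fps_deriv ^^ j) F) n = pochhammer (real n + 1) j * fps_nth F (n + j)"
  by (induction j arbitrary: n) (simp_all add: pochhammer_rec algebra_simps)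

text \<open>
  A bound on the derivative of order \<open>K + 1\<close> near \<open>\<rho>\<close> bounds each term of its series of
  nonnegative terms.  Its coefficients are those of \<open>F\<close> times a factor of order \<open>n\<^bsup>K + 1\<^esup>\<close>,
  which outweighs the lower bound of order \<open>n\<^bsup>-K\<^esup>\<close>.
\<close>

lemma no_regular_point:
  assumes ode: "fps_of_poly q * fps_deriv F = fps_of_poly s * F" and q: "poly q \<rho> \<noteq> 0"
    and lower: "c > 0" "\<And>n. fps_nth F n * \<rho> ^ n * real (n + 1) ^ K \<ge> c"
  shows False
proof -
  define j where "j = Suc K"
  obtain B r where B: "0 \<le> r" "r < \<rho>"
    "\<And>z. r \<le> z \<Longrightarrow> z < \<rho> \<Longrightarrow> eval_fps ((fps_deriv ^^ j) F) z \<le> B"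
    using derivatives_bounded[OF ode q, of j] by blast
  have coeff: "real (n + 1) ^ j * fps_nth F (n + j) * \<rho> ^ n \<le> B" for n
  proof (rule tendsto_upperbound)
    show "((\<lambda>z. real (n + 1) ^ j * fps_nth F (n + j) * z ^ n) \<longlongrightarrow>
        real (n + 1) ^ j * fps_nth F (n + j) * \<rho> ^ n) (at_left \<rho>)"
      by (intro tendsto_intros)
    have "eventually (\<lambda>z. z \<in> {r<..<\<rho>}) (at_left \<rho>)"
      using B by (intro eventually_at_left_real)
    thus "eventually (\<lambda>z. real (n + 1) ^ j * fps_nth F (n + j) * z ^ n \<le> B) (at_left \<rho>)"
    proof eventually_elim
      case (elim z)
      hence z: "0 \<le> z" "z < \<rho>" "r \<le> z" using B by auto
      have "real (n + 1) ^ j \<le> pochhammer (real n + 1) j"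
        using prod_mono[of "{0..<j}" "\<lambda>_. real (n + 1)" "\<lambda>i. real n + 1 + real i"]
        by (simp add: pochhammer_prod)
      hence "real (n + 1) ^ j * fps_nth F (n + j) * z ^ n \<le> fps_nth ((fps_deriv ^^ j) F) n * z ^ n"
        unfolding nth_deriv_iter using z nonneg by (intro mult_right_mono) auto
      also have "\<dots> \<le> eval_fps ((fps_deriv ^^ j) F) z"
        using z nonneg_iter radius_iter by (intro coeff_le_eval)
      also have "\<dots> \<le> B" using B(3) z by simp
      finally show ?case .
    qed
  qed simp
  have "c * real (n + 1) \<le> B * \<rho> ^ j * real (K + 2) ^ K" for n
  proof -
    have "c * real (n + 1) ^ j \<le> fps_nth F (n + j) * \<rho> ^ (n + j) * real (n + j + 1) ^ K * real (n + 1) ^ j"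
      using lower(2)[of "n + j"] by (intro mult_right_mono) auto
    also have "\<dots> = real (n + 1) ^ j * fps_nth F (n + j) * \<rho> ^ n * (\<rho> ^ j * real (n + j + 1) ^ K)"
      by (simp add: power_add mult_ac)
    also have "\<dots> \<le> B * (\<rho> ^ j * real (n + j + 1) ^ K)"
      using rho by (intro mult_right_mono coeff) auto
    also have "\<dots> \<le> B * (\<rho> ^ j * (real (K + 2) * real (n + 1)) ^ K)"
    proof -
      have "0 \<le> B" using coeff[of 0] nonneg[of j] by (simp add: j_def)
      moreover have "real (n + j + 1) \<le> real (K + 2) * real (n + 1)" by (simp add: j_def algebra_simps)
      ultimately show ?thesis using rho by (intro mult_left_mono power_mono) auto
    qed
    finally have "c * real (n + 1) * real (n + 1) ^ K \<le> B * \<rho> ^ j * real (K + 2) ^ K * real (n + 1) ^ K"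
      by (simp add: j_def power_mult_distrib mult_ac)
    thus ?thesis by (rule mult_right_le_imp_le) simp
  qed
  moreover obtain n :: nat where "real n > B * \<rho> ^ j * real (K + 2) ^ K / c"
    using reals_Archimedean2 by blast
  hence "B * \<rho> ^ j * real (K + 2) ^ K < c * real n" using lower(1) by (simp add: field_simps)
  hence "B * \<rho> ^ j * real (K + 2) ^ K < c * real (n + 1)" using lower(1) by (simp add: algebra_simps)
  ultimately show False by (meson leD)
qed

text \<open>
  Common zeros of \<open>q\<close> and \<open>s\<close> at \<open>\<rho>\<close> cancel from the equation; after that, \<open>s/q\<close> has a pole
  at \<open>\<rho>\<close> or \<open>q\<close> does not vanish there.
\<close>

theorem no_first_order_ode:
  assumes lower: "c > 0" "\<And>n. fps_nth F n * \<rho> ^ n * real (n + 1) ^ K \<ge> c" and q: "q \<noteq> 0"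
  shows "fps_of_poly q * fps_deriv F \<noteq> fps_of_poly s * F"
  using q
proof (induction "degree q" arbitrary: q s rule: less_induct)
  case less
  show ?case
  proof
    assume ode: "fps_of_poly q * fps_deriv F = fps_of_poly s * F"
    have q0: "poly q \<rho> = 0" using no_regular_point[OF ode _ lower] by blast
    hence s0: "poly s \<rho> = 0" using no_pole[OF ode] by blast
    obtain q1 where q1: "q = [:- \<rho>, 1:] * q1" using q0 by (auto simp: poly_eq_0_iff_dvd elim: dvdE)
    obtain s1 where s1: "s = [:- \<rho>, 1:] * s1" using s0 by (auto simp: poly_eq_0_iff_dvd elim: dvdE)
    have "q1 \<noteq> 0" using less.prems q1 by auto
    hence "degree q1 < degree q" unfolding q1 by (subst degree_mult_eq) auto
    moreover have "fps_of_poly [:- \<rho>, 1:] * (fps_of_poly q1 * fps_deriv F) =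
      fps_of_poly [:- \<rho>, 1:] * (fps_of_poly s1 * F)"
      using ode unfolding q1 s1 fps_of_poly_mult by (simp only: mult.assoc)
    moreover have "fps_of_poly [:- \<rho>, 1:] \<noteq> 0" using fps_of_poly_eq_iff[of "[:- \<rho>, 1:]" 0] by simp
    ultimately show False using less.hyps \<open>q1 \<noteq> 0\<close> by (metis mult_left_cancel)
  qed
qed

end

lemma (in reciprocal_growth_fps) no_integer_first_order_ode:
  fixes f :: "nat \<Rightarrow> int"
  assumes F: "F = fps_reduce (Abs_fps f)"
    and lower: "c > 0" "\<And>n. fps_nth F n * \<rho> ^ n * real (n + 1) ^ K \<ge> c"
    and q: "q \<noteq> 0" and ode: "fps_of_poly q * fps_deriv (Abs_fps f) = fps_of_poly S * Abs_fps f"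
  shows False
proof -
  have "(red_poly q :: real poly) \<noteq> 0"
    using q by (auto simp: poly_eq_iff coeff_map_poly)
  moreover have "fps_of_poly (red_poly q) * fps_deriv F = fps_of_poly (red_poly S) * F"
    using arg_cong[OF ode, of "fps_reduce :: _ \<Rightarrow> real fps"]
    by (simp add: fps_reduce_mult fps_reduce_deriv fps_reduce_fps_of_poly F)
  ultimately show False using no_first_order_ode[OF lower] by blast
qed

lemma no_first_order_ode_of_growth:
  fixes f :: "nat \<Rightarrow> nat" and \<alpha> :: real
  assumes f0: "f 0 = 1" and \<alpha>: "\<alpha> > 0"
    and upper: "\<And>n. real (f n) \<le> C * \<alpha> ^ n / real (n + 1)"
    and lower: "\<And>n. \<alpha> ^ n \<le> real (f n) * real (n + 1) ^ K"
    and q: "q \<noteq> 0"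
  shows "fps_of_poly q * fps_deriv (Abs_fps (\<lambda>n. int (f n))) \<noteq> fps_of_poly S * Abs_fps (\<lambda>n. int (f n))"
proof
  assume ode: "fps_of_poly q * fps_deriv (Abs_fps (\<lambda>n. int (f n))) = fps_of_poly S * Abs_fps (\<lambda>n. int (f n))"
  define F where "F = (fps_reduce (Abs_fps (\<lambda>n. int (f n))) :: real fps)"
  have nF: "fps_nth F n = real (f n)" for n by (simp add: F_def fps_reduce_def)
  interpret reciprocal_growth_fps F "1 / \<alpha>" C
  proof
    show "fps_nth F n * (1 / \<alpha>) ^ n * real (n + 1) \<le> C" for n
      using upper[of n] \<alpha> by (simp add: nF field_simps power_divide)
  qed (use f0 \<alpha> in \<open>simp_all add: nF\<close>)
  show False
  proof (rule no_integer_first_order_ode[OF F_def zero_less_one _ q ode])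
    show "1 \<le> fps_nth F n * (1 / \<alpha>) ^ n * real (n + 1) ^ K" for n
      using lower[of n] \<alpha> by (simp add: nF field_simps power_divide)
  qed
qed

section \<open>Recursion and Lucas congruences of the walk sequences\<close>

lemma A_seq_Suc: "A_seq (Suc d) n =
  (\<Sum>k\<le>n. ((2 * n) choose (2 * k)) * A_seq d k * ((2 * (n - k)) choose (n - k)))"
proof -
  have "A_seq (Suc d) n = (\<Sum>m\<le>2 * n. ((2 * n) choose m) * card (closed_walks d m) * card (axis_walks d (2 * n - m)))"
    by (simp add: A_seq_def card_closed_walks_Suc)
  also have "\<dots> = (\<Sum>m\<in>(\<lambda>k. 2 * k) ` {..n}. ((2 * n) choose m) * card (closed_walks d m) * card (axis_walks d (2 * n - m)))"
  proof (rule sum.mono_neutral_right)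
    show "\<forall>m\<in>{..2 * n} - (\<lambda>k. 2 * k) ` {..n}.
      ((2 * n) choose m) * card (closed_walks d m) * card (axis_walks d (2 * n - m)) = 0"
    proof
      fix m assume m: "m \<in> {..2 * n} - (\<lambda>k. 2 * k) ` {..n}"
      have "odd m"
      proof
        assume "even m"
        then obtain k where "m = 2 * k" by blast
        with m show False by auto
      qed
      with card_closed_walks_dvd[of m d]
      show "((2 * n) choose m) * card (closed_walks d m) * card (axis_walks d (2 * n - m)) = 0" by simp
    qed
  qed auto
  also have "\<dots> = (\<Sum>k\<le>n. ((2 * n) choose (2 * k)) * A_seq d k * card (axis_walks d (2 * n - 2 * k)))"
    by (subst sum.reindex) (auto simp: inj_on_def A_seq_def)
  also have "\<dots> = (\<Sum>k\<le>n. ((2 * n) choose (2 * k)) * A_seq d k * ((2 * (n - k)) choose (n - k)))"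
    by (intro sum.cong refl) (simp add: card_axis_walks flip: diff_mult_distrib2)
  finally show ?thesis .
qed

text \<open>
  The central binomial coefficient divides out of the recursion of \<open>A_seq\<close> term by term, by
  \<open>central_binomial_identity\<close>.
\<close>

lemma x_seq_Suc: "x_seq (Suc d) n = (\<Sum>k\<le>n. (n choose k) ^ 2 * x_seq d k)"
proof -
  have "x_seq (Suc d) n * ((2 * n) choose n) = (\<Sum>k\<le>n. (n choose k) ^ 2 * x_seq d k) * ((2 * n) choose n)"
    unfolding x_seq_mult_central_binomial A_seq_Suc sum_distrib_right
  proof (rule sum.cong[OF refl])
    fix k assume "k \<in> {..n}"
    hence eq: "((2 * n) choose (2 * k)) * ((2 * k) choose k) * ((2 * (n - k)) choose (n - k)) =
      ((2 * n) choose n) * (n choose k) ^ 2" by (intro central_binomial_identity) simp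
    thus "((2 * n) choose (2 * k)) * A_seq d k * ((2 * (n - k)) choose (n - k)) =
      (n choose k) ^ 2 * x_seq d k * ((2 * n) choose n)"
    proof -
      have "((2 * n) choose (2 * k)) * (x_seq d k * ((2 * k) choose k)) * ((2 * (n - k)) choose (n - k)) =
        ((2 * n) choose (2 * k)) * ((2 * k) choose k) * ((2 * (n - k)) choose (n - k)) * x_seq d k"
        by (simp only: mult_ac)
      thus ?thesis unfolding eq x_seq_mult_central_binomial by (simp only: mult_ac)
    qed
  qed
  thus ?thesis by simp
qed

lemma x_seq_0_dim: "x_seq 0 n = (if n = 0 then 1 else 0)"
proof -
  have "closed_walks 0 m = (if m = 0 then {[]} else {})" for m
    by (auto simp: closed_walks_def walks_def steps_def endpoint_def)
  thus ?thesis by (simp add: x_seq_def A_seq_def)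
qed

lemma x_seq_dim_1: "x_seq (Suc 0) n = 1"
  by (simp add: x_seq_Suc x_seq_0_dim if_distrib cong: if_cong)

lemma x_seq_dim_2: "x_seq 2 n = (2 * n) choose n"
  using x_seq_Suc[of "Suc 0" n] by (simp add: x_seq_dim_1 choose_square_sum flip: numeral_2_eq_2)

lemma x_seq_start: "x_seq d 0 = 1"
  by (induction d) (simp_all add: x_seq_0_dim x_seq_Suc)

text \<open>
  The central binomial coefficients are themselves the sequence \<open>x_seq 2\<close>, so what holds for
  \<open>x_seq\<close> and is preserved by products carries over to \<open>A_seq\<close>.
\<close>

lemma A_seq_eq: "A_seq d n = x_seq 2 n * x_seq d n"
  using x_seq_mult_central_binomial[of d n] by (simp add: x_seq_dim_2 mult.commute)

lemma A_seq_start: "A_seq d 0 = 1"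
  by (simp add: A_seq_eq x_seq_start)

text \<open>
  Lucas's theorem, by induction on \<open>n\<close>: in the Vandermonde expansion of \<open>(p + m) choose r\<close>
  only the terms with \<open>p choose 0\<close> and \<open>p choose p\<close> survive modulo \<open>p\<close>.
\<close>

lemma lucas_binomial:
  assumes p: "prime p" and ij: "i < p" "j < p"
  shows "[(p * n + j) choose (p * k + i) = (n choose k) * (j choose i)] (mod p)"
  using ij
proof (induction n arbitrary: k i j)
  case 0
  thus ?case
    by (cases k) (auto simp: binomial_eq_0 cong_def)
next
  case (Suc n)
  have p0: "p > 0" using p by (rule prime_gt_0_nat)
  have vand: "[(p + m) choose (p + l) = (m choose (p + l)) + (m choose l)] (mod p)"
       "l < p \<Longrightarrow> [(p + m) choose l = m choose l] (mod p)" for m l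
  proof -
    have mid: "p dvd (p choose a) * b" if "a \<noteq> 0" "a \<noteq> p" for a b
    proof (cases "a < p")
      case True
      thus ?thesis using dvd_choose_prime[of a p] p that by simp
    qed (use that in \<open>simp add: binomial_eq_0\<close>)
    have drop: "[x + y = x] (mod p)" if "p dvd y" for x y
      using cong_add[OF cong_refl[of x p], of y 0] that by (simp add: cong_0_iff)
    have "(p + m) choose (p + l) = (\<Sum>a\<le>p + l. (p choose a) * (m choose (p + l - a)))"
      by (rule vandermonde[symmetric])
    also have "\<dots> = (\<Sum>a\<in>{0, p}. (p choose a) * (m choose (p + l - a))) +
      (\<Sum>a\<in>{..p + l} - {0, p}. (p choose a) * (m choose (p + l - a)))"
      by (subst add.commute, rule sum.subset_diff) auto
    also have "[\<dots> = (\<Sum>a\<in>{0, p}. (p choose a) * (m choose (p + l - a)))] (mod p)"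
      by (intro drop dvd_sum mid) auto
    finally show "[(p + m) choose (p + l) = (m choose (p + l)) + (m choose l)] (mod p)"
      using p0 by simp
    assume l: "l < p"
    have "(p + m) choose l = (\<Sum>a\<le>l. (p choose a) * (m choose (l - a)))"
      by (rule vandermonde[symmetric])
    also have "\<dots> = (p choose 0) * (m choose (l - 0)) +
      (\<Sum>a\<in>{..l} - {0}. (p choose a) * (m choose (l - a)))"
      by (rule sum.remove) auto
    also have "[\<dots> = (p choose 0) * (m choose (l - 0))] (mod p)"
      using l by (intro drop dvd_sum mid) auto
    finally show "[(p + m) choose l = m choose l] (mod p)" by simp
  qed
  show ?case
  proof (cases k)
    case 0
    have "[(p + (p * n + j)) choose i = (p * n + j) choose i] (mod p)" using Suc.prems by (intro vand)
    also have "[(p * n + j) choose (p * 0 + i) = (n choose 0) * (j choose i)] (mod p)"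
      by (rule Suc.IH) (use Suc.prems in auto)
    hence "[(p * n + j) choose i = j choose i] (mod p)" by simp
    finally show ?thesis using 0 by (simp add: add_ac)
  next
    case (Suc k')
    have "[(p + (p * n + j)) choose (p + (p * k' + i)) =
      ((p * n + j) choose (p + (p * k' + i))) + ((p * n + j) choose (p * k' + i))] (mod p)" by (rule vand)
    also have "[((p * n + j) choose (p + (p * k' + i))) + ((p * n + j) choose (p * k' + i)) =
      (n choose Suc k') * (j choose i) + (n choose k') * (j choose i)] (mod p)"
      using Suc.IH[of i j "Suc k'"] Suc.IH[of i j k'] Suc.prems
      by (intro cong_add) (simp_all add: add_ac)
    also have "(n choose Suc k') * (j choose i) + (n choose k') * (j choose i) = (Suc n choose Suc k') * (j choose i)"
      by (simp add: algebra_simps)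
    finally show ?thesis using Suc by (simp add: add_ac)
  qed
qed

lemma sum_split_residues:
  fixes h :: "nat \<Rightarrow> 'a::comm_monoid_add"
  assumes "p > 0"
  shows "(\<Sum>m<p * n. h m) = (\<Sum>k<n. \<Sum>i<p. h (p * k + i))"
proof -
  have bound: "p * k + i < p * n" if "k < n" "i < p" for k i
  proof -
    have "p * k + i < p * Suc k" using that by simp
    also have "\<dots> \<le> p * n" using that by (intro mult_le_mono2) simp
    finally show ?thesis .
  qed
  have "(\<Sum>m<p * n. h m) = (\<Sum>(k, i)\<in>{..<n} \<times> {..<p}. h (p * k + i))"
    by (rule sum.reindex_bij_witness[of _ "\<lambda>(k, i). p * k + i" "\<lambda>m. (m div p, m mod p)"])
       (use assms bound in \<open>auto simp: less_mult_imp_div_less mult.commute\<close>)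
  thus ?thesis by (simp only: sum.cartesian_product)
qed

text \<open>
  The sum in the recursion factors along the residue classes modulo \<open>p\<close>.  Extending it to a
  multiple of \<open>p\<close> only adds vanishing binomial coefficients.
\<close>

lemma x_seq_lucas:
  assumes p: "prime p" and j: "j < p"
  shows "[x_seq d (p * n + j) = x_seq d n * x_seq d j] (mod p)"
  using j
proof (induction d arbitrary: n j)
  case 0
  have "p * n + j = 0 \<longleftrightarrow> n = 0 \<and> j = 0" using p by auto
  thus ?case by (simp only: x_seq_0_dim) auto
next
  case (Suc d)
  have p0: "p > 0" using p by (rule prime_gt_0_nat)
  have "x_seq (Suc d) (p * n + j) = (\<Sum>m\<le>p * n + j. ((p * n + j) choose m) ^ 2 * x_seq d m)"
    by (rule x_seq_Suc)
  also have "\<dots> = (\<Sum>m<p * Suc n. ((p * n + j) choose m) ^ 2 * x_seq d m)"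
    by (rule sum.mono_neutral_left) (use Suc.prems in \<open>auto simp: binomial_eq_0\<close>)
  also have "\<dots> = (\<Sum>k<Suc n. \<Sum>i<p. ((p * n + j) choose (p * k + i)) ^ 2 * x_seq d (p * k + i))"
    by (rule sum_split_residues[OF p0])
  finally have lhs: "x_seq (Suc d) (p * n + j) =
    (\<Sum>k<Suc n. \<Sum>i<p. ((p * n + j) choose (p * k + i)) ^ 2 * x_seq d (p * k + i))" .
  have "[(\<Sum>k<Suc n. \<Sum>i<p. ((p * n + j) choose (p * k + i)) ^ 2 * x_seq d (p * k + i)) =
    (\<Sum>k<Suc n. \<Sum>i<p. ((n choose k) ^ 2 * x_seq d k) * ((j choose i) ^ 2 * x_seq d i))] (mod p)"
  proof (intro cong_sum)
    fix k i assume "i \<in> {..<p}"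
    hence i: "i < p" by simp
    have "[((p * n + j) choose (p * k + i)) ^ 2 * x_seq d (p * k + i) =
        ((n choose k) * (j choose i)) ^ 2 * (x_seq d k * x_seq d i)] (mod p)"
      by (rule cong_mult[OF cong_pow[OF lucas_binomial[OF p i Suc.prems]] Suc.IH[OF i]])
    also have "((n choose k) * (j choose i)) ^ 2 * (x_seq d k * x_seq d i) =
        ((n choose k) ^ 2 * x_seq d k) * ((j choose i) ^ 2 * x_seq d i)"
      by (simp only: power_mult_distrib mult.assoc mult.left_commute)
    finally show "[((p * n + j) choose (p * k + i)) ^ 2 * x_seq d (p * k + i) =
        ((n choose k) ^ 2 * x_seq d k) * ((j choose i) ^ 2 * x_seq d i)] (mod p)" .
  qed
  hence *: "[x_seq (Suc d) (p * n + j) =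
    (\<Sum>k<Suc n. (n choose k) ^ 2 * x_seq d k) * (\<Sum>i<p. (j choose i) ^ 2 * x_seq d i)] (mod p)"
    unfolding lhs sum_product .
  have "(\<Sum>i<p. (j choose i) ^ 2 * x_seq d i) = x_seq (Suc d) j"
    unfolding x_seq_Suc by (rule sum.mono_neutral_right) (use Suc.prems in \<open>auto simp: binomial_eq_0\<close>)
  moreover have "(\<Sum>k<Suc n. (n choose k) ^ 2 * x_seq d k) = x_seq (Suc d) n"
    unfolding x_seq_Suc lessThan_Suc_atMost ..
  ultimately show ?case using * by metis
qed

lemma lucas_mod_x_seq: "prime p \<Longrightarrow> lucas_mod p (\<lambda>n. int (x_seq d n))"
  unfolding lucas_mod_def by (auto simp: x_seq_lucas cong_int_iff simp flip: of_nat_mult)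

lemma lucas_mod_A_seq:
  assumes "prime p"
  shows "lucas_mod p (\<lambda>n. int (A_seq d n))"
  unfolding lucas_mod_def
proof (intro allI impI)
  fix n j assume "j < p"
  hence "[x_seq 2 (p * n + j) * x_seq d (p * n + j) = (x_seq 2 n * x_seq 2 j) * (x_seq d n * x_seq d j)] (mod p)"
    using assms by (intro cong_mult x_seq_lucas)
  also have "(x_seq 2 n * x_seq 2 j) * (x_seq d n * x_seq d j) = A_seq d n * A_seq d j"
    unfolding A_seq_eq by (simp only: mult_ac)
  finally show "[int (A_seq d (p * n + j)) = int (A_seq d n) * int (A_seq d j)] (mod int p)"
    unfolding A_seq_eq[of d "p * n + j", symmetric] of_nat_mult[symmetric] cong_int_iff .
qed

section \<open>Growth of the walk sequences\<close>

lemma central_binomial_Suc: "Suc n * ((2 * Suc n) choose Suc n) = 2 * (2 * n + 1) * ((2 * n) choose n)"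
proof -
  define b where "b = (2 * n + 1) choose n"
  have sym: "(2 * n + 1) choose Suc n = b"
    unfolding b_def by (subst binomial_symmetric) auto
  have b: "Suc n * b = (2 * n + 1) * ((2 * n) choose n)"
    using Suc_times_binomial[of n "2 * n"] unfolding sym[symmetric] by simp
  have "(2 * Suc n) choose Suc n = ((2 * n + 1) choose n) + ((2 * n + 1) choose Suc n)"
    by simp
  hence "Suc n * ((2 * Suc n) choose Suc n) = 2 * (Suc n * b)"
    unfolding sym b_def[symmetric] by (simp only: distrib_left mult_2)
  thus ?thesis unfolding b by (simp only: mult.assoc)
qed

text \<open>
  The quotient of consecutive values of the left-hand side is
  \<open>4 (2 n + 1) (2 n + 3) / (n + 1)\<^sup>2 \<le> 16\<close>.
\<close>

lemma central_binomial_square_le: "((2 * n) choose n) ^ 2 * (2 * n + 1) \<le> 16 ^ n"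
proof (induction n)
  case (Suc n)
  define c where "c = (2 * n) choose n"
  define c' where "c' = (2 * Suc n) choose Suc n"
  have odd_product: "(2 * n + 1) * (2 * n + 3) \<le> 4 * Suc n ^ 2"
    by (simp add: power2_eq_square algebra_simps)
  have "Suc n ^ 2 * (c' ^ 2 * (2 * Suc n + 1)) = (Suc n * c') ^ 2 * (2 * Suc n + 1)"
    by (simp only: power_mult_distrib mult.assoc)
  also have "Suc n * c' = 2 * (2 * n + 1) * c" unfolding c_def c'_def by (rule central_binomial_Suc)
  also have "(2 * (2 * n + 1) * c) ^ 2 * (2 * Suc n + 1) =
      4 * ((2 * n + 1) * (2 * n + 3)) * (c ^ 2 * (2 * n + 1))"
    by (simp add: power2_eq_square algebra_simps)
  also have "\<dots> \<le> 4 * (4 * Suc n ^ 2) * 16 ^ n"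
    using mult_le_mono[OF mult_le_mono2[OF odd_product] Suc.IH] unfolding c_def .
  also have "\<dots> = Suc n ^ 2 * 16 ^ Suc n" by simp
  finally have "Suc n ^ 2 * (c' ^ 2 * (2 * Suc n + 1)) \<le> Suc n ^ 2 * 16 ^ Suc n" .
  thus ?case unfolding c'_def by (simp only: mult_le_cancel1) simp
qed simp

lemma central_binomial_le: "real ((2 * n) choose n) \<le> 4 ^ n / sqrt (real (2 * n + 1))"
proof -
  have "real (((2 * n) choose n) ^ 2 * (2 * n + 1)) \<le> real (16 ^ n)"
    using central_binomial_square_le of_nat_le_iff by blast
  hence "real ((2 * n) choose n) ^ 2 * real (2 * n + 1) \<le> 16 ^ n"
    by (simp only: of_nat_mult of_nat_power of_nat_numeral)
  moreover have "(real ((2 * n) choose n) * sqrt (real (2 * n + 1))) ^ 2 =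
      real ((2 * n) choose n) ^ 2 * real (2 * n + 1)"
    unfolding power_mult_distrib by simp
  moreover have "(4 ^ n) ^ 2 = (16 ^ n :: real)"
    by (simp add: power2_eq_square flip: power_mult_distrib)
  ultimately have "(real ((2 * n) choose n) * sqrt (real (2 * n + 1))) ^ 2 \<le> (4 ^ n) ^ 2"
    by simp
  hence "real ((2 * n) choose n) * sqrt (real (2 * n + 1)) \<le> 4 ^ n"
    by (rule power2_le_imp_le) simp
  thus ?thesis by (simp add: pos_le_divide_eq)
qed

lemma binomial_le_sqrt: "real (m choose j) \<le> 2 ^ m / sqrt (real (m + 1))"
proof -
  have "real (m choose j) \<le> real (m choose (m div 2))" by (simp add: binomial_maximum)
  also have "\<dots> \<le> 2 ^ m / sqrt (real (m + 1))"
  proof (cases "even m")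
    case True
    then obtain n where "m = 2 * n" by blast
    thus ?thesis using central_binomial_le[of n] by (simp add: power_mult)
  next
    case False
    then obtain n where m: "m = 2 * n + 1" by (elim oddE)
    have "(2 * n + 1) choose Suc n = (2 * n + 1) choose n"
      by (subst binomial_symmetric) auto
    hence "2 * ((2 * n + 1) choose n) = (2 * Suc n) choose Suc n" by simp
    hence "2 * real (m choose (m div 2)) = real ((2 * Suc n) choose Suc n)"
      unfolding m by (metis add_diff_cancel_right' even_Suc_div_two dvd_triv_left Suc_eq_plus1 nonzero_mult_div_cancel_left of_nat_mult of_nat_numeral zero_neq_numeral)
    also have "\<dots> \<le> 4 ^ Suc n / sqrt (real (2 * Suc n + 1))" by (rule central_binomial_le)
    also have "\<dots> \<le> 4 ^ Suc n / sqrt (real (m + 1))"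
      by (intro divide_left_mono mult_pos_pos) (simp_all add: m)
    also have "(4::real) ^ Suc n = 2 * 2 ^ m" by (simp add: m power_mult)
    finally show ?thesis by simp
  qed
  finally show ?thesis .
qed

text \<open>
  By \<open>(n choose m) / (m + 1) = (Suc n choose Suc m) / (n + 1)\<close> the sum is a part of a
  binomial expansion.
\<close>

lemma binomial_sum_reciprocal_le:
  assumes t: "t > (0::real)"
  shows "(\<Sum>m\<le>n. real (n choose m) * t ^ m / real (m + 1)) \<le> (t + 1) ^ Suc n / (t * real (n + 1))"
proof -
  have "t * real (n + 1) * (\<Sum>m\<le>n. real (n choose m) * t ^ m / real (m + 1)) =
      (\<Sum>m\<le>n. real (Suc n choose Suc m) * t ^ Suc m)"
    unfolding sum_distrib_left
  proof (rule sum.cong[OF refl])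
    fix m
    have "real (Suc m) * real (Suc n choose Suc m) = real (Suc n) * real (n choose m)"
      unfolding of_nat_mult[symmetric] by (simp only: Suc_times_binomial)
    hence "real (Suc n choose Suc m) = real (Suc n) * real (n choose m) / real (Suc m)"
      by (simp add: field_simps del: binomial_Suc_Suc)
    thus "t * real (n + 1) * (real (n choose m) * t ^ m / real (m + 1)) = real (Suc n choose Suc m) * t ^ Suc m"
      by (simp del: binomial_Suc_Suc)
  qed
  also have "\<dots> = (\<Sum>m\<in>Suc ` {..n}. real (Suc n choose m) * t ^ m)"
    by (subst sum.reindex) (simp_all del: binomial_Suc_Suc)
  also have "\<dots> \<le> (\<Sum>m\<le>Suc n. real (Suc n choose m) * t ^ m)"
    using t by (intro sum_mono2) auto
  also have "\<dots> = (t + 1) ^ Suc n"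
    by (subst binomial_ring) simp
  finally show ?thesis using t by (simp add: pos_le_divide_eq mult.commute)
qed

text \<open>
  The arithmetic-geometric mean inequality with weight \<open>L = sqrt (n + 1)\<close> reduces the inverse
  square root to the reciprocal \<open>1 / (m + 1)\<close>.
\<close>

lemma binomial_sum_inverse_sqrt_le:
  "(\<Sum>m\<le>n. real (n choose m) * 2 ^ m / sqrt (real (m + 1))) \<le> 5 / 4 * 3 ^ n / sqrt (real (n + 1))"
proof -
  define L where "L = sqrt (real (n + 1))"
  have L: "L > 0" "L * L = real (n + 1)" by (simp_all add: L_def)
  have amgm: "1 / sqrt (real (m + 1)) \<le> (L / real (m + 1) + 1 / L) / 2" for m :: nat
  proof -
    define s where "s = sqrt (real (m + 1))"
    have s: "s > 0" "s * s = real (m + 1)" by (simp_all add: s_def)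
    have "0 \<le> (L - s) ^ 2 / (s * s * L)" using s L by simp
    also have "\<dots> = L / (s * s) + 1 / L - 2 / s"
      using s(1) L(1) by (simp add: power2_eq_square field_simps)
    finally show ?thesis unfolding s(2) s_def[symmetric] by simp
  qed
  have "(\<Sum>m\<le>n. real (n choose m) * 2 ^ m / sqrt (real (m + 1))) =
      (\<Sum>m\<le>n. real (n choose m) * 2 ^ m * (1 / sqrt (real (m + 1))))" by simp
  also have "\<dots> \<le> (\<Sum>m\<le>n. real (n choose m) * 2 ^ m * ((L / real (m + 1) + 1 / L) / 2))"
    by (intro sum_mono mult_left_mono amgm) simp
  also have "\<dots> = L / 2 * (\<Sum>m\<le>n. real (n choose m) * 2 ^ m / real (m + 1)) +
      1 / (2 * L) * (\<Sum>m\<le>n. real (n choose m) * 2 ^ m)"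
    unfolding sum_distrib_left sum.distrib[symmetric]
  proof (rule sum.cong[OF refl])
    have split: "x * ((L / q + 1 / L) / 2) = L / 2 * (x / q) + 1 / (2 * L) * x" for x q
      by (simp add: add_divide_distrib distrib_left mult.commute)
    fix m
    show "real (n choose m) * 2 ^ m * ((L / real (m + 1) + 1 / L) / 2) =
      L / 2 * (real (n choose m) * 2 ^ m / real (m + 1)) + 1 / (2 * L) * (real (n choose m) * 2 ^ m)"
      by (rule split)
  qed
  also have "(\<Sum>m\<le>n. real (n choose m) * 2 ^ m) = 3 ^ n"
    using binomial_ring[of "2::real" 1 n] by simp
  also have "L / 2 * (\<Sum>m\<le>n. real (n choose m) * 2 ^ m / real (m + 1)) \<le>
      L / 2 * (3 ^ Suc n / (2 * real (n + 1)))"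
    using binomial_sum_reciprocal_le[of 2 n] L(1) by (intro mult_left_mono) auto
  also have "L / 2 * (3 ^ Suc n / (2 * real (n + 1))) + 1 / (2 * L) * 3 ^ n = 5 / 4 * 3 ^ n / L"
    using L(1) unfolding L(2)[symmetric] by (simp add: field_simps)
  finally show ?thesis by (simp add: L_def)
qed

text \<open>
  A local limit bound for the binomial distribution with success probability \<open>2/3\<close>.  Expanding
  \<open>2\<^sup>k\<close> as a row sum writes the left-hand side as a mixture of symmetric binomial
  distributions, each of which is bounded by \<open>binomial_le_sqrt\<close>.
\<close>

lemma binomial_times_power2_le:
  assumes "k \<le> n"
  shows "real (n choose k) * 2 ^ k \<le> 5 / 4 * 3 ^ n / sqrt (real (n + 1))"
proof -
  have "real (n choose k) * 2 ^ k = real ((n choose k) * (\<Sum>i\<le>k. k choose i))"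
    by (simp add: choose_row_sum)
  also have "(n choose k) * (\<Sum>i\<le>k. k choose i) = (\<Sum>i\<le>k. (n choose i) * ((n - i) choose (k - i)))"
    unfolding sum_distrib_left using assms by (intro sum.cong refl) (simp add: choose_mult)
  also have "real \<dots> = (\<Sum>i\<le>k. real (n choose i) * real ((n - i) choose (k - i)))" by simp
  also have "\<dots> \<le> (\<Sum>i\<le>k. real (n choose i) * (2 ^ (n - i) / sqrt (real (n - i + 1))))"
    by (intro sum_mono mult_left_mono binomial_le_sqrt) simp
  also have "\<dots> \<le> (\<Sum>i\<le>n. real (n choose i) * (2 ^ (n - i) / sqrt (real (n - i + 1))))"
    using assms by (intro sum_mono2) auto
  also have "\<dots> = (\<Sum>m\<le>n. real (n choose m) * 2 ^ m / sqrt (real (m + 1)))"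
    by (rule sum.reindex_bij_witness[of _ "\<lambda>m. n - m" "\<lambda>m. n - m"])
       (auto simp flip: binomial_symmetric)
  also have "\<dots> \<le> 5 / 4 * 3 ^ n / sqrt (real (n + 1))" by (rule binomial_sum_inverse_sqrt_le)
  finally show ?thesis .
qed

lemma binomial_power_le: "k \<le> n \<Longrightarrow> real (n choose k) * real d ^ k \<le> real (Suc d) ^ n"
proof -
  assume "k \<le> n"
  hence "(\<Sum>i\<in>{k}. real (n choose i) * real d ^ i) \<le> (\<Sum>i\<le>n. real (n choose i) * real d ^ i)"
    by (intro sum_mono2) auto
  also have "\<dots> = real (Suc d) ^ n"
    using binomial_ring[of "real d" 1 n] by (simp add: add.commute)
  finally show ?thesis by simp
qed

text \<open>
  Inductively, the recursion is at least \<open>\<Sum>k\<le>n. ((n choose k) (Suc e)\<^sup>k)\<^sup>2\<close> up to a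
  power of \<open>n + 1\<close>, and by the Cauchy-Schwarz inequality that is at least
  \<open>(e + 2)\<^bsup>2 n\<^esup> / (n + 1)\<close>.
\<close>

lemma x_seq_lower: "real (Suc e) ^ (2 * n) \<le> real (x_seq (Suc e) n) * real (n + 1) ^ e"
proof (induction e arbitrary: n)
  case 0
  show ?case by (simp add: x_seq_dim_1)
next
  case (Suc e)
  have "real (Suc (Suc e)) ^ (2 * n) = (\<Sum>k\<le>n. real (n choose k) * real (Suc e) ^ k) ^ 2"
    using binomial_ring[of "real (Suc e)" 1 n] unfolding power_even_eq by (simp add: add_ac)
  also have "\<dots> \<le> (\<Sum>k\<le>n. (real (n choose k) * real (Suc e) ^ k) ^ 2) * real (n + 1)"
    using sum_squared_le_sum_of_squares[of "\<lambda>k. real (n choose k) * real (Suc e) ^ k" "{..n}"] by simp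
  also have "\<dots> \<le> (\<Sum>k\<le>n. real (n choose k) ^ 2 * real (x_seq (Suc e) k) * real (n + 1) ^ e) * real (n + 1)"
  proof (intro mult_right_mono sum_mono)
    fix k assume k: "k \<in> {..n}"
    have "real (Suc e) ^ (2 * k) \<le> real (x_seq (Suc e) k) * real (k + 1) ^ e" by (rule Suc.IH)
    also have "\<dots> \<le> real (x_seq (Suc e) k) * real (n + 1) ^ e"
      using k by (intro mult_left_mono power_mono) auto
    finally have "real (n choose k) ^ 2 * real (Suc e) ^ (2 * k) \<le>
        real (n choose k) ^ 2 * (real (x_seq (Suc e) k) * real (n + 1) ^ e)"
      by (intro mult_left_mono) auto
    thus "(real (n choose k) * real (Suc e) ^ k) ^ 2 \<le>
        real (n choose k) ^ 2 * real (x_seq (Suc e) k) * real (n + 1) ^ e"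
      by (simp only: power_mult_distrib power_even_eq mult.assoc)
  qed auto
  also have "\<dots> = real (x_seq (Suc (Suc e)) n) * real (n + 1) ^ Suc e"
    by (simp add: x_seq_Suc[of "Suc e"] sum_distrib_right sum_distrib_left mult_ac)
  finally show ?case .
qed

text \<open>
  One factor \<open>1 / sqrt (n + 1)\<close> comes from the largest term \<open>(n choose k) 2\<^sup>k\<close> and one from the
  central binomial coefficient \<open>(2 k) choose k\<close>.
\<close>

lemma x_seq_3_upper: "real (x_seq 3 n) \<le> 25 / 16 * 9 ^ n / real (n + 1)"
proof -
  define L where "L = sqrt (real (n + 1))"
  have L: "L > 0" "L * L = real (n + 1)" by (simp_all add: L_def)
  have "real (x_seq 3 n) = (\<Sum>k\<le>n. real (n choose k) ^ 2 * real ((2 * k) choose k))"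
    using x_seq_Suc[of 2 n] by (simp add: x_seq_dim_2 eval_nat_numeral(3)[symmetric] flip: of_nat_mult of_nat_power of_nat_sum)
  also have "\<dots> \<le> (\<Sum>k\<le>n. (5 / 4 * 3 ^ n / L) * (real (n choose k) * 2 ^ k / sqrt (real (k + 1))))"
  proof (rule sum_mono)
    fix k assume k: "k \<in> {..n}"
    have "real ((2 * k) choose k) \<le> 4 ^ k / sqrt (real (2 * k + 1))" by (rule central_binomial_le)
    also have "\<dots> \<le> 4 ^ k / sqrt (real (k + 1))"
      by (intro divide_left_mono mult_pos_pos) auto
    also have "(4::real) ^ k = 2 ^ k * 2 ^ k" by (simp flip: power_mult_distrib)
    finally have "real (n choose k) ^ 2 * real ((2 * k) choose k) \<le>
        real (n choose k) ^ 2 * (2 ^ k * 2 ^ k / sqrt (real (k + 1)))"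
      by (intro mult_left_mono) auto
    also have "\<dots> = (real (n choose k) * 2 ^ k) * (real (n choose k) * 2 ^ k / sqrt (real (k + 1)))"
      by (simp add: power2_eq_square)
    also have "\<dots> \<le> (5 / 4 * 3 ^ n / L) * (real (n choose k) * 2 ^ k / sqrt (real (k + 1)))"
      unfolding L_def using k by (intro mult_right_mono binomial_times_power2_le) auto
    finally show "real (n choose k) ^ 2 * real ((2 * k) choose k) \<le>
      (5 / 4 * 3 ^ n / L) * (real (n choose k) * 2 ^ k / sqrt (real (k + 1)))" .
  qed
  also have "\<dots> = (5 / 4 * 3 ^ n / L) * (\<Sum>k\<le>n. real (n choose k) * 2 ^ k / sqrt (real (k + 1)))"
    by (rule sum_distrib_left[symmetric])
  also have "\<dots> \<le> (5 / 4 * 3 ^ n / L) * (5 / 4 * 3 ^ n / L)"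
    using binomial_sum_inverse_sqrt_le[of n] L(1) unfolding L_def[symmetric] by (intro mult_left_mono) auto
  also have "\<dots> = 25 / 16 * (3 ^ n * 3 ^ n) / (L * L)" by simp
  also have "(3::real) ^ n * 3 ^ n = 9 ^ n" by (simp flip: power_mult_distrib)
  finally show ?thesis unfolding L(2) .
qed

text \<open>
  From dimension \<open>3\<close> on the decay \<open>1 / (n + 1)\<close> is merely preserved: one factor
  \<open>(n choose k) d\<^sup>k\<close> is estimated by the whole sum \<open>(d + 1)\<^sup>n\<close>, and
  \<open>binomial_sum_reciprocal_le\<close> handles the rest.
\<close>

lemma x_seq_upper:
  assumes "d \<ge> 3"
  obtains C where "\<And>n. real (x_seq d n) \<le> C * (real d ^ 2) ^ n / real (n + 1)"
proof -
  have "\<exists>C. \<forall>n. real (x_seq d n) \<le> C * (real d ^ 2) ^ n / real (n + 1)"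
    using assms
  proof (induction d rule: dec_induct)
    case base
    show ?case using x_seq_3_upper by (intro exI[of _ "25 / 16"]) simp
  next
    case (step d)
    then obtain C where C: "\<And>n. real (x_seq d n) \<le> C * (real d ^ 2) ^ n / real (n + 1)" by blast
    have C0: "C \<ge> 0" using C[of 0] by (simp add: x_seq_start)
    define C' where "C' = C * real (Suc d) / real d"
    have "real (x_seq (Suc d) n) \<le> C' * (real (Suc d) ^ 2) ^ n / real (n + 1)" for n
    proof -
      have "real (x_seq (Suc d) n) = (\<Sum>k\<le>n. real (n choose k) ^ 2 * real (x_seq d k))"
        by (simp add: x_seq_Suc)
      also have "\<dots> \<le> (\<Sum>k\<le>n. real (Suc d) ^ n * C * (real (n choose k) * real d ^ k / real (k + 1)))"
      proof (rule sum_mono)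
        fix k assume k: "k \<in> {..n}"
        have "real (n choose k) ^ 2 * real (x_seq d k) \<le>
            real (n choose k) ^ 2 * (C * (real d ^ 2) ^ k / real (k + 1))"
          by (intro mult_left_mono C) auto
        also have "\<dots> = (real (n choose k) * real d ^ k) * (C * (real (n choose k) * real d ^ k / real (k + 1)))"
          by (simp add: power2_eq_square power_mult_distrib)
        also have "\<dots> \<le> real (Suc d) ^ n * (C * (real (n choose k) * real d ^ k / real (k + 1)))"
          using k C0 by (intro mult_right_mono binomial_power_le mult_nonneg_nonneg divide_nonneg_nonneg) auto
        finally show "real (n choose k) ^ 2 * real (x_seq d k) \<le>
          real (Suc d) ^ n * C * (real (n choose k) * real d ^ k / real (k + 1))" by (simp only: mult.assoc)
      qed
      also have "\<dots> = real (Suc d) ^ n * C * (\<Sum>k\<le>n. real (n choose k) * real d ^ k / real (k + 1))"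
        by (rule sum_distrib_left[symmetric])
      also have "\<dots> \<le> real (Suc d) ^ n * C * ((real d + 1) ^ Suc n / (real d * real (n + 1)))"
        using step C0 by (intro mult_left_mono binomial_sum_reciprocal_le) auto
      also have "\<dots> = C' * (real (Suc d) ^ 2) ^ n / real (n + 1)"
        by (simp add: C'_def power2_eq_square power_mult_distrib add.commute)
      finally show ?thesis .
    qed
    thus ?case by blast
  qed
  with that show ?thesis by blast
qed

lemma A_seq_lower: "(4 * real (Suc e) ^ 2) ^ n \<le> real (A_seq (Suc e) n) * real (n + 1) ^ Suc e"
proof -
  have "(4 * real (Suc e) ^ 2) ^ n = real (Suc 1) ^ (2 * n) * real (Suc e) ^ (2 * n)"
    by (simp add: power_mult_distrib power_mult)
  also have "\<dots> \<le> (real (x_seq (Suc 1) n) * real (n + 1) ^ 1) * (real (x_seq (Suc e) n) * real (n + 1) ^ e)"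
    by (intro mult_mono x_seq_lower) auto
  also have "\<dots> = real (A_seq (Suc e) n) * real (n + 1) ^ Suc e"
    unfolding A_seq_eq Suc_1 of_nat_mult power_Suc by (simp only: mult_ac power_one_right)
  finally show ?thesis .
qed

lemma A_seq_upper:
  assumes "d \<ge> 2"
  obtains C where "\<And>n. real (A_seq d n) \<le> C * (4 * real d ^ 2) ^ n / real (n + 1)"
proof (cases "d = 2")
  case True
  have "real (A_seq d n) \<le> 1 * (4 * real d ^ 2) ^ n / real (n + 1)" for n
  proof -
    have "A_seq d n = ((2 * n) choose n) ^ 2"
      by (simp add: True A_seq_eq x_seq_dim_2 power2_eq_square)
    hence "A_seq d n * (n + 1) \<le> ((2 * n) choose n) ^ 2 * (2 * n + 1)" by simp
    also have "\<dots> \<le> 16 ^ n" by (rule central_binomial_square_le)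
    finally have "real (A_seq d n * (n + 1)) \<le> real (16 ^ n)" by (simp only: of_nat_le_iff)
    thus ?thesis by (simp add: True pos_le_divide_eq distrib_left)
  qed
  with that show ?thesis by blast
next
  case False
  with assms have "d \<ge> 3" by simp
  then obtain C where C: "\<And>n. real (x_seq d n) \<le> C * (real d ^ 2) ^ n / real (n + 1)"
    using x_seq_upper by blast
  have "real (A_seq d n) \<le> C * (4 * real d ^ 2) ^ n / real (n + 1)" for n
  proof -
    have "(2 * n) choose n \<le> 2 ^ (2 * n)" by (rule binomial_le_pow2)
    hence "real ((2 * n) choose n) \<le> real (2 ^ (2 * n))" by (simp only: of_nat_le_iff)
    hence "real ((2 * n) choose n) \<le> 4 ^ n" by (simp add: power_mult)
    hence "real (x_seq 2 n) * real (x_seq d n) \<le> 4 ^ n * (C * (real d ^ 2) ^ n / real (n + 1))"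
      unfolding x_seq_dim_2 by (intro mult_mono C) auto
    thus ?thesis by (simp add: A_seq_eq power_mult_distrib mult_ac)
  qed
  with that show ?thesis by blast
qed

lemma x_seq_no_first_order_ode:
  assumes "d \<ge> 3" "q \<noteq> 0"
  shows "fps_of_poly q * fps_deriv (Abs_fps (\<lambda>n. int (x_seq d n))) \<noteq> fps_of_poly S * Abs_fps (\<lambda>n. int (x_seq d n))"
proof -
  obtain C where C: "\<And>n. real (x_seq d n) \<le> C * (real d ^ 2) ^ n / real (n + 1)"
    using x_seq_upper[OF assms(1)] by blast
  obtain e where e: "d = Suc e" using assms(1) by (cases d) auto
  show ?thesis
  proof (rule no_first_order_ode_of_growth[OF _ _ C _ assms(2)])
    show "(real d ^ 2) ^ n \<le> real (x_seq d n) * real (n + 1) ^ e" for n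
      using x_seq_lower[of e n] by (simp add: e power_mult)
  qed (use assms in \<open>simp_all add: x_seq_start\<close>)
qed

lemma A_seq_no_first_order_ode:
  assumes "d \<ge> 2" "q \<noteq> 0"
  shows "fps_of_poly q * fps_deriv (Abs_fps (\<lambda>n. int (A_seq d n))) \<noteq> fps_of_poly S * Abs_fps (\<lambda>n. int (A_seq d n))"
proof -
  obtain C where C: "\<And>n. real (A_seq d n) \<le> C * (4 * real d ^ 2) ^ n / real (n + 1)"
    using A_seq_upper[OF assms(1)] by blast
  obtain e where e: "d = Suc e" using assms(1) by (cases d) auto
  show ?thesis
  proof (rule no_first_order_ode_of_growth[OF _ _ C _ assms(2)])
    show "(4 * real d ^ 2) ^ n \<le> real (A_seq d n) * real (n + 1) ^ Suc e" for n
      unfolding e by (rule A_seq_lower)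
  qed (use assms in \<open>simp_all add: A_seq_start\<close>)
qed

section \<open>P-recursiveness\<close>

text \<open>
  The modified Bessel function of order \<open>0\<close> at \<open>2 sqrt z\<close>.
\<close>

definition squared_inverse_factorials :: "'a::field_char_0 fps" where
  "squared_inverse_factorials = Abs_fps (\<lambda>n. 1 / fact n ^ 2)"

lemma euler_fps_mult: "euler_fps (u * v) = euler_fps u * v + u * euler_fps v"
  by (simp add: euler_fps_def algebra_simps)

lemma euler_fps_power: "euler_fps (u ^ n) = of_nat n * u ^ (n - 1) * euler_fps u"
  by (simp add: euler_fps_def fps_deriv_power mult_ac fps_of_nat)

lemma euler_fps_const_mult: "euler_fps (of_nat c * u) = of_nat c * euler_fps u"
  by (simp add: euler_fps_def algebra_simps fps_of_nat[symmetric])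

lemma bessel_ode:
  "euler_fps (euler_fps squared_inverse_factorials) = fps_X * squared_inverse_factorials"
proof (rule fps_ext)
  fix n
  show "fps_nth (euler_fps (euler_fps squared_inverse_factorials)) n =
    fps_nth (fps_X * squared_inverse_factorials :: 'a fps) n"
    by (cases n) (simp_all add: nth_euler_fps squared_inverse_factorials_def divide_simps power2_eq_square
       del: of_nat_Suc)
qed

text \<open>
  With \<open>\<theta> = z d/dz\<close> and a solution \<open>H\<close> of \<open>\<theta>\<^sup>2 H = z H\<close>, these operators map \<open>H\<^sup>d\<close> to multiples
  of \<open>H\<^bsup>d - k\<^esup> (\<theta> H)\<^sup>k\<close>; the operator number \<open>d + 1\<close> is the \<open>d\<close>-th symmetric power of the
  equation.
\<close>

fun sym_power_op :: "nat \<Rightarrow> nat \<Rightarrow> 'a::comm_ring_1 fps \<Rightarrow> 'a fps" where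
  "sym_power_op d 0 u = u"
| "sym_power_op d (Suc 0) u = euler_fps u"
| "sym_power_op d (Suc (Suc k)) u =
     euler_fps (sym_power_op d (Suc k) u) - of_nat (Suc k * (d - k)) * fps_X * sym_power_op d k u"

text \<open>
  Applying \<open>\<theta>\<close> to \<open>H\<^bsup>d - k\<^esup> (\<theta> H)\<^sup>k\<close> gives a multiple of the next product and, since
  \<open>\<theta>\<^sup>2 H = z H\<close>, a multiple of \<open>z\<close> times the previous one, which the operator subtracts.  For
  \<open>k = d + 1\<close> the numerical factor contains \<open>d - d = 0\<close>.
\<close>

lemma sym_power_op_power:
  fixes H :: "'a::comm_ring_1 fps"
  assumes H: "euler_fps (euler_fps H) = fps_X * H"
  shows "k \<le> Suc d \<Longrightarrow>
    sym_power_op d k (H ^ d) = of_nat (\<Prod>i<k. d - i) * H ^ (d - k) * euler_fps H ^ k"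
proof (induction d k "H ^ d" rule: sym_power_op.induct)
  case (2 d)
  show ?case by (simp add: euler_fps_power)
next
  case (3 d k)
  define G where "G = euler_fps H"
  define c where "c = (\<Prod>i<k. d - i)"
  have G: "euler_fps G = fps_X * H" using H by (simp add: G_def)
  have kd: "k < d" using 3 by simp
  have IH: "sym_power_op d (Suc k) (H ^ d) = of_nat (c * (d - k)) * (H ^ (d - Suc k) * G ^ Suc k)"
    "sym_power_op d k (H ^ d) = of_nat c * H ^ (d - k) * G ^ k"
    using 3 by (simp_all add: c_def G_def mult.assoc)
  have Hk: "H ^ (d - k) = H ^ (d - Suc k) * H"
    using kd by (metis Suc_diff_Suc power_Suc2)
  have "sym_power_op d (Suc (Suc k)) (H ^ d) =
      of_nat (c * (d - k)) * (of_nat (d - Suc k) * H ^ (d - Suc k - 1) * G * G ^ Suc k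
         + H ^ (d - Suc k) * (of_nat (Suc k) * G ^ k * (fps_X * H)))
      - of_nat (Suc k * (d - k)) * fps_X * (of_nat c * H ^ (d - k) * G ^ k)"
    unfolding sym_power_op.simps IH
    unfolding euler_fps_const_mult
    unfolding euler_fps_mult euler_fps_power G_def[symmetric] G
    by simp
  also have "\<dots> = of_nat (c * (d - k) * (d - Suc k)) * H ^ (d - Suc k - 1) * G ^ Suc (Suc k)"
    unfolding Hk of_nat_mult power_Suc by (simp only: algebra_simps)
  also have "c * (d - k) * (d - Suc k) = (\<Prod>i<Suc (Suc k). d - i)" by (simp add: c_def)
  finally show ?case by (simp add: G_def)
qed auto

text \<open>
  The coefficient, as a polynomial in \<open>n\<close>, with which the \<open>(n - j)\<close>-th coefficient of a series
  enters the \<open>n\<close>-th coefficient of its image under \<open>sym_power_op d k\<close>.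
\<close>

fun sym_power_coeff :: "nat \<Rightarrow> nat \<Rightarrow> nat \<Rightarrow> 'a::comm_ring_1 poly" where
  "sym_power_coeff d 0 j = (if j = 0 then 1 else 0)"
| "sym_power_coeff d (Suc 0) j = (if j = 0 then [:0, 1:] else 0)"
| "sym_power_coeff d (Suc (Suc k)) j = [:0, 1:] * sym_power_coeff d (Suc k) j -
     (if j = 0 then 0 else of_nat (Suc k * (d - k)) * pcompose (sym_power_coeff d k (j - 1)) [:-1, 1:])"

lemma sym_power_coeff_0: "sym_power_coeff d k 0 = [:0, 1:] ^ k"
  by (induction d k "0::nat" rule: sym_power_coeff.induct) simp_all

lemma sym_power_coeff_beyond: "k < j \<Longrightarrow> sym_power_coeff d k j = 0"
  by (induction d k j rule: sym_power_coeff.induct) simp_all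

lemma nth_sym_power_op:
  "fps_nth (sym_power_op d k u) n = (\<Sum>j\<le>n. poly (sym_power_coeff d k j) (of_nat n) * fps_nth u (n - j))"
proof (induction d k u arbitrary: n rule: sym_power_op.induct)
  case (1 d u)
  have "(\<Sum>j\<le>n. poly (sym_power_coeff d 0 j) (of_nat n) * fps_nth u (n - j)) =
    (\<Sum>j\<le>n. if j = 0 then fps_nth u n else 0)" by (rule sum.cong) auto
  thus ?case by simp
next
  case (2 d u)
  have "(\<Sum>j\<le>n. poly (sym_power_coeff d (Suc 0) j) (of_nat n) * fps_nth u (n - j)) =
    (\<Sum>j\<le>n. if j = 0 then of_nat n * fps_nth u n else 0)" by (rule sum.cong) auto
  thus ?case by (simp add: nth_euler_fps)
next
  case (3 d k u)
  define a :: 'a where "a = of_nat (Suc k * (d - k))"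
  have shift: "fps_nth (of_nat (Suc k * (d - k)) * fps_X * sym_power_op d k u) n =
    (\<Sum>j\<le>n. if j = 0 then 0 else a * poly (sym_power_coeff d k (j - 1)) (of_nat n - 1) * fps_nth u (n - j))"
  proof (cases n)
    case (Suc m)
    have "fps_nth (of_nat (Suc k * (d - k)) * fps_X * sym_power_op d k u) n =
        a * fps_nth (sym_power_op d k u) m"
      unfolding a_def Suc fps_of_nat[symmetric] by (simp only: mult.assoc fps_mult_left_const_nth fps_X_mult_nth) simp
    also have "\<dots> = (\<Sum>j\<le>m. a * poly (sym_power_coeff d k j) (of_nat n - 1) * fps_nth u (m - j))"
      by (simp add: 3 sum_distrib_left mult.assoc Suc)
    also have "\<dots> = (\<Sum>j\<in>Suc ` {..m}. a * poly (sym_power_coeff d k (j - 1)) (of_nat n - 1) * fps_nth u (n - j))"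
      by (subst sum.reindex) (simp_all add: Suc)
    also have "\<dots> = (\<Sum>j\<le>n. if j = 0 then 0 else a * poly (sym_power_coeff d k (j - 1)) (of_nat n - 1) * fps_nth u (n - j))"
      by (rule sum.mono_neutral_cong_left) (auto simp: Suc image_iff Suc_le_eq gr0_conv_Suc)
    finally show ?thesis .
  qed simp
  have "fps_nth (sym_power_op d (Suc (Suc k)) u) n =
      (\<Sum>j\<le>n. of_nat n * (poly (sym_power_coeff d (Suc k) j) (of_nat n) * fps_nth u (n - j)))
      - (\<Sum>j\<le>n. if j = 0 then 0 else a * poly (sym_power_coeff d k (j - 1)) (of_nat n - 1) * fps_nth u (n - j))"
    unfolding sym_power_op.simps fps_sub_nth shift nth_euler_fps 3(1) sum_distrib_left ..
  also have "\<dots> = (\<Sum>j\<le>n. poly (sym_power_coeff d (Suc (Suc k)) j) (of_nat n) * fps_nth u (n - j))"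
    unfolding sum_subtractf[symmetric]
  proof (rule sum.cong[OF refl])
    fix j
    have a': "(of_nat (Suc k * (d - k)) :: 'a poly) = [:a:]" by (simp only: a_def of_nat_poly)
    show "of_nat n * (poly (sym_power_coeff d (Suc k) j) (of_nat n) * fps_nth u (n - j))
        - (if j = 0 then 0 else a * poly (sym_power_coeff d k (j - 1)) (of_nat n - 1) * fps_nth u (n - j)) =
        poly (sym_power_coeff d (Suc (Suc k)) j) (of_nat n) * fps_nth u (n - j)"
      unfolding sym_power_coeff.simps a'
      by (cases "j = 0") (simp_all add: poly_pcompose left_diff_distrib mult.assoc del: sym_power_coeff.simps)
  qed
  finally show ?case .
qed

lemma P_recursive_of_backward_recurrence:
  fixes y :: "nat \<Rightarrow> 'a::field" and q :: "nat \<Rightarrow> 'a poly"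
  assumes q0: "q 0 \<noteq> 0"
    and rec: "\<And>n. n \<ge> r \<Longrightarrow> (\<Sum>j\<le>r. poly (q j) (of_nat n) * y (n - j)) = 0"
  shows "P_recursive y"
proof -
  define P where "P = (\<lambda>k. pcompose (q (r - k)) [:of_nat r, 1:])"
  have "P r \<noteq> 0" using q0 pcompose_eq_0[of "q 0" "[:of_nat r, 1:]"] by (auto simp: P_def)
  moreover have "(\<Sum>k\<le>r. poly (P k) (of_nat n) * y (n + k)) = 0" for n
  proof -
    have "(\<Sum>k\<le>r. poly (P k) (of_nat n) * y (n + k)) = (\<Sum>j\<le>r. poly (q j) (of_nat (n + r)) * y (n + r - j))"
      by (rule sum.reindex_bij_witness[of _ "\<lambda>j. r - j" "\<lambda>j. r - j"])
         (auto simp: P_def poly_pcompose add_ac)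
    thus ?thesis using rec[of "n + r"] by simp
  qed
  ultimately show ?thesis unfolding P_recursive_def by blast
qed

text \<open>
  Multiply the recurrence by \<open>w (n + r)\<close>, which is a polynomial multiple of every \<open>w (n + k)\<close>.
\<close>

lemma P_recursive_mult_hypergeometric:
  fixes y w :: "nat \<Rightarrow> 'a::field"
  assumes y: "P_recursive y" and s: "s \<noteq> 0" and w: "\<And>n. w (Suc n) = poly s (of_nat n) * w n"
  shows "P_recursive (\<lambda>n. w n * y n)"
proof -
  obtain r P n0 where ex: "\<exists>k\<le>r. P k \<noteq> 0"
    and rec: "\<And>n. n \<ge> n0 \<Longrightarrow> (\<Sum>k\<le>r. poly (P k) (of_nat n) * y (n + k)) = 0"
    using y unfolding P_recursive_def by blast
  define S where "S = (\<lambda>k. \<Prod>i\<in>{k..<r}. pcompose s [:of_nat i, 1:])"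
  have "pcompose s [:of_nat i, 1:] \<noteq> 0" for i :: nat
    using s pcompose_eq_0[of s "[:of_nat i, 1:]"] by auto
  hence S0: "S k \<noteq> 0" for k by (simp add: S_def)
  have wS: "w (n + r) = poly (S k) (of_nat n) * w (n + k)" if "k \<le> r" for n k
    using that
  proof (induction "r - k" arbitrary: k)
    case 0
    thus ?case by (simp add: S_def)
  next
    case (Suc m)
    hence "S k = pcompose s [:of_nat k, 1:] * S (Suc k)"
      by (simp add: S_def prod.atLeast_Suc_lessThan)
    moreover have "w (n + r) = poly (S (Suc k)) (of_nat n) * w (n + Suc k)"
      using Suc.hyps Suc.prems by (intro Suc.hyps) auto
    ultimately show ?case by (simp add: w poly_pcompose mult_ac add_ac)
  qed
  have rec': "(\<Sum>k\<le>r. poly (P k * S k) (of_nat n) * (w (n + k) * y (n + k))) = 0" if "n \<ge> n0" for n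
  proof -
    have "(\<Sum>k\<le>r. poly (P k * S k) (of_nat n) * (w (n + k) * y (n + k))) =
      (\<Sum>k\<le>r. w (n + r) * (poly (P k) (of_nat n) * y (n + k)))"
      by (rule sum.cong[OF refl]) (simp add: wS mult_ac)
    thus ?thesis using rec[OF that] by (simp flip: sum_distrib_left)
  qed
  show ?thesis
    unfolding P_recursive_def
  proof (rule exI[of _ r], rule exI[of _ "\<lambda>k. P k * S k"], rule exI[of _ n0], intro conjI allI impI)
    show "\<exists>k\<le>r. P k * S k \<noteq> 0" using ex S0 by auto
    show "(\<Sum>k\<le>r. poly (P k * S k) (of_nat n) * (w (n + k) * y (n + k))) = 0" if "n0 \<le> n" for n
      using that by (rule rec')
  qed
qed

lemma P_recursive_bessel_power:
  "P_recursive (\<lambda>n. fps_nth (squared_inverse_factorials ^ d :: 'a::field_char_0 fps) n)"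
proof (rule P_recursive_of_backward_recurrence)
  show "sym_power_coeff d (Suc d) 0 \<noteq> (0 :: 'a poly)" by (simp add: sym_power_coeff_0)
  have zero: "sym_power_op d (Suc d) (squared_inverse_factorials ^ d :: 'a fps) = 0"
    by (subst sym_power_op_power[OF bessel_ode]) simp_all
  fix n assume n: "n \<ge> Suc d"
  have "(\<Sum>j\<le>Suc d. poly (sym_power_coeff d (Suc d) j) (of_nat n) *
      fps_nth (squared_inverse_factorials ^ d :: 'a fps) (n - j)) =
    (\<Sum>j\<le>n. poly (sym_power_coeff d (Suc d) j) (of_nat n) *
      fps_nth (squared_inverse_factorials ^ d :: 'a fps) (n - j))"
    by (rule sum.mono_neutral_left) (use n in \<open>auto simp: sym_power_coeff_beyond\<close>)
  also have "\<dots> = 0" using zero by (simp flip: nth_sym_power_op)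
  finally show "(\<Sum>j\<le>Suc d. poly (sym_power_coeff d (Suc d) j) (of_nat n) *
      fps_nth (squared_inverse_factorials ^ d :: 'a fps) (n - j)) = 0" .
qed

text \<open>
  Division by \<open>(n!)\<^sup>2\<close> turns the recursion of \<open>x_seq\<close> into a Cauchy product.
\<close>

lemma nth_bessel_power:
  "fps_nth (squared_inverse_factorials ^ d :: 'a::field_char_0 fps) n = of_nat (x_seq d n) / fact n ^ 2"
proof (induction d arbitrary: n)
  case 0
  show ?case by (simp add: x_seq_0_dim)
next
  case (Suc d)
  have "fps_nth (squared_inverse_factorials ^ d * squared_inverse_factorials :: 'a fps) n =
    (\<Sum>k\<le>n. of_nat (x_seq d k) / fact k ^ 2 * (1 / fact (n - k) ^ 2))"
    unfolding fps_mult_nth Suc.IH by (simp add: squared_inverse_factorials_def atLeast0AtMost)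
  also have "\<dots> = (\<Sum>k\<le>n. of_nat ((n choose k) ^ 2 * x_seq d k) / fact n ^ 2)"
    by (intro sum.cong refl) (simp add: binomial_fact power_divide power_mult_distrib)
  also have "\<dots> = of_nat (x_seq (Suc d) n) / fact n ^ 2"
    by (simp add: x_seq_Suc sum_divide_distrib)
  finally show ?case by (simp add: mult.commute)
qed

lemma P_recursive_x_seq: "P_recursive (\<lambda>n. of_nat (x_seq d n) :: 'a::field_char_0)"
proof -
  have "P_recursive (\<lambda>n. fact n ^ 2 * fps_nth (squared_inverse_factorials ^ d) n :: 'a)"
  proof (rule P_recursive_mult_hypergeometric[OF P_recursive_bessel_power])
    show "[:1, 1:] ^ 2 \<noteq> (0 :: 'a poly)" by simp
    show "fact (Suc n) ^ 2 = poly ([:1, 1:] ^ 2) (of_nat n) * (fact n ^ 2 :: 'a)" for n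
      by (simp add: power_mult_distrib)
  qed
  thus ?thesis by (simp add: nth_bessel_power)
qed

lemma P_recursive_A_seq: "P_recursive (\<lambda>n. of_nat (A_seq d n) :: 'a::field_char_0)"
proof -
  have "P_recursive (\<lambda>n. fact (2 * n) * fps_nth (squared_inverse_factorials ^ d) n :: 'a)"
  proof (rule P_recursive_mult_hypergeometric[OF P_recursive_bessel_power])
    show "[:1, 2:] * [:2, 2:] \<noteq> (0 :: 'a poly)" by simp
    show "fact (2 * Suc n) = poly ([:1, 2:] * [:2, 2:]) (of_nat n) * (fact (2 * n) :: 'a)" for n
      by (simp add: algebra_simps)
  qed
  moreover have "fact (2 * n) * fps_nth (squared_inverse_factorials ^ d) n = (of_nat (A_seq d n) :: 'a)" for n
    by (simp add: nth_bessel_power A_seq_eq x_seq_dim_2 binomial_fact mult_2 power2_eq_square)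
  ultimately show ?thesis by simp
qed

section \<open>First returns\<close>

lemma endpoint_append: "endpoint (u @ v) = (\<lambda>j. endpoint u j + endpoint v j)"
  by (simp add: endpoint_def)

lemma closed_walk_even_length:
  assumes "w \<in> closed_walks d m"
  shows "even m"
proof (rule ccontr)
  assume "odd m"
  hence "card (closed_walks d m) = 0" using card_closed_walks_dvd[of m d] by blast
  with assms show False by (simp add: finite_closed_walks)
qed

text \<open>
  Cut a closed walk at its first return to the origin.
\<close>

lemma first_return_decomposition:
  assumes n: "n > 0"
  shows "bij_betw (\<lambda>(k, u, v). u @ v)
    (SIGMA k:{1..n}. first_return_walks d (2 * k) \<times> closed_walks d (2 * (n - k))) (closed_walks d (2 * n))"
  unfolding bij_betw_def
proof
  show "inj_on (\<lambda>(k, u, v). u @ v)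
    (SIGMA k:{1..n}. first_return_walks d (2 * k) \<times> closed_walks d (2 * (n - k)))"
  proof (rule inj_onI)
    fix x y :: "nat \<times> (nat \<Rightarrow> int) list \<times> (nat \<Rightarrow> int) list"
    obtain k u v k' u' v' where xy: "x = (k, u, v)" "y = (k', u', v')" by (metis surj_pair)
    assume "x \<in> (SIGMA k:{1..n}. first_return_walks d (2 * k) \<times> closed_walks d (2 * (n - k)))"
      "y \<in> (SIGMA k:{1..n}. first_return_walks d (2 * k) \<times> closed_walks d (2 * (n - k)))"
      and "(\<lambda>(k, u, v). u @ v) x = (\<lambda>(k, u, v). u @ v) y"
    hence k: "k \<in> {1..n}" "k' \<in> {1..n}"
      and u: "u \<in> first_return_walks d (2 * k)" and u': "u' \<in> first_return_walks d (2 * k')"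
      and eq: "u @ v = u' @ v'"
      by (auto simp: xy)
    have len: "length u = 2 * k" "length u' = 2 * k'"
      using u u' by (simp_all add: first_return_walks_def closed_walks_def walks_def)
    have no: "\<not> a < b" if "x \<in> first_return_walks d (2 * a)" "y \<in> first_return_walks d (2 * b)"
      "x @ s = y @ t" "a \<ge> 1" for a b :: nat and x y s t
    proof
      assume "a < b"
      have "length x = 2 * a" "length y = 2 * b" "endpoint x = (\<lambda>j. 0)"
        using that by (simp_all add: first_return_walks_def closed_walks_def walks_def)
      hence "take (2 * a) y = x"
        using arg_cong[OF that(3), of "take (2 * a)"] \<open>a < b\<close> by simp
      with \<open>a < b\<close> \<open>endpoint x = (\<lambda>j. 0)\<close> that(2,4) show False
        by (auto simp: first_return_walks_def)
    qed
    have "k = k'" using no[OF u u' eq] no[OF u' u eq[symmetric]] k by auto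
    thus "x = y" using eq len by (simp add: xy)
  qed
next
  show "(\<lambda>(k, u, v). u @ v) `
    (SIGMA k:{1..n}. first_return_walks d (2 * k) \<times> closed_walks d (2 * (n - k))) = closed_walks d (2 * n)"
  proof (intro equalityI subsetI)
    fix w assume "w \<in> (\<lambda>(k, u, v). u @ v) `
      (SIGMA k:{1..n}. first_return_walks d (2 * k) \<times> closed_walks d (2 * (n - k)))"
    thus "w \<in> closed_walks d (2 * n)"
      by (auto simp: first_return_walks_def closed_walks_def walks_def endpoint_append)
  next
    fix w assume w: "w \<in> closed_walks d (2 * n)"
    define P where "P = (\<lambda>m. 0 < m \<and> endpoint (take m w) = (\<lambda>j. 0))"
    have len: "length w = 2 * n" using w by (simp add: closed_walks_def walks_def)
    have "P (2 * n)" using w n len by (simp add: P_def closed_walks_def)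
    define m where "m = (LEAST m. P m)"
    have Pm: "P m" unfolding m_def using \<open>P (2 * n)\<close> by (rule LeastI)
    have m_le: "m \<le> 2 * n" unfolding m_def using \<open>P (2 * n)\<close> by (rule Least_le)
    have min: "\<not> P k" if "k < m" for k using that unfolding m_def by (rule not_less_Least)
    have u: "take m w \<in> closed_walks d m"
      using w Pm m_le len by (auto simp: P_def closed_walks_def walks_def dest: in_set_takeD)
    then obtain k where k: "m = 2 * k" using closed_walk_even_length by blast
    have "take m w \<in> first_return_walks d (2 * k)"
      unfolding first_return_walks_def using u Pm min k by (auto simp: P_def min_def)
    moreover have "endpoint (drop m w) = (\<lambda>j. 0)"
    proof
      fix j
      have "endpoint w j = endpoint (take m w) j + endpoint (drop m w) j"
        using endpoint_append[of "take m w" "drop m w"] by simp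
      thus "endpoint (drop m w) j = 0" using w Pm by (simp add: P_def closed_walks_def)
    qed
    hence "drop m w \<in> closed_walks d (2 * (n - k))"
      using w len k by (auto simp: closed_walks_def walks_def dest: in_set_dropD)
    moreover have "k \<in> {1..n}" using Pm m_le k by (auto simp: P_def)
    ultimately show "w \<in> (\<lambda>(k, u, v). u @ v) `
      (SIGMA k:{1..n}. first_return_walks d (2 * k) \<times> closed_walks d (2 * (n - k)))"
      by (intro image_eqI[of _ _ "(k, take m w, drop m w)"]) auto
  qed
qed

lemma A_seq_renewal:
  assumes "n > 0"
  shows "A_seq d n = (\<Sum>k\<in>{1..n}. B_seq d k * A_seq d (n - k))"
proof -
  have fin: "finite (first_return_walks d m)" for m
    by (rule finite_subset[OF _ finite_closed_walks[of d m]]) (auto simp: first_return_walks_def)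
  have "A_seq d n = card (SIGMA k:{1..n}. first_return_walks d (2 * k) \<times> closed_walks d (2 * (n - k)))"
    unfolding A_seq_def using bij_betw_same_card[OF first_return_decomposition[OF assms]] by simp
  also have "\<dots> = (\<Sum>k\<in>{1..n}. B_seq d k * A_seq d (n - k))"
    by (simp add: card_SigmaI fin finite_closed_walks card_cartesian_product A_seq_def B_seq_def)
  finally show ?thesis .
qed

lemma B_seq_0: "B_seq d 0 = 0"
  by (simp add: B_seq_def first_return_walks_def)

lemma A_fps_times_one_minus_B_fps:
  "Abs_fps (\<lambda>n. int (A_seq d n)) * (1 - Abs_fps (\<lambda>n. int (B_seq d n))) = 1"
proof (rule fps_ext)
  fix n
  define A where "A = Abs_fps (\<lambda>n. int (A_seq d n))"
  define B where "B = Abs_fps (\<lambda>n. int (B_seq d n))"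
  have "fps_nth (A * (1 - B)) n = int (A_seq d n) - fps_nth (B * A) n"
    by (simp add: A_def algebra_simps)
  also have "fps_nth (B * A) n = int (\<Sum>k\<in>{0..n}. B_seq d k * A_seq d (n - k))"
    by (simp add: fps_mult_nth A_def B_def)
  also have "(\<Sum>k\<in>{0..n}. B_seq d k * A_seq d (n - k)) = (\<Sum>k\<in>{1..n}. B_seq d k * A_seq d (n - k))"
    by (rule sum.mono_neutral_right) (auto simp: B_seq_0 Suc_le_eq)
  also have "int (A_seq d n) - int \<dots> = fps_nth 1 n"
    using A_seq_renewal[of n d] A_seq_start[of d] by (cases "n = 0") auto
  finally show "fps_nth (A * (1 - B)) n = fps_nth 1 n" .
qed

section \<open>Transcendence and first returns that are not P-recursive\<close>

text \<open>
  \<open>1 - B = 1/A\<close>, so otherwise \<open>A\<close> and its inverse would both be P-recursive.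
\<close>

lemma B_seq_not_P_recursive:
  assumes "d \<ge> 2"
  shows "\<not> P_recursive (\<lambda>n. of_nat (B_seq d n) :: 'a::field_char_0)"
proof
  assume B: "P_recursive (\<lambda>n. of_nat (B_seq d n) :: 'a)"
  define g where "g = (\<lambda>n. if n = 0 then 1 else - int (B_seq d n))"
  have g: "Abs_fps g = 1 - Abs_fps (\<lambda>n. int (B_seq d n))"
    by (rule fps_ext) (simp add: g_def B_seq_0)
  obtain r n0 and P :: "nat \<Rightarrow> 'a poly" where ex: "\<exists>k\<le>r. P k \<noteq> 0"
    and rec: "\<And>n. n \<ge> n0 \<Longrightarrow> (\<Sum>k\<le>r. poly (P k) (of_nat n) * of_nat (B_seq d (n + k))) = 0"
    using B unfolding P_recursive_def by blast
  have "(\<Sum>k\<le>r. poly (P k) (of_nat n) * of_int (g (n + k))) = 0" if n: "n \<ge> Suc n0" for n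
  proof -
    have "(\<Sum>k\<le>r. poly (P k) (of_nat n) * of_int (g (n + k))) =
      (\<Sum>k\<le>r. - (poly (P k) (of_nat n) * of_nat (B_seq d (n + k))))"
      using n by (intro sum.cong refl) (simp add: g_def)
    also have "\<dots> = 0" using rec[of n] n by (simp add: sum_negf)
    finally show ?thesis .
  qed
  with ex have "P_recursive (\<lambda>n. of_int (g n) :: 'a)" unfolding P_recursive_def by blast
  moreover have "P_recursive (\<lambda>n. of_int (int (A_seq d n)) :: 'a)" using P_recursive_A_seq by simp
  ultimately obtain q S where "q \<noteq> 0"
    "fps_of_poly q * fps_deriv (Abs_fps (\<lambda>n. int (A_seq d n))) = fps_of_poly S * Abs_fps (\<lambda>n. int (A_seq d n))"
    using P_recursive_lucas_first_order_ode[of "\<lambda>n. int (A_seq d n)" g, where 'a = 'a]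
      lucas_mod_A_seq[of _ d] A_seq_start[of d] A_fps_times_one_minus_B_fps[of d] unfolding g by auto
  with A_seq_no_first_order_ode[OF assms] show False by blast
qed

lemma x_seq_transcendental:
  assumes "d \<ge> 3"
  shows "transcendental_seq (\<lambda>n. of_nat (x_seq d n) :: 'a::field_char_0)"
proof
  assume "algebraic_seq (\<lambda>n. of_nat (x_seq d n) :: 'a)"
  hence "algebraic_seq (\<lambda>n. of_int (int (x_seq d n)) :: 'a)" by simp
  from algebraic_lucas_first_order_ode[OF lucas_mod_x_seq _ this] x_seq_start[of d]
    x_seq_no_first_order_ode[OF assms] show False by (metis of_nat_1)
qed

lemma A_seq_transcendental:
  assumes "d \<ge> 2"
  shows "transcendental_seq (\<lambda>n. of_nat (A_seq d n) :: 'a::field_char_0)"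
proof
  assume "algebraic_seq (\<lambda>n. of_nat (A_seq d n) :: 'a)"
  hence "algebraic_seq (\<lambda>n. of_int (int (A_seq d n)) :: 'a)" by simp
  from algebraic_lucas_first_order_ode[OF lucas_mod_A_seq _ this] A_seq_start[of d]
    A_seq_no_first_order_ode[OF assms] show False by (metis of_nat_1)
qed

lemma algebraic_seq_mod_x_seq: "prime p \<Longrightarrow> algebraic_seq_mod p (\<lambda>n. int (x_seq d n))"
  using lucas_claims lucas_mod_x_seq unfolding lucas_claims_def by blast

lemma algebraic_seq_mod_A_seq: "prime p \<Longrightarrow> algebraic_seq_mod p (\<lambda>n. int (A_seq d n))"
  using lucas_claims lucas_mod_A_seq unfolding lucas_claims_def by blast

theorem theorem8:
  shows
    "(\<forall>d\<ge>3. P_recursive (\<lambda>n. (of_nat (x_seq d n) :: complex)) \<and>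
            transcendental_seq (\<lambda>n. (of_nat (x_seq d n) :: complex)) \<and>
            (\<forall>p. prime p \<longrightarrow> algebraic_seq_mod p (\<lambda>n. int (x_seq d n)))) \<and>
     (\<forall>d\<ge>2. P_recursive (\<lambda>n. (of_nat (A_seq d n) :: complex)) \<and>
            transcendental_seq (\<lambda>n. (of_nat (A_seq d n) :: complex)) \<and>
            (\<forall>p. prime p \<longrightarrow> algebraic_seq_mod p (\<lambda>n. int (A_seq d n)))) \<and>
     (\<forall>d\<ge>2. \<not> P_recursive (\<lambda>n. (of_nat (B_seq d n) :: complex)))"
  by (simp add: P_recursive_x_seq x_seq_transcendental algebraic_seq_mod_x_seq
      P_recursive_A_seq A_seq_transcendental algebraic_seq_mod_A_seq B_seq_not_P_recursive)

end
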